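(* Let $\boldsymbol{a}=(a_0,a_1,\dots)$ be factorial parameters and $\boldsymbol{x}=(x_1,\dots,x_n)$. Define the modified Pieri coefficients $c^\lambda_{\mu,r}(\boldsymbol{a})$ ($r\ge 0$) by the relation $$P_\mu(\boldsymbol{x}|\boldsymbol{a})\cdot q_r(\boldsymbol{x})=\sum_\lambda c^\lambda_{\mu,r}(\boldsymbol{a})P_\lambda(\boldsymbol{x}|\boldsymbol{a}),$$ where $q_r(\boldsymbol{x})=Q_{(r)}(\boldsymbol{x})$ is Schur's $Q$-function, and $\mu$ is, and $\lambda$ runs over all, strict partitions of length $\le n$. For two strict partitions $\lambda$ and $\mu$ of length $\le n$, consider the generating function $$c^\lambda_\mu(z|\boldsymbol{a})=\sum_{r=0}^\infty c^\lambda_{\mu,r}(\boldsymbol{a})z^r.$$ Then, with $S(\lambda)\supset S(\mu)$ in (1) and (2), we have the following. (1) If the skew shifted diagram $S(\lambda/\mu)$ contains a $2\times2$ block of cells, then $c^\lambda_\mu(z|\boldsymbol{a})=0$. (2) Suppose that $S(\lambda/\mu)$ contains no $2\times 2$ block of cells. Let $$S(\lambda/\mu)=\bigsqcup_{i=1}^rS\big((\lambda_{m(i)},\dots,\lambda_{M(i)})/(\mu_{m(i)},\dots,\mu_{M(i)})\big)$$ be the decomposition of $S(\lambda/\mu)$ into a disjoint union of border strips (its connected components), where $m(1)\le M(1)<m(2)\le M(2)<\dots<m(r)\le M(r)$. Then $$c^\lambda_\mu(z|\boldsymbol{a})=\prod_{k\in K}\frac{1+a_{\mu_k}z}{1-a_{\mu_k}z}\;\prod_{i=1}^r\frac{2z^{\lambda_{m(i)}-\mu_{M(i)}}}{\prod_{j=\mu_{M(i)}}^{\lambda_{m(i)}}(1-a_jz)},$$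 where $$K=\begin{cases}\{k:1\le k\le l(\mu),\ \lambda_k=\mu_k\}&\text{if $n+l(\mu)$ is even,}\\ \{k:1\le k\le l(\mu)+1,\ \lambda_k=\mu_k\}&\text{if $n+l(\mu)$ is odd.}\end{cases}$$ (3) In particular, the modified Pieri coefficient $c^\lambda_{\mu,r}(\boldsymbol{a})$ is a polynomial in the factorial parameters $a_0,a_1,\dots$ with nonnegative integer coefficients.
   Context: $\mathbb{F}$ is a field of characteristic $0$ containing the parameters $a_0,a_1,\dots$ (regarded as indeterminates in part (3)). A strict partition of length $l=l(\lambda)$ is a strictly decreasing sequence $\lambda=(\lambda_1>\dots>\lambda_l)$ of positive integers (the empty sequence has length $0$); we set $\lambda_k=0$ for $k>l(\lambda)$. Factorial monomials: $(u|\boldsymbol{a})^d=\prod_{i=0}^{d-1}(u-a_i)$ for $d\ge0$. Factorial $P$-functions: put $A(\boldsymbol{x})=\left(\frac{x_j-x_i}{x_j+x_i}\right)_{1\le i,j\le n}$, $\Delta(\boldsymbol{x})=\prod_{1\le i<j\le n}\frac{x_j-x_i}{x_j+x_i}$, and for a sequence $\alpha=(\alpha_1,\dots,\alpha_s)$ of nonnegative integers $V_\alpha(\boldsymbol{x})=\big((x_i|\boldsymbol{a})^{\alpha_j}\big)_{1\le i\le n,\,1\le j\le s}$. Then $$P_\lambda(\boldsymbol{x}|\boldsymbol{a})=\frac{1}{\Delta(\boldsymbol{x})}\mathrm{Pf}\begin{pmatrix}A(\boldsymbol{x})&V_{\lambda^*}(\boldsymbol{x})\\-{}^tV_{\lambda^*}(\boldsymbol{x})&O\end{pmatrix},$$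 where $\mathrm{Pf}$ is the Pfaffian, $\lambda^*=\lambda$ if $n+l(\lambda)$ is even, $\lambda^*=(\lambda_1,\dots,\lambda_l,0)$ if $n+l(\lambda)$ is odd, and ${}^t$ denotes transpose. The $P_\lambda(\boldsymbol{x}|\boldsymbol{a})$ with $\lambda$ strict of length $\le n$ form an $\mathbb{F}$-basis of the ring of symmetric polynomials $f\in \mathbb{F}[x_1,\dots,x_n]^{S_n}$ such that $f(t,-t,x_3,\dots,x_n)$ is independent of $t$, and $P_\lambda(\boldsymbol{x}|\boldsymbol{a})=0$ if $l(\lambda)>n$. The Schur $Q$-functions $q_r(\boldsymbol{x})=Q_{(r)}(\boldsymbol{x})$, with $q_0=1$, are given by $\sum_{r\ge0}q_r(\boldsymbol{x})z^r=\prod_{i=1}^n\frac{1+x_iz}{1-x_iz}$. Shifted diagrams: $S(\lambda)=\{(i,j)\in\mathbb{Z}^2:1\le i\le l(\lambda),\ i\le j\le\lambda_i+i-1\}$ and $S(\lambda/\mu)=S(\lambda)\setminus S(\mu)$ when $S(\lambda)\supset S(\mu)$. A $2\times2$ block is a set of cells $\{(i,j),(i,j+1),(i+1,j),(i+1,j+1)\}$. A skew shifted diagram is a border strip if it is connected (via cells sharing an edge) and contains no $2\times2$ block. In (2), $S((\lambda_m,\dots,\lambda_M)/(\mu_m,\dots,\mu_M))$ denotes the part of $S(\lambda/\mu)$ lying in rows $m,\dots,M$; empty products are $1$.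
   Formalization: In (2) the product formula is stated only for l(λ) ≤ l(μ)+1; if S(λ/μ) has no 2×2 block and l(λ) ≥ l(μ)+2, the generating function is shown to be 0 instead, since the printed formula fails there: n=2, μ=∅, λ=(2,1), a=0 gives 0, not 2z^2. *)

theory Defs
  imports
    "HOL-Library.Poly_Mapping"
    "HOL-Computational_Algebra.Polynomial_Factorial"
    "HOL-Computational_Algebra.Formal_Power_Series"
    "HOL-Combinatorics.Permutations"
    "Jordan_Normal_Form.Matrix"
begin

section \<open>Strict partitions and shifted diagrams\<close>

definition strict_partition :: "nat list \<Rightarrow> bool" where
  "strict_partition lam \<longleftrightarrow> sorted_wrt (>) lam \<and> (\<forall>k\<in>set lam. 0 < k)"

text \<open>Parts are numbered from 1, and are 0 beyond the length.\<close>

definition part :: "nat list \<Rightarrow> nat \<Rightarrow> nat" where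
  "part lam k = (if 1 \<le> k \<and> k \<le> length lam then lam ! (k - 1) else 0)"

definition shifted_diagram :: "nat list \<Rightarrow> (nat \<times> nat) set" where
  "shifted_diagram lam =
     {(i, j). 1 \<le> i \<and> i \<le> length lam \<and> i \<le> j \<and> j \<le> part lam i + i - 1}"

definition skew_shifted_diagram :: "nat list \<Rightarrow> nat list \<Rightarrow> (nat \<times> nat) set" where
  "skew_shifted_diagram lam mu = shifted_diagram lam - shifted_diagram mu"

definition contains_block :: "(nat \<times> nat) set \<Rightarrow> bool" where
  "contains_block D \<longleftrightarrow> (\<exists>i j. {(i, j), (i, j + 1), (i + 1, j), (i + 1, j + 1)} \<subseteq> D)"

text \<open>
  Pitfall at the diagonal: \<open>{(i, i), (i, i + 1), (i + 1, i + 1)}\<close> is not a block, since \<open>(i + 1, i)\<close> is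
  not a cell of a shifted diagram.  A block-free \<open>S(\<lambda>/\<mu>)\<close> may therefore contain two diagonal cells,
  which happens iff \<open>l(\<lambda>) = l(\<mu>) + 2\<close>; its Pieri coefficients are then 0, and not given by
  the product formula for border strips (e.g. \<open>q\<^sub>2 = 2 P\<^bsub>(2)\<^esub>\<close> for \<open>n = 2\<close> and \<open>a = 0\<close> does not involve
  \<open>P\<^bsub>(2,1)\<^esub>\<close>).  The theorem treats this case separately.
\<close>

fun share_edge :: "nat \<times> nat \<Rightarrow> nat \<times> nat \<Rightarrow> bool" where
  "share_edge (i, j) (i', j') \<longleftrightarrow>
     i = i' \<and> (j' = j + 1 \<or> j = j' + 1) \<or> j = j' \<and> (i' = i + 1 \<or> i = i' + 1)"

definition edge_connected :: "(nat \<times> nat) set \<Rightarrow> ((nat \<times> nat) \<times> (nat \<times> nat)) set" where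
  "edge_connected D = {(p, q). p \<in> D \<and> q \<in> D \<and>
     (p, q) \<in> {(s, t). s \<in> D \<and> t \<in> D \<and> share_edge s t}\<^sup>*}"

definition cell_components :: "(nat \<times> nat) set \<Rightarrow> (nat \<times> nat) set set" where
  "cell_components D = D // edge_connected D"

definition border_strip :: "(nat \<times> nat) set \<Rightarrow> bool" where
  "border_strip D \<longleftrightarrow> D \<noteq> {} \<and> edge_connected D = D \<times> D \<and> \<not> contains_block D"

definition rows :: "nat \<Rightarrow> nat \<Rightarrow> (nat \<times> nat) set \<Rightarrow> (nat \<times> nat) set" where
  "rows m M D = {(i, j) \<in> D. m \<le> i \<and> i \<le> M}"

text \<open>
  The decomposition of a skew shifted diagram into border strips (its connected components),
  listed from top to bottom.  The condition on \<open>fst\<close> makes \<open>m i\<close> and \<open>M i\<close> the first and the last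
  row that the \<open>i\<close>-th strip really meets: without it they could be moved into neighbouring
  rows in which the skew diagram has no cell.
\<close>

definition border_strip_decomposition ::
    "nat list \<Rightarrow> nat list \<Rightarrow> nat \<Rightarrow> (nat \<Rightarrow> nat) \<Rightarrow> (nat \<Rightarrow> nat) \<Rightarrow> bool" where
  "border_strip_decomposition lam mu r m M \<longleftrightarrow>
     (let D = skew_shifted_diagram lam mu in
       (\<forall>i\<in>{1..r}. m i \<le> M i) \<and>
       (\<forall>i\<in>{1..<r}. M i < m (i + 1)) \<and>
       (\<forall>i\<in>{1..r}. border_strip (rows (m i) (M i) D) \<and>
                    fst ` rows (m i) (M i) D = {m i..M i}) \<and>
       cell_components D = (\<lambda>i. rows (m i) (M i) D) ` {1..r})"

section \<open>Factorial P-functions\<close>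

text \<open>Indices of matrix rows and of variables start at 0: the variables are \<open>x 0, \<dots>, x (n - 1)\<close>.\<close>

definition factorial_monomial :: "(nat \<Rightarrow> 'a::comm_ring_1) \<Rightarrow> 'a \<Rightarrow> nat \<Rightarrow> 'a" where
  "factorial_monomial a u d = (\<Prod>i<d. (u - a i))"

text \<open>
  The Pfaffian of a skew-symmetric matrix of even size, as the signed sum over perfect matchings;
  each matching \<open>{{s 0, s 1}, {s 2, s 3}, \<dots>}\<close> is represented by the unique permutation \<open>s\<close> with
  \<open>s 0 < s 1\<close>, \<open>s 2 < s 3\<close>, \<open>\<dots>\<close> and \<open>s 0 < s 2 < s 4 < \<dots>\<close>.
\<close>

definition pfaffian :: "'a::comm_ring_1 mat \<Rightarrow> 'a" where
  "pfaffian A =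
     (let h = dim_row A div 2 in
       \<Sum>s | s permutes {..<dim_row A} \<and> (\<forall>i<h. s (2 * i) < s (2 * i + 1)) \<and>
             (\<forall>i. i + 1 < h \<longrightarrow> s (2 * i) < s (2 * (i + 1))).
         of_int (sign s) * (\<Prod>i<h. A $$ (s (2 * i), s (2 * i + 1))))"

definition A_matrix :: "nat \<Rightarrow> (nat \<Rightarrow> 'a::field) \<Rightarrow> 'a mat" where
  "A_matrix n x = mat n n (\<lambda>(i, j). (x j - x i) / (x j + x i))"

definition Delta :: "nat \<Rightarrow> (nat \<Rightarrow> 'a::field) \<Rightarrow> 'a" where
  "Delta n x = (\<Prod>(i, j)\<in>{(i, j). i < j \<and> j < n}. (x j - x i) / (x j + x i))"

definition V_matrix ::
    "nat \<Rightarrow> (nat \<Rightarrow> 'a::comm_ring_1) \<Rightarrow> (nat \<Rightarrow> 'a) \<Rightarrow> nat list \<Rightarrow> 'a mat" where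
  "V_matrix n x a \<alpha> = mat n (length \<alpha>) (\<lambda>(i, j). factorial_monomial a (x i) (\<alpha> ! j))"

definition factorial_P ::
    "nat \<Rightarrow> (nat \<Rightarrow> 'a::field) \<Rightarrow> (nat \<Rightarrow> 'a) \<Rightarrow> nat list \<Rightarrow> 'a" where
  "factorial_P n x a lam =
     (let lam' = (if even (n + length lam) then lam else lam @ [0]);
          s = length lam';
          V = V_matrix n x a lam'
      in 1 / Delta n x *
         pfaffian (four_block_mat (A_matrix n x) V (- transpose_mat V) (0\<^sub>m s s)))"

definition schur_q :: "nat \<Rightarrow> (nat \<Rightarrow> 'a::field) \<Rightarrow> nat \<Rightarrow> 'a" where
  "schur_q n x r =
     fps_nth (\<Prod>i<n. (1 + fps_const (x i) * fps_X) / (1 - fps_const (x i) * fps_X)) r"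

section \<open>Modified Pieri coefficients\<close>

text \<open>
  The functions above are evaluated in the field of rational functions over \<open>'a\<close> in countably many
  variables, at the first \<open>n\<close> variables.  An equation between polynomials in these variables is the
  same as an equation in that field.
\<close>

type_synonym 'a ratfun = "((nat \<Rightarrow>\<^sub>0 nat) \<Rightarrow>\<^sub>0 'a) fract"

definition ratfun_const :: "'a::field_char_0 \<Rightarrow> 'a ratfun" where
  "ratfun_const c = to_fract (Poly_Mapping.single 0 c)"

definition ratfun_var :: "nat \<Rightarrow> 'a::field_char_0 ratfun" where
  "ratfun_var i = to_fract (Poly_Mapping.single (Poly_Mapping.single i 1) 1)"

definition P_generic :: "nat \<Rightarrow> (nat \<Rightarrow> 'a::field_char_0) \<Rightarrow> nat list \<Rightarrow> 'a ratfun" where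
  "P_generic n a lam = factorial_P n ratfun_var (\<lambda>j. ratfun_const (a j)) lam"

definition q_generic :: "nat \<Rightarrow> nat \<Rightarrow> 'a::field_char_0 ratfun" where
  "q_generic n r = schur_q n ratfun_var r"

text \<open>
  The coefficients in the basis of the \<open>P\<^sub>\<lambda>(x|a)\<close>, \<open>\<lambda>\<close> strict of length at most \<open>n\<close>; there is a unique
  such family since \<open>P\<^sub>\<mu>(x|a) q\<^sub>r(x)\<close> lies in the ring of which they are a basis.
\<close>

definition pieri_coeff ::
    "nat \<Rightarrow> (nat \<Rightarrow> 'a::field_char_0) \<Rightarrow> nat list \<Rightarrow> nat \<Rightarrow> nat list \<Rightarrow> 'a" where
  "pieri_coeff n a mu r =
     (THE c. finite {lam. c lam \<noteq> 0} \<and>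
             (\<forall>lam. c lam \<noteq> 0 \<longrightarrow> strict_partition lam \<and> length lam \<le> n) \<and>
             P_generic n a mu * q_generic n r =
               (\<Sum>lam | c lam \<noteq> 0. ratfun_const (c lam) * P_generic n a lam))"

definition pieri_gf ::
    "nat \<Rightarrow> (nat \<Rightarrow> 'a::field_char_0) \<Rightarrow> nat list \<Rightarrow> nat list \<Rightarrow> 'a fps" where
  "pieri_gf n a mu lam = Abs_fps (\<lambda>r. pieri_coeff n a mu r lam)"

definition K_set :: "nat \<Rightarrow> nat list \<Rightarrow> nat list \<Rightarrow> nat set" where
  "K_set n mu lam =
     (if even (n + length mu) then {k. 1 \<le> k \<and> k \<le> length mu \<and> part lam k = part mu k}
      else {k. 1 \<le> k \<and> k \<le> length mu + 1 \<and> part lam k = part mu k})"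

text \<open>
  Value at \<open>a\<close> of a polynomial with nonnegative integer coefficients in variables indexed by \<open>nat\<close>.
\<close>

definition eval_nat_poly :: "((nat \<Rightarrow>\<^sub>0 nat) \<Rightarrow>\<^sub>0 nat) \<Rightarrow> (nat \<Rightarrow> 'a::comm_semiring_1) \<Rightarrow> 'a" where
  "eval_nat_poly p a =
     (\<Sum>e\<in>Poly_Mapping.keys p. of_nat (Poly_Mapping.lookup p e) *
        (\<Prod>i\<in>Poly_Mapping.keys e. a i ^ Poly_Mapping.lookup e i))"

end

theory Submission
  imports Defs
begin

text \<open>
  Let \<open>A\<close> be the matrix \<open>((x\<^sub>j - x\<^sub>i) / (x\<^sub>j + x\<^sub>i))\<close>, let \<open>v\<^sub>m\<close> be the column \<open>((x\<^sub>i|a)\<^sup>m)\<close>, and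
  let \<open>F(u, ..., w)\<close> be the Pfaffian of \<open>A\<close> bordered by the columns \<open>u, ..., w\<close>. Up to the common
  factor \<open>1 / \<Delta>\<close>, the function \<open>P\<^sub>\<mu>\<close> is \<open>F\<close> of the columns \<open>v\<^sub>m\<close>, \<open>m\<close> running through the parts of
  \<open>\<mu>\<close> and possibly \<open>0\<close>.

  The generating function of the \<open>q\<^sub>r\<close> is the product of \<open>d\<^sub>i = (1 + x\<^sub>i z) / (1 - x\<^sub>i z)\<close>, so
  multiplying a Pfaffian by it means conjugating the matrix by \<open>D = diag(d\<^sub>i)\<close>. Everything rests
  on the identity \<open>d\<^sub>i d\<^sub>j A\<^sub>i\<^sub>j = A\<^sub>i\<^sub>j + d\<^sub>j - d\<^sub>i\<close>: conjugation changes \<open>A\<close> by a matrix of rank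
  2 only, and a rank 2 update of \<open>A\<close> adds the Pfaffian bordered by two more columns
  (\<open>bpf_rank2_update\<close>). These two columns are \<open>D v\<^sub>0\<close> and \<open>v\<^sub>0\<close>, so
  \<open>(\<Prod> d\<^sub>i) F(v, ...) = F(D v, ...) + F(D v, ..., D v\<^sub>0, v\<^sub>0)\<close> (\<open>cayley_times_bpf\<close>).

  Next, \<open>D v\<^sub>m\<close> is an infinite combination of the \<open>v\<^sub>k\<close> with \<open>k \<ge> m\<close>, but for \<open>m < U\<close> a suitable
  \<open>D v\<^sub>m - c D v\<^sub>U\<close> is a combination of \<open>v\<^sub>m, ..., v\<^sub>U\<close> alone (\<open>cayley_fmon_telescope\<close>).
  Subtracting from each column a multiple of the column before it therefore confines the column of
  \<open>\<mu>\<^sub>j\<close> to the indices between \<open>\<mu>\<^sub>j\<close> and \<open>\<mu>\<^bsub>j-1\<^esub>\<close>, and expanding by multilinearity yields a sum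
  over sequences \<open>\<lambda>\<close> that interlace with \<open>\<mu>\<close>. Such a sequence is weakly decreasing, and it
  contributes \<open>0\<close> if two entries agree. So no signs and no determinants appear: the coefficient of
  \<open>P\<^sub>\<lambda>\<close> is a product with one factor for each row (\<open>pieri_identity\<close>), and each factor visibly has
  nonnegative coefficients.

  These coefficients are the Pieri coefficients because the \<open>P\<^sub>\<lambda>\<close> are linearly independent
  (\<open>P_generic_independent\<close>). After evaluating the variables at points, letting the last variable
  grow singles out the largest part of \<open>\<lambda>\<close>, and one inducts on the number of variables.

  Finally, if \<open>l(\<lambda>) \<le> l(\<mu>) + 1\<close>, then \<open>\<lambda>\<close> interlaces with \<open>\<mu>\<close> exactly if \<open>S(\<mu>) \<subseteq> S(\<lambda>)\<close> and
  \<open>S(\<lambda>/\<mu>)\<close> has no block. Two consecutive rows \<open>k\<close>, \<open>k + 1\<close> then share an edge exactly if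
  \<open>\<lambda>\<^bsub>k+1\<^esub> = \<mu>\<^sub>k\<close>, that is, if row \<open>k + 1\<close> uses the last index available to it; the factors of the
  rows of a border strip telescope to the factor of the strip (\<open>hit_product\<close>).
\<close>

section \<open>Pfaffians as sums over perfect matchings\<close>

text \<open>
  A perfect matching of \<open>{0, ..., 2h - 1}\<close> is encoded by its normalized permutation: pairs are
  increasing and listed by increasing first entry.
\<close>

definition matchings :: "nat \<Rightarrow> (nat \<Rightarrow> nat) set" where
  "matchings h = {s. s permutes {..<2 * h} \<and> (\<forall>i<h. s (2 * i) < s (2 * i + 1)) \<and>
     (\<forall>i. i + 1 < h \<longrightarrow> s (2 * i) < s (2 * (i + 1)))}"

abbreviation (input) pair_prod ::
  "nat \<Rightarrow> (nat \<Rightarrow> nat \<Rightarrow> 'a) \<Rightarrow> (nat \<Rightarrow> nat) \<Rightarrow> 'a::comm_ring_1"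
  where "pair_prod h f s \<equiv> \<Prod>i<h. f (s (2 * i)) (s (2 * i + 1))"

text \<open>
  Only the entries above the diagonal enter, so skew symmetry is a hypothesis of those lemmas
  whose proofs reorder a pair.
\<close>

definition pf :: "nat \<Rightarrow> (nat \<Rightarrow> nat \<Rightarrow> 'a) \<Rightarrow> 'a::comm_ring_1" where
  "pf h f = (\<Sum>s\<in>matchings h. of_int (sign s) * pair_prod h f s)"

lemma pfaffian_eq_pf:
  assumes "dim_row A = 2 * h"
  shows "pfaffian A = pf h (\<lambda>i j. A $$ (i, j))"
  using assms by (simp add: pfaffian_def pf_def matchings_def Let_def)

lemma finite_matchings [simp]: "finite (matchings h)"
  unfolding matchings_def by (rule finite_subset[OF _ finite_permutations[of "{..<2*h}"]]) auto

lemma matchingsD: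
  assumes "s \<in> matchings h"
  shows "s permutes {..<2 * h}" "\<And>i. i < h \<Longrightarrow> s (2 * i) < s (2 * i + 1)"
    "\<And>i. i < h \<Longrightarrow> s (2 * i + 1) < 2 * h" "\<And>i. i < h \<Longrightarrow> s (2 * i) < 2 * h"
    "inj s"
proof -
  show p: "s permutes {..<2 * h}" using assms by (simp add: matchings_def)
  show "s (2 * i) < s (2 * i + 1)" if "i < h" for i using assms that by (simp add: matchings_def)
  show "s (2 * i + 1) < 2 * h" "s (2 * i) < 2 * h" if "i < h" for i
    using permutes_in_image[OF p, of "2 * i + 1"] permutes_in_image[OF p, of "2 * i"] that by auto
  show "inj s" by (rule permutes_inj[OF p])
qed

lemma matchings_mono:
  assumes s: "s \<in> matchings h"
  shows "j < h \<Longrightarrow> i < j \<Longrightarrow> s (2 * i) < s (2 * j)"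
proof (induction j)
  case (Suc j)
  have step: "s (2 * j) < s (2 * (j + 1))" using s Suc.prems by (auto simp: matchings_def)
  show ?case
  proof (cases "i = j")
    case False
    then have "s (2 * i) < s (2 * j)" using Suc by auto
    with step show ?thesis by simp
  qed (use step in simp)
qed simp

lemma pf_cong:
  assumes "\<And>i j. i < j \<Longrightarrow> j < 2 * h \<Longrightarrow> f i j = g i j"
  shows "pf h f = pf h g"
  unfolding pf_def
proof (rule sum.cong[OF refl])
  fix s assume s: "s \<in> matchings h"
  have "pair_prod h f s = pair_prod h g s"
    by (rule prod.cong[OF refl]) (use matchingsD[OF s] assms in auto)
  then show "of_int (sign s) * pair_prod h f s =
    of_int (sign s) * pair_prod h g s" by simp
qed

lemma pf_0 [simp]: "pf 0 f = 1"
proof -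
  have "matchings 0 = {id}" by (auto simp: matchings_def)
  then show ?thesis by (simp add: pf_def)
qed

lemma prod_pairs: "(\<Prod>i<h. d (2 * i) * d (2 * i + 1)) = (\<Prod>i<2 * h. d i)"
  for d :: "nat \<Rightarrow> 'a::comm_monoid_mult"
  by (induction h) (simp_all add: mult.assoc)

lemma pf_scale:
  "pf h (\<lambda>i j. d i * d j * f i j) = (\<Prod>i<2 * h. d i) * pf h f"
  unfolding pf_def sum_distrib_left
proof (rule sum.cong[OF refl])
  fix s assume s: "s \<in> matchings h"
  have "(\<Prod>i<h. d (s (2 * i)) * d (s (2 * i + 1))) = (\<Prod>i<2 * h. d (s i))"
    using prod_pairs[of "\<lambda>i. d (s i)" h] by simp
  also have "\<dots> = (\<Prod>i<2 * h. d i)"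
    using prod.permute[OF matchingsD(1)[OF s], of d] by (simp add: o_def)
  finally show "of_int (sign s) * (\<Prod>i<h. d (s (2 * i)) * d (s (2 * i + 1)) * f (s (2 * i)) (s (2 * i + 1)))
      = (\<Prod>i<2 * h. d i) * (of_int (sign s) * pair_prod h f s)"
    by (simp only: prod.distrib[of "\<lambda>i. d (s (2 * i)) * d (s (2 * i + 1))"] mult.left_commute)
qed

lemma hom_0_uminus:
  fixes \<phi> :: "'a::ring_1 \<Rightarrow> 'b::ring_1"
  assumes "\<And>x y. \<phi> (x + y) = \<phi> x + \<phi> y"
  shows "\<phi> 0 = 0" "\<phi> (- x) = - \<phi> x"
proof -
  show 0: "\<phi> 0 = 0" using assms[of 0 0] by simp
  show "\<phi> (- x) = - \<phi> x" using assms[of x "- x"] 0 by (simp add: eq_neg_iff_add_eq_0 add.commute)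
qed

lemma pf_hom:
  assumes "\<And>x y. \<phi> (x + y) = \<phi> x + \<phi> y" "\<And>x y. \<phi> (x * y) = \<phi> x * \<phi> y"
    "\<phi> (1::'a::comm_ring_1) = (1::'b::comm_ring_1)"
  shows "\<phi> (pf h f) = pf h (\<lambda>i j. \<phi> (f i j))"
proof -
  note z = hom_0_uminus[of \<phi>, OF assms(1)]
  have sm: "\<phi> (sum u S) = (\<Sum>s\<in>S. \<phi> (u s))" for u and S :: "(nat \<Rightarrow> nat) set"
    by (induction S rule: infinite_finite_induct) (simp_all add: z assms)
  have pr: "\<phi> (prod u S) = (\<Prod>s\<in>S. \<phi> (u s))" for u and S :: "nat set"
    by (induction S rule: infinite_finite_induct) (simp_all add: assms)
  have sg: "\<phi> (of_int (sign s)) = of_int (sign s)" for s :: "nat \<Rightarrow> nat"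
    by (cases s rule: sign_cases) (simp_all add: assms z)
  show ?thesis unfolding pf_def by (simp add: sm pr sg assms)
qed

lemma matching_pair:
  assumes s: "s \<in> matchings h" and k: "k < 2 * h"
  obtains i where "i < h" "s (2 * i) = k \<or> s (2 * i + 1) = k"
    "\<And>j. j < h \<Longrightarrow> j \<noteq> i \<Longrightarrow> s (2 * j) \<noteq> k \<and> s (2 * j + 1) \<noteq> k"
proof -
  note p = matchingsD(1)[OF s]
  obtain m where m: "m < 2 * h" "s m = k"
    using permutes_surj[OF p] permutes_in_image[OF p] k by (metis lessThan_iff surjD)
  have "s (2 * (m div 2)) = k \<or> s (2 * (m div 2) + 1) = k"
    using m by (cases "even m") (auto elim: evenE oddE)
  moreover have "s (2 * j) \<noteq> k \<and> s (2 * j + 1) \<noteq> k" if "j \<noteq> m div 2" for j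
  proof -
    have "2 * j \<noteq> m" "2 * j + 1 \<noteq> m" using that by auto
    then show ?thesis using m matchingsD(5)[OF s] by (metis injD)
  qed
  moreover have "m div 2 < h" using m by simp
  ultimately show ?thesis using that[of "m div 2"] by simp
qed

text \<open>
  In every matching exactly one pair contains the index \<open>k\<close>, so each term has exactly one factor
  from row and column \<open>k\<close>.
\<close>

lemma pf_linear:
  assumes k: "k < 2 * h"
    and same: "\<And>i j. i < j \<Longrightarrow> j < 2 * h \<Longrightarrow> i \<noteq> k \<Longrightarrow> j \<noteq> k \<Longrightarrow> g i j = f i j \<and> e i j = f i j"
    and lin: "\<And>i j. i < j \<Longrightarrow> j < 2 * h \<Longrightarrow> i = k \<or> j = k \<Longrightarrow> f i j = \<alpha> * g i j + \<beta> * e i j"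
  shows "pf h f = \<alpha> * pf h g + \<beta> * pf h e"
  unfolding pf_def sum_distrib_left sum.distrib[symmetric]
proof (rule sum.cong[OF refl])
  fix s assume s: "s \<in> matchings h"
  note sD = matchingsD[OF s]
  obtain i where i: "i < h" "s (2 * i) = k \<or> s (2 * i + 1) = k"
    "\<And>j. j < h \<Longrightarrow> j \<noteq> i \<Longrightarrow> s (2 * j) \<noteq> k \<and> s (2 * j + 1) \<noteq> k"
    using matching_pair[OF s k] by blast
  let ?R = "\<lambda>f. \<Prod>j\<in>{..<h} - {i}. f (s (2 * j)) (s (2 * j + 1))"
  have sp: "pair_prod h f s = f (s (2 * i)) (s (2 * i + 1)) * ?R f"
    for f :: "nat \<Rightarrow> nat \<Rightarrow> 'a"
    by (rule prod.remove) (use i in auto)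
  have eq: "?R g = ?R f" "?R e = ?R f"
    by (rule prod.cong[OF refl]; use same i(3) sD in auto)+
  have "f (s (2 * i)) (s (2 * i + 1)) =
      \<alpha> * g (s (2 * i)) (s (2 * i + 1)) + \<beta> * e (s (2 * i)) (s (2 * i + 1))"
    by (rule lin) (use i sD in auto)
  then show "of_int (sign s) * pair_prod h f s =
      \<alpha> * (of_int (sign s) * pair_prod h g s) +
      \<beta> * (of_int (sign s) * pair_prod h e s)"
    unfolding sp eq by (simp add: algebra_simps)
qed

lemma pf_zero_row:
  assumes "k < 2 * h" "\<And>i j. i < j \<Longrightarrow> j < 2 * h \<Longrightarrow> i = k \<or> j = k \<Longrightarrow> f i j = 0"
  shows "pf h f = 0"
  using pf_linear[OF assms(1), of f f f 0 0] assms(2) by simp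

text \<open>
  The image of a matching under the transposition of \<open>k\<close> and \<open>k + 1\<close>, normalized again. Since no
  value lies between \<open>k\<close> and \<open>k + 1\<close>, composing with the transposition spoils normalization only
  if the two are paired with each other, or if both are first entries. In the first case the
  matching does not change; in the second the two first entries stay in place and their partners
  are exchanged.
\<close>

definition swap_matching :: "nat \<Rightarrow> (nat \<Rightarrow> nat) \<Rightarrow> nat \<Rightarrow> nat" where
  "swap_matching k s =
     (let p = inv_into UNIV s k in
      if even p \<and> s (p + 1) = k + 1 then s
      else if even p \<and> s (p + 2) = k + 1 then s \<circ> transpose (p + 1) (p + 3)
      else transpose k (k + 1) \<circ> s)"

lemma matchingsI:
  assumes "s permutes {..<2 * h}" "\<And>i. i < h \<Longrightarrow> s (2 * i) < s (2 * i + 1)"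
    "\<And>i. i + 1 < h \<Longrightarrow> s (2 * i) < s (2 * (i + 1))"
  shows "s \<in> matchings h"
  using assms by (simp add: matchings_def)

lemma transpose_Suc_less:
  assumes "x < y" "\<not> (x = k \<and> y = k + 1)"
  shows "transpose k (k + 1) x < transpose k (k + (1::nat)) y"
  using assms by (auto simp: transpose_def)

lemma swap_matching_cases:
  assumes s: "s \<in> matchings h" and k: "k + 1 < 2 * h"
  obtains
    (paired) i where "i < h" "s (2 * i) = k" "s (2 * i + 1) = k + 1" "swap_matching k s = s"
  | (firsts) i where "i + 1 < h" "s (2 * i) = k" "s (2 * (i + 1)) = k + 1"
      "swap_matching k s = s \<circ> transpose (2 * i + 1) (2 * (i + 1) + 1)"
  | (other) "\<And>i. i < h \<Longrightarrow> \<not> (s (2 * i) = k \<and> s (2 * i + 1) = k + 1)"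
      "\<And>i. i + 1 < h \<Longrightarrow> \<not> (s (2 * i) = k \<and> s (2 * (i + 1)) = k + 1)"
      "swap_matching k s = transpose k (k + 1) \<circ> s"
proof -
  note p = matchingsD(1)[OF s]
  define m where "m = inv_into UNIV s k"
  have sm: "s m = k" unfolding m_def using permutes_inverses(1)[OF p] by simp
  have lt: "j < 2 * h" if "s j = k \<or> s j = k + 1" for j
    using permutes_in_image[OF p, of j] that k by auto
  have eqm: "j = m" if "s j = k" for j using that sm matchingsD(5)[OF s] by (metis injD)
  consider (a) "even m" "s (m + 1) = k + 1" | (b) "even m" "s (m + 1) \<noteq> k + 1" "s (m + 2) = k + 1"
    | (c) "\<not> (even m \<and> s (m + 1) = k + 1)" "\<not> (even m \<and> s (m + 2) = k + 1)" by blast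
  then show ?thesis
  proof cases
    case a
    then obtain i where "m = 2 * i" by (elim evenE)
    with a show ?thesis using sm lt[of m]
      by (intro paired[of i]) (auto simp: swap_matching_def Let_def m_def[symmetric])
  next
    case b
    then obtain i where i: "m = 2 * i" by (elim evenE)
    have "i + 1 < h" using lt[of "m + 2"] b i by auto
    with b i show ?thesis using sm
      by (intro firsts[of i]) (auto simp: swap_matching_def Let_def m_def[symmetric] numeral_3_eq_3)
  next
    case c
    show ?thesis
    proof (rule other)
      show "\<not> (s (2 * i) = k \<and> s (2 * i + 1) = k + 1)" for i using eqm[of "2 * i"] c by auto
      show "\<not> (s (2 * i) = k \<and> s (2 * (i + 1)) = k + 1)" for i using eqm[of "2 * i"] c by auto
      show "swap_matching k s = transpose k (k + 1) \<circ> s"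
        using c by (simp only: swap_matching_def Let_def m_def[symmetric] if_False)
    qed
  qed
qed

lemma swap_matching_in:
  assumes s: "s \<in> matchings h" and k: "k + 1 < 2 * h"
  shows "swap_matching k s \<in> matchings h"
  using s k
proof (cases rule: swap_matching_cases)
  case (firsts i)
  note sD = matchingsD[OF s]
  let ?t = "transpose (2 * i + 1) (2 * (i + 1) + 1)"
  have ev: "?t (2 * j) = 2 * j" for j unfolding transpose_def by presburger
  have od: "?t (2 * j + 1) = (if j = i then 2 * (i + 1) + 1 else if j = i + 1 then 2 * i + 1 else 2 * j + 1)" for j
    by (auto simp: transpose_def)
  have "s (2 * i + 1) \<noteq> s (2 * (i + 1))" using sD(5) by (auto dest!: injD)
  then have 1: "s (2 * (i + 1)) < s (2 * i + 1)" using sD(2)[of i] firsts by auto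
  have 2: "s (2 * i) < s (2 * (i + 1) + 1)" using sD(2)[of "i + 1"] firsts by auto
  show ?thesis unfolding firsts(4)
  proof (rule matchingsI)
    show "s \<circ> ?t permutes {..<2 * h}"
      by (rule permutes_compose[OF permutes_swap_id sD(1)]) (use firsts in auto)
    show "(s \<circ> ?t) (2 * j) < (s \<circ> ?t) (2 * j + 1)" if "j < h" for j
      unfolding o_apply ev od using 1 2 sD(2)[OF that] by auto
    show "(s \<circ> ?t) (2 * j) < (s \<circ> ?t) (2 * (j + 1))" if "j + 1 < h" for j
      unfolding o_apply ev using s that by (auto simp: matchings_def)
  qed
next
  case other
  note sD = matchingsD[OF s]
  show ?thesis unfolding other(3)
  proof (rule matchingsI)
    show "transpose k (k + 1) \<circ> s permutes {..<2 * h}"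
      by (rule permutes_compose[OF sD(1) permutes_swap_id]) (use k in auto)
    show "(transpose k (k + 1) \<circ> s) (2 * j) < (transpose k (k + 1) \<circ> s) (2 * j + 1)" if "j < h" for j
      unfolding o_apply by (rule transpose_Suc_less[OF sD(2)[OF that] other(1)[OF that]])
    show "(transpose k (k + 1) \<circ> s) (2 * j) < (transpose k (k + 1) \<circ> s) (2 * (j + 1))" if "j + 1 < h" for j
      unfolding o_apply by (rule transpose_Suc_less[OF matchings_mono[OF s that] other(2)[OF that]]) auto
  qed
qed (use s in simp)

lemma swap_matching_involution:
  assumes s: "s \<in> matchings h" and k: "k + 1 < 2 * h"
  shows "swap_matching k (swap_matching k s) = s"
  using s k
proof (cases rule: swap_matching_cases)
  case (firsts i)
  note t = swap_matching_in[OF s k]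
  have ti: "swap_matching k s (2 * i) = k" "swap_matching k s (2 * (i + 1)) = k + 1"
    unfolding firsts(4) using firsts(2,3) by (simp_all add: transpose_def)
  from t k show ?thesis
  proof (cases rule: swap_matching_cases)
    case (paired j)
    then have "2 * j + 1 = 2 * (i + 1)" using ti matchingsD(5)[OF t] by (metis injD)
    then have False by presburger
    then show ?thesis ..
  next
    case (firsts j)
    then have "2 * j = 2 * i" using ti matchingsD(5)[OF t] by (metis injD)
    then have j: "j = i" by simp
    show ?thesis
      by (subst firsts(4), subst \<open>swap_matching k s = s \<circ> transpose (2 * i + 1) (2 * (i + 1) + 1)\<close>)
        (simp add: j o_assoc[symmetric])
  next
    case other
    then show ?thesis using ti firsts(1) by blast
  qed
next
  case other
  note t = swap_matching_in[OF s k]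
  have inv: "swap_matching k s j = k \<Longrightarrow> s j = k + 1" "swap_matching k s j = k + 1 \<Longrightarrow> s j = k" for j
    unfolding other(3) by (auto simp: transpose_def split: if_splits)
  from t k show ?thesis
  proof (cases rule: swap_matching_cases)
    case (paired j)
    then show ?thesis using inv(1)[of "2 * j"] inv(2)[of "2 * j + 1"] matchingsD(2)[OF s, of j] by simp
  next
    case (firsts j)
    then show ?thesis
      using inv(1)[of "2 * j"] inv(2)[of "2 * (j + 1)"] matchings_mono[OF s, of "j + 1" j] by simp
  next
    case o2: other
    show ?thesis by (subst o2(3), subst other(3)) (simp add: o_assoc)
  qed
qed simp

text \<open>
  Renormalizing matchings is an involution on the index set of the sum, and corresponding terms
  are opposite: either the sign of the permutation changes, or a single entry is replaced by its
  transpose.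
\<close>

lemma pf_swap_adjacent:
  fixes f :: "nat \<Rightarrow> nat \<Rightarrow> 'a::comm_ring_1"
  assumes k: "k + 1 < 2 * h" and skew: "\<And>i j. f j i = - f i j"
  shows "pf h (\<lambda>i j. f (transpose k (k + 1) i) (transpose k (k + 1) j)) = - pf h f"
  unfolding pf_def sum_negf[symmetric]
proof (rule sum.reindex_bij_witness[of _ "swap_matching k" "swap_matching k"])
  fix s assume s: "s \<in> matchings h"
  note sD = matchingsD[OF s]
  have perm: "permutation s" using sD(1) permutation_permutes by blast
  let ?\<tau> = "transpose k (k + 1)"
  show "swap_matching k s \<in> matchings h" "swap_matching k (swap_matching k s) = s"
    using swap_matching_in[OF s k] swap_matching_involution[OF s k] by auto
  show "- (of_int (sign (swap_matching k s)) *
          (\<Prod>i<h. f (swap_matching k s (2 * i)) (swap_matching k s (2 * i + 1)))) =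
        of_int (sign s) * (\<Prod>i<h. f (?\<tau> (s (2 * i))) (?\<tau> (s (2 * i + 1))))"
    using s k
  proof (cases rule: swap_matching_cases)
    case (paired i)
    have fix\<tau>: "?\<tau> (s j) = s j" if "j \<noteq> 2 * i" "j \<noteq> 2 * i + 1" for j
      by (rule transpose_apply_other) (use that paired sD(5) in \<open>metis injD\<close>)+
    have "(\<Prod>j<h. f (?\<tau> (s (2 * j))) (?\<tau> (s (2 * j + 1)))) =
        f (k + 1) k * (\<Prod>j\<in>{..<h} - {i}. f (?\<tau> (s (2 * j))) (?\<tau> (s (2 * j + 1))))"
      by (subst prod.remove[of _ i]) (use paired in auto)
    also have "(\<Prod>j\<in>{..<h} - {i}. f (?\<tau> (s (2 * j))) (?\<tau> (s (2 * j + 1)))) =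
        (\<Prod>j\<in>{..<h} - {i}. f (s (2 * j)) (s (2 * j + 1)))"
    proof (rule prod.cong[OF refl])
      fix j assume "j \<in> {..<h} - {i}"
      then have "?\<tau> (s (2 * j)) = s (2 * j)" "?\<tau> (s (2 * j + 1)) = s (2 * j + 1)"
        by (intro fix\<tau>; simp; presburger)+
      then show "f (?\<tau> (s (2 * j))) (?\<tau> (s (2 * j + 1))) = f (s (2 * j)) (s (2 * j + 1))" by simp
    qed
    also have "f (k + 1) k * (\<Prod>j\<in>{..<h} - {i}. f (s (2 * j)) (s (2 * j + 1))) =
        - pair_prod h f s"
      by (subst (2) prod.remove[of _ i]) (use paired skew[of "k + 1" k] in auto)
    finally show ?thesis using paired by simp
  next
    case (firsts i)
    let ?t = "transpose (2 * i + 1) (2 * (i + 1) + 1)"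
    have sg: "sign (swap_matching k s) = - sign s"
      unfolding firsts(4) by (subst sign_compose) (use perm in \<open>auto simp: permutation_swap_id sign_swap_id\<close>)
    have neq: "s (2 * i + 1) \<noteq> k" "s (2 * i + 1) \<noteq> k + 1"
        "s (2 * (i + 1) + 1) \<noteq> k" "s (2 * (i + 1) + 1) \<noteq> k + 1"
      unfolding firsts(3)[symmetric] unfolding firsts(2)[symmetric] inj_eq[OF sD(5)] by presburger+
    have fix\<tau>: "?\<tau> (s j) = s j" if "j \<noteq> 2 * i" "j \<noteq> 2 * (i + 1)" for j
      by (rule transpose_apply_other) (use that firsts sD(5) in \<open>metis injD\<close>)+
    have sp: "(\<Prod>j<h. g j) = g i * (g (i + 1) * (\<Prod>j\<in>{..<h} - {i} - {i + 1}. g j))"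
      for g :: "nat \<Rightarrow> 'a"
      by (subst prod.remove[of _ i], use firsts in simp, use firsts in simp,
          subst prod.remove[of _ "i + 1"]) (use firsts in auto)
    have tev: "?t (2 * j) = 2 * j" for j unfolding transpose_def by presburger
    have tod: "?t (2 * i + 1) = 2 * (i + 1) + 1" "?t (2 * (i + 1) + 1) = 2 * i + 1" by simp_all
    have "(\<Prod>j\<in>{..<h} - {i} - {i + 1}. f (?\<tau> (s (2 * j))) (?\<tau> (s (2 * j + 1)))) =
        (\<Prod>j\<in>{..<h} - {i} - {i + 1}. f (swap_matching k s (2 * j)) (swap_matching k s (2 * j + 1)))"
    proof (rule prod.cong[OF refl])
      fix j assume j: "j \<in> {..<h} - {i} - {i + 1}"
      have "?t (2 * j + 1) = 2 * j + 1" using j by (intro transpose_apply_other) auto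
      moreover have "?\<tau> (s (2 * j)) = s (2 * j)" using j by (intro fix\<tau>) auto
      moreover have "?\<tau> (s (2 * j + 1)) = s (2 * j + 1)" by (intro fix\<tau>; presburger)
      ultimately show "f (?\<tau> (s (2 * j))) (?\<tau> (s (2 * j + 1))) =
          f (swap_matching k s (2 * j)) (swap_matching k s (2 * j + 1))"
        unfolding firsts(4) o_apply tev by simp
    qed
    moreover have "f (?\<tau> (s (2 * i))) (?\<tau> (s (2 * i + 1))) =
        f (swap_matching k s (2 * (i + 1))) (swap_matching k s (2 * (i + 1) + 1))"
      unfolding firsts(4) o_apply tev tod firsts(2,3)
      by (subst (2) transpose_apply_other) (use neq in auto)
    moreover have "f (?\<tau> (s (2 * (i + 1)))) (?\<tau> (s (2 * (i + 1) + 1))) =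
        f (swap_matching k s (2 * i)) (swap_matching k s (2 * i + 1))"
      unfolding firsts(4) o_apply tev tod firsts(2,3)
      by (subst (2) transpose_apply_other) (use neq in auto)
    ultimately show ?thesis unfolding sp sg by (simp add: mult_ac)
  next
    case other
    have "sign (swap_matching k s) = - sign s"
      unfolding other(3) by (subst sign_compose) (use perm in \<open>auto simp: permutation_swap_id sign_swap_id\<close>)
    then show ?thesis unfolding other(3) by simp
  qed
qed (use swap_matching_in k swap_matching_involution in auto)

text \<open>
  A transposition of distant indices is a conjugate of a closer one by an adjacent one, which
  makes three sign changes.
\<close>

lemma pf_swap:
  fixes f :: "nat \<Rightarrow> nat \<Rightarrow> 'a::comm_ring_1"
  assumes "k < l" "l < 2 * h" "\<And>i j. f j i = - f i j"
  shows "pf h (\<lambda>i j. f (transpose k l i) (transpose k l j)) = - pf h f"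
  using assms
proof (induction "l - k" arbitrary: k l f)
  case 0
  have False using 0(1,2) by simp
  then show ?case ..
next
  case (Suc d)
  show ?case
  proof (cases "l = k + 1")
    case True
    then show ?thesis using pf_swap_adjacent[of k h f, OF _ Suc.prems(3)] Suc.prems(2) by simp
  next
    case False
    define m where "m = l - 1"
    have m: "l = m + 1" "k < m" using False Suc.prems by (auto simp: m_def)
    let ?\<tau> = "transpose m (m + 1)" and ?\<rho> = "transpose k m"
    have conj: "transpose k l i = ?\<tau> (?\<rho> (?\<tau> i))" for i
      using m by (auto simp: transpose_def)
    have "pf h (\<lambda>i j. f (transpose k l i) (transpose k l j)) =
        pf h (\<lambda>i j. (\<lambda>i j. f (?\<tau> (?\<rho> i)) (?\<tau> (?\<rho> j))) (?\<tau> i) (?\<tau> j))"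
      by (simp add: conj)
    also have "\<dots> = - pf h (\<lambda>i j. f (?\<tau> (?\<rho> i)) (?\<tau> (?\<rho> j)))"
      by (rule pf_swap_adjacent) (use m Suc.prems(2) in simp, rule Suc.prems(3))
    also have "pf h (\<lambda>i j. f (?\<tau> (?\<rho> i)) (?\<tau> (?\<rho> j))) = - pf h (\<lambda>i j. f (?\<tau> i) (?\<tau> j))"
      by (rule Suc.hyps(1)[of m k "\<lambda>i j. f (?\<tau> i) (?\<tau> j)"])
        (use m Suc.hyps(2) Suc.prems(2) in simp_all, rule Suc.prems(3))
    also have "pf h (\<lambda>i j. f (?\<tau> i) (?\<tau> j)) = - pf h f"
      by (rule pf_swap_adjacent) (use m Suc.prems(2) in simp, rule Suc.prems(3))
    finally show ?thesis by simp
  qed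
qed

lemma pf_equal_rows:
  fixes f :: "nat \<Rightarrow> nat \<Rightarrow> 'a::{idom, ring_char_0}"
  assumes "k \<noteq> l" "k < 2 * h" "l < 2 * h" "\<And>i j. f j i = - f i j" "\<And>j. f k j = f l j"
  shows "pf h f = 0"
proof -
  have *: "pf h f = 0" if "k < l" "l < 2 * h" "\<And>j. f k j = f l j" for k l
  proof -
    have col: "f j k = f j l" for j
      using assms(4)[where i = k and j = j] assms(4)[where i = l and j = j] unfolding that(3) by (rule trans[OF _ sym])
    have row: "f (transpose k l i) j = f i j" for i j
      using that(3)[of j] by (cases "i = k"; cases "i = l") simp_all
    have "f i (transpose k l j) = f i j" for i j
      using col[of i] by (cases "j = k"; cases "j = l") simp_all
    then have "pf h (\<lambda>i j. f (transpose k l i) (transpose k l j)) = pf h f"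
      unfolding row by simp
    moreover have "pf h (\<lambda>i j. f (transpose k l i) (transpose k l j)) = - pf h f"
      by (rule pf_swap[OF that(1,2)]) (rule assms(4))
    ultimately have "pf h f = - pf h f" by metis
    then show ?thesis by (simp add: eq_neg_iff_add_eq_0 mult_2[symmetric])
  qed
  show ?thesis
  proof (cases "k < l")
    case True
    then show ?thesis using *[of k l] assms(3,5) by blast
  next
    case False
    then show ?thesis using *[of l k] assms(1,2,5) by (metis linorder_neqE_nat)
  qed
qed

lemma pf_transvection:
  fixes f :: "nat \<Rightarrow> nat \<Rightarrow> 'a::{idom, ring_char_0}"
  assumes kl: "k \<noteq> l" "k < 2 * h" "l < 2 * h" and skew: "\<And>i j. f j i = - f i j"
  shows "pf h (\<lambda>i j. f i j + (if i = k then c * f l j else 0) + (if j = k then c * f i l else 0)) = pf h f"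
proof -
  define \<rho> where "\<rho> = id(k := l)"
  have ll: "f l l = 0" using skew[of l l] by (simp add: eq_neg_iff_add_eq_0 mult_2[symmetric])
  have "pf h (\<lambda>i j. f i j + (if i = k then c * f l j else 0) + (if j = k then c * f i l else 0)) =
      1 * pf h f + c * pf h (\<lambda>i j. f (\<rho> i) (\<rho> j))"
    by (rule pf_linear[OF kl(2)]) (auto simp: \<rho>_def ll)
  also have "pf h (\<lambda>i j. f (\<rho> i) (\<rho> j)) = 0"
    by (rule pf_equal_rows[OF kl]) (rule skew, use kl in \<open>auto simp: \<rho>_def\<close>)
  finally show ?thesis by simp
qed

text \<open>
  An expansion along the last two indices. The larger of the two can only be a second entry, and
  the smaller one is a first entry only if it is paired with the larger. So a matching that does
  not pair them uses both as second entries, hence picks up an entry from each of the last two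
  columns.
\<close>

lemma pf_last_pair:
  fixes f :: "nat \<Rightarrow> nat \<Rightarrow> 'a::comm_ring_1"
  assumes iso: "(\<forall>i<2 * h. f i (2 * h) = 0) \<or> (\<forall>i<2 * h. f i (2 * h + 1) = 0)"
  shows "pf (Suc h) f = f (2 * h) (2 * h + 1) * pf h f"
proof -
  let ?good = "{s \<in> matchings (Suc h). s (2 * h) = 2 * h \<and> s (2 * h + 1) = 2 * h + 1}"
  have vanish: "(\<Prod>i<Suc h. f (s (2 * i)) (s (2 * i + 1))) = 0"
    if s: "s \<in> matchings (Suc h)" and bad: "s \<notin> ?good" for s
  proof -
    note sD = matchingsD[OF s]
    have *: "s (2 * i) < 2 * h" if "i < Suc h" "s (2 * i + 1) = 2 * h \<or> s (2 * i + 1) = 2 * h + 1" for i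
    proof (rule ccontr)
      assume "\<not> s (2 * i) < 2 * h"
      then have e: "s (2 * i) = 2 * h" "s (2 * i + 1) = 2 * h + 1" using sD(2)[OF that(1)] that(2) by auto
      have "i = h"
      proof (rule ccontr)
        assume "i \<noteq> h"
        then have "2 * h < s (2 * h)" using matchings_mono[OF s, of h i] e that by auto
        moreover have "s (2 * h) < s (2 * h + 1)" "s (2 * h + 1) < 2 * Suc h" using sD(2,3)[of h] by auto
        ultimately show False by simp
      qed
      with e s bad show False by simp
    qed
    have ex: "\<exists>i<Suc h. f (s (2 * i)) (s (2 * i + 1)) = 0"
    proof -
      have "\<exists>i<Suc h. s (2 * i + 1) = q" if q: "q = 2 * h \<or> q = 2 * h + 1" for q
      proof -
        have "q < 2 * Suc h" using q by auto
        from matching_pair[OF s this] obtain i where i: "i < Suc h" "s (2 * i) = q \<or> s (2 * i + 1) = q" by blast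
        have False if "s (2 * i) = q"
        proof -
          have "s (2 * i + 1) = 2 * h + 1" using sD(2,3)[OF i(1)] that q by auto
          then have "s (2 * i) < 2 * h" using * i(1) by blast
          with that q show False by auto
        qed
        with i show ?thesis by blast
      qed
      then obtain i1 i2 where "i1 < Suc h" "s (2 * i1 + 1) = 2 * h" "i2 < Suc h" "s (2 * i2 + 1) = 2 * h + 1" by blast
      from iso show ?thesis
      proof
        assume "\<forall>i<2 * h. f i (2 * h) = 0"
        then show ?thesis using *[of i1] \<open>i1 < Suc h\<close> \<open>s (2 * i1 + 1) = 2 * h\<close> by auto
      next
        assume "\<forall>i<2 * h. f i (2 * h + 1) = 0"
        then show ?thesis using *[of i2] \<open>i2 < Suc h\<close> \<open>s (2 * i2 + 1) = 2 * h + 1\<close> by auto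
      qed
    qed
    then show ?thesis by (intro prod_zero) auto
  qed
  have gd: "?good = matchings h"
  proof (intro equalityI subsetI)
    fix s assume "s \<in> ?good"
    then have s: "s \<in> matchings (Suc h)" and e: "s (2 * h) = 2 * h" "s (2 * h + 1) = 2 * h + 1" by auto
    show "s \<in> matchings h"
    proof (rule matchingsI)
      show "s permutes {..<2 * h}"
      proof (rule permutes_superset[OF matchingsD(1)[OF s]])
        fix x assume "x \<in> {..<2 * Suc h} - {..<2 * h}"
        then have "x = 2 * h \<or> x = 2 * h + 1" by auto
        then show "s x = x" using e by auto
      qed
      show "s (2 * i) < s (2 * i + 1)" if "i < h" for i using matchingsD(2)[OF s, of i] that by simp
      show "s (2 * i) < s (2 * (i + 1))" if "i + 1 < h" for i using matchings_mono[OF s, of "i + 1" i] that by simp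
    qed
  next
    fix s assume s: "s \<in> matchings h"
    note sD = matchingsD[OF s]
    have e: "s (2 * h) = 2 * h" "s (2 * h + 1) = 2 * h + 1"
      using permutes_not_in[OF sD(1)] by auto
    have "s \<in> matchings (Suc h)"
    proof (rule matchingsI)
      show "s permutes {..<2 * Suc h}" by (rule permutes_subset[OF sD(1)]) auto
      show "s (2 * i) < s (2 * i + 1)" if "i < Suc h" for i
        using sD(2)[of i] e that by (cases "i = h") auto
      show "s (2 * i) < s (2 * (i + 1))" if "i + 1 < Suc h" for i
        using matchings_mono[OF s, of "i + 1" i] sD(4)[of i] e that by (cases "i + 1 = h") auto
    qed
    with e show "s \<in> ?good" by simp
  qed
  have "pf (Suc h) f = (\<Sum>s\<in>?good. of_int (sign s) * (\<Prod>i<Suc h. f (s (2 * i)) (s (2 * i + 1))))"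
    unfolding pf_def by (rule sum.mono_neutral_right) (use vanish in auto)
  also have "\<dots> = (\<Sum>s\<in>?good. f (2 * h) (2 * h + 1) * (of_int (sign s) * pair_prod h f s))"
    by (rule sum.cong[OF refl]) (auto simp: mult_ac)
  also have "\<dots> = f (2 * h) (2 * h + 1) * pf h f"
    unfolding pf_def gd sum_distrib_left ..
  finally show ?thesis .
qed

section \<open>Pfaffians bordered by columns\<close>

text \<open>
  The skew matrix with blocks \<open>A\<close>, \<open>V\<close>, \<open>- V\<^sup>T\<close>, \<open>0\<close>, where \<open>V\<close> has the columns \<open>vs\<close>. A list of
  columns, instead of a matrix \<open>V\<close>, lets column operations be list operations.
\<close>

definition bordered :: "nat \<Rightarrow> (nat \<Rightarrow> nat \<Rightarrow> 'a) \<Rightarrow> (nat \<Rightarrow> 'a) list \<Rightarrow> nat \<Rightarrow> nat \<Rightarrow> 'a::comm_ring_1" where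
  "bordered n A vs i j =
     (if i < n \<and> j < n then A i j
      else if i < n \<and> j < n + length vs then (vs ! (j - n)) i
      else if j < n \<and> i < n + length vs then - (vs ! (i - n)) j
      else 0)"

definition bpf :: "nat \<Rightarrow> (nat \<Rightarrow> nat \<Rightarrow> 'a) \<Rightarrow> (nat \<Rightarrow> 'a) list \<Rightarrow> 'a::comm_ring_1" where
  "bpf n A vs = pf ((n + length vs) div 2) (bordered n A vs)"

lemma bordered_skew:
  assumes "\<And>i j. A j i = - A i j"
  shows "bordered n A vs j i = - bordered n A vs i j"
proof (cases "i < n \<and> j < n")
  case True
  then show ?thesis using assms[where i = i and j = j] by (simp add: bordered_def)
qed (auto simp: bordered_def)

lemma bpf_cong:
  assumes "even (n + length vs)" "length vs = length ws"
    "\<And>i j. i < j \<Longrightarrow> j < n \<Longrightarrow> A i j = B i j"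
    "\<And>p i. p < length vs \<Longrightarrow> i < n \<Longrightarrow> (vs ! p) i = (ws ! p) i"
  shows "bpf n A vs = bpf n B ws"
  unfolding bpf_def assms(2)[symmetric]
  by (rule pf_cong) (use assms in \<open>auto simp: bordered_def\<close>)

lemma bpf_linear:
  assumes "even (n + length us + length vs + 1)"
  shows "bpf n A (us @ (\<lambda>i. \<alpha> * u i + \<beta> * w i) # vs) =
    \<alpha> * bpf n A (us @ u # vs) + \<beta> * bpf n A (us @ w # vs)"
proof -
  have h: "2 * ((n + length (us @ u # vs)) div 2) = n + length us + length vs + 1"
    using assms by simp presburger
  have len: "length (us @ (\<lambda>i. \<alpha> * u i + \<beta> * w i) # vs) = length (us @ u # vs)"
    "length (us @ w # vs) = length (us @ u # vs)" by simp_all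
  show ?thesis unfolding bpf_def len
  proof (rule pf_linear[where k = "n + length us"])
    show "n + length us < 2 * ((n + length (us @ u # vs)) div 2)" unfolding h by simp
  qed (auto simp: bordered_def nth_append nth_Cons' algebra_simps)
qed

lemma bpf_zero_column:
  assumes "even (n + length us + length vs + 1)"
  shows "bpf n A (us @ (\<lambda>i. 0) # vs) = 0"
  using bpf_linear[OF assms, where \<alpha> = 0 and \<beta> = 0 and A = A and u = "\<lambda>i. 0" and w = "\<lambda>i. 0"] by simp

lemma bpf_sum:
  assumes "even (n + length us + length vs + 1)" "finite S"
  shows "bpf n A (us @ (\<lambda>i. \<Sum>k\<in>S. c k * w k i) # vs) = (\<Sum>k\<in>S. c k * bpf n A (us @ w k # vs))"
  using assms(2)
proof induction
  case empty
  then show ?case using bpf_zero_column[OF assms(1)] by simp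
next
  case (insert k S)
  then show ?case
    using bpf_linear[OF assms(1), where \<alpha> = "c k" and \<beta> = 1 and u = "w k" and A = A
      and w = "\<lambda>i. \<Sum>k\<in>S. c k * w k i"] by simp
qed

lemma bpf_equal_columns:
  fixes A :: "nat \<Rightarrow> nat \<Rightarrow> 'a::{idom, ring_char_0}"
  assumes ev: "even (n + length vs)" and skew: "\<And>i j. A j i = - A i j"
    and pq: "p < q" "q < length vs" "vs ! p = vs ! q"
  shows "bpf n A vs = 0"
  unfolding bpf_def
proof (rule pf_equal_rows[of "n + p" "n + q"])
  have h: "2 * ((n + length vs) div 2) = n + length vs" using ev by simp
  show "n + p < 2 * ((n + length vs) div 2)" "n + q < 2 * ((n + length vs) div 2)" "n + p \<noteq> n + q"
    unfolding h using pq by auto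
  show "bordered n A vs (n + p) j = bordered n A vs (n + q) j" for j
    using pq by (auto simp: bordered_def)
qed (rule bordered_skew, rule skew)

lemma bpf_add_column:
  fixes A :: "nat \<Rightarrow> nat \<Rightarrow> 'a::{idom, ring_char_0}"
  assumes ev: "even (n + length us + length vs + 1)" and skew: "\<And>i j. A j i = - A i j"
    and w: "w \<in> set us"
  shows "bpf n A (us @ (\<lambda>i. u i + c * w i) # vs) = bpf n A (us @ u # vs)"
proof -
  obtain p where p: "p < length us" "us ! p = w" using w by (auto simp: in_set_conv_nth)
  have "bpf n A (us @ w # vs) = 0"
    by (rule bpf_equal_columns[OF _ skew, of _ _ p "length us"]) (use p ev in \<open>auto simp: nth_append\<close>)
  with bpf_linear[OF ev, where \<alpha> = 1 and \<beta> = c and A = A and u = u and w = w] show ?thesis by simp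
qed

text \<open>
  With more columns than rows of \<open>A\<close>, every matching has a pair inside the zero block: otherwise
  each of its \<open>h > n\<close> pairs would have its first entry below \<open>n\<close>.
\<close>

lemma bpf_too_many_columns:
  assumes ev: "even (n + length vs)" and n: "n < length vs"
  shows "bpf n A vs = 0"
proof -
  define h where "h = (n + length vs) div 2"
  have "2 * h = n + length vs" using ev by (simp add: h_def)
  with n have h: "n < h" "2 * h = n + length vs" by auto
  have "(\<Prod>i<h. bordered n A vs (s (2 * i)) (s (2 * i + 1))) = 0" if s: "s \<in> matchings h" for s
  proof -
    note sD = matchingsD[OF s]
    have "\<exists>i<h. n \<le> s (2 * i)"
    proof (rule ccontr)
      assume "\<not> ?thesis"
      then have "(\<lambda>i. s (2 * i)) ` {..<h} \<subseteq> {..<n}" by auto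
      moreover have "inj_on (\<lambda>i. s (2 * i)) {..<h}" by (simp add: inj_on_def inj_eq[OF sD(5)])
      ultimately have "card {..<h} \<le> card {..<n}" by (intro card_inj_on_le) auto
      then have "h \<le> n" by simp
      with h show False by simp
    qed
    then obtain i where "i < h" "n \<le> s (2 * i)" by blast
    then show ?thesis using sD(2)[of i] by (intro prod_zero) (auto simp: bordered_def intro!: bexI[of _ i])
  qed
  then show ?thesis unfolding bpf_def h_def[symmetric] pf_def by simp
qed

text \<open>
  Border \<open>A\<close> by \<open>vs\<close>, \<open>u\<close>, \<open>v\<close> and put \<open>1\<close> at the intersection of the last two indices. Splitting
  the last column gives the right hand side. Clearing the column of \<open>u\<close> with the help of this \<open>1\<close>
  adds the rank 2 term to \<open>A\<close> and isolates the last pair, which gives the left hand side.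
\<close>

lemma bpf_rank2_update:
  fixes A :: "nat \<Rightarrow> nat \<Rightarrow> 'a::{idom, ring_char_0}"
  assumes ev: "even (n + length vs)" and skew: "\<And>i j. A j i = - A i j"
  shows "bpf n (\<lambda>i j. A i j + (v i * u j - u i * v j)) vs = bpf n A vs + bpf n A (vs @ [u, v])"
proof -
  define h where "h = (n + length vs) div 2"
  have h: "2 * h = n + length vs" using ev by (simp add: h_def)
  have h': "(n + length (vs @ [x, y])) div 2 = Suc h" for x y :: "nat \<Rightarrow> 'a" using h by simp
  define E :: "nat \<Rightarrow> nat \<Rightarrow> 'a" where
    "E = (\<lambda>i j. if i = 2 * h \<and> j = 2 * h + 1 then 1 else if i = 2 * h + 1 \<and> j = 2 * h then - 1 else 0)"
  define M where "M = (\<lambda>i j. bordered n A (vs @ [u, v]) i j + E i j)"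
  define M0 where "M0 = (\<lambda>i j. bordered n A (vs @ [u, \<lambda>i. 0]) i j + E i j)"
  have nh: "n \<le> 2 * h" using h by simp
  have M_skew: "M j i = - M i j" for i j
  proof -
    have "E j i = - E i j" by (auto simp: E_def)
    with bordered_skew[OF skew, where n = n and vs = "vs @ [u, v]" and i = i and j = j] show ?thesis by (simp add:
      M_def)
  qed
  have "pf (Suc h) M = 1 * pf (Suc h) (bordered n A (vs @ [u, v])) + 1 * pf (Suc h) M0"
    by (rule pf_linear[where k = "2 * h + 1"])
      (use h in \<open>auto simp: M_def M0_def E_def bordered_def nth_append\<close>)
  also have "pf (Suc h) M0 = M0 (2 * h) (2 * h + 1) * pf h M0"
    by (rule pf_last_pair) (use h in \<open>auto simp: M0_def E_def bordered_def nth_append\<close>)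
  also have "M0 (2 * h) (2 * h + 1) = 1"
    using h by (auto simp: M0_def E_def bordered_def)
  also have "pf h M0 = bpf n A vs" unfolding bpf_def h_def[symmetric]
    by (rule pf_cong) (use h in \<open>auto simp: M0_def E_def bordered_def nth_append\<close>)
  finally have 1: "pf (Suc h) M = bpf n A vs + bpf n A (vs @ [u, v])"
    unfolding bpf_def h' by simp
  \<comment> \<open>\<open>T k\<close> is the matrix after the multiple \<open>u\<^sub>i\<close> of the last row and column has been added to the
    indices \<open>i < k\<close>.\<close>
  define T where "T = (\<lambda>k i j. M i j + (if i < k then u i * M (2 * h + 1) j else 0)
     + (if j < k then u j * M i (2 * h + 1) else 0))"
  have Mll: "M (2 * h + 1) (2 * h + 1) = 0" using h by (auto simp: M_def E_def bordered_def)
  have "k \<le> n \<Longrightarrow> pf (Suc h) (T k) = pf (Suc h) M" for k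
  proof (induction k)
    case (Suc k)
    have "T (Suc k) = (\<lambda>i j. T k i j + (if i = k then u k * T k (2 * h + 1) j else 0)
        + (if j = k then u k * T k i (2 * h + 1) else 0))"
      using Suc.prems nh Mll by (intro ext) (auto simp: T_def less_Suc_eq algebra_simps)
    moreover have "pf (Suc h) \<dots> = pf (Suc h) (T k)"
    proof (rule pf_transvection)
      show "T k j i = - T k i j" for i j
        unfolding T_def using M_skew[where i = i and j = j] M_skew[where i = "2 * h + 1" and j = j]
          M_skew[where i = "2 * h + 1" and j = i] by simp
    qed (use Suc.prems nh in auto)
    ultimately show ?case using Suc by simp
  qed (simp add: T_def)
  then have "pf (Suc h) M = pf (Suc h) (T n)" by simp
  also have "\<dots> = T n (2 * h) (2 * h + 1) * pf h (T n)"
    by (rule pf_last_pair) (use h in \<open>auto simp: T_def M_def E_def bordered_def nth_append\<close>)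
  also have "T n (2 * h) (2 * h + 1) = 1"
    using h by (auto simp: T_def M_def E_def bordered_def)
  also have "pf h (T n) = bpf n (\<lambda>i j. A i j + (v i * u j - u i * v j)) vs"
    unfolding bpf_def h_def[symmetric]
    by (rule pf_cong) (use h in \<open>auto simp: T_def M_def E_def bordered_def nth_append\<close>)
  finally show ?thesis using 1 by simp
qed

lemma bpf_scale:
  assumes "even (n + length vs)"
  shows "bpf n (\<lambda>i j. d i * d j * A i j) (map (\<lambda>v i. d i * v i) vs) = (\<Prod>i<n. d i) * bpf n A vs"
proof -
  define h where "h = (n + length vs) div 2"
  have h: "2 * h = n + length vs" using assms by (simp add: h_def)
  let ?d = "\<lambda>i. if i < n then d i else 1"
  have "bpf n (\<lambda>i j. d i * d j * A i j) (map (\<lambda>v i. d i * v i) vs) =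
      pf h (\<lambda>i j. ?d i * ?d j * bordered n A vs i j)"
    unfolding bpf_def length_map h_def[symmetric]
    by (rule pf_cong) (use h in \<open>auto simp: bordered_def\<close>)
  also have "\<dots> = (\<Prod>i<2 * h. ?d i) * bpf n A vs"
    unfolding bpf_def h_def[symmetric] by (rule pf_scale)
  also have "(\<Prod>i<2 * h. ?d i) = (\<Prod>i<n. d i)"
    by (rule prod.mono_neutral_cong_right) (use h in auto)
  finally show ?thesis .
qed

lemma bpf_hom:
  assumes "\<And>x y. \<phi> (x + y) = \<phi> x + \<phi> y" "\<And>x y. \<phi> (x * y) = \<phi> x * \<phi> y"
    "\<phi> (1::'a::comm_ring_1) = (1::'b::comm_ring_1)"
    and ev: "even (n + length vs)"
  shows "\<phi> (bpf n A vs) = bpf n (\<lambda>i j. \<phi> (A i j)) (map (\<lambda>v i. \<phi> (v i)) vs)"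
proof -
  note z = hom_0_uminus[of \<phi>, OF assms(1)]
  have "\<phi> (bpf n A vs) = pf ((n + length vs) div 2) (\<lambda>i j. \<phi> (bordered n A vs i j))"
    unfolding bpf_def by (rule pf_hom) (fact assms)+
  also have "\<dots> = bpf n (\<lambda>i j. \<phi> (A i j)) (map (\<lambda>v i. \<phi> (v i)) vs)"
    unfolding bpf_def length_map
    by (rule pf_cong) (use ev in \<open>auto simp: bordered_def z\<close>)
  finally show ?thesis .
qed

section \<open>Column operations on factorial monomials\<close>

instance fps :: (ring_char_0) ring_char_0 ..

text \<open>
  Characteristic 0 is needed since a Pfaffian with two equal rows is shown to be its own negative.
\<close>

instance fract :: ("{idom, ring_char_0}") field_char_0
proof
  show "inj (of_nat :: nat \<Rightarrow> 'a fract)"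
  proof
    fix m k :: nat
    have of_nat: "of_nat i = to_fract (of_nat i :: 'a)" for i by (induction i) simp_all
    assume "of_nat m = (of_nat k :: 'a fract)"
    then show "m = k" by (simp add: of_nat)
  qed
qed

abbreviation (input) lin :: "'a::field \<Rightarrow> 'a fps" where
  "lin c \<equiv> 1 - fps_const c * fps_X"

text \<open>
  The geometric series \<open>1 / (1 - c z)\<close>.
\<close>

definition geo :: "'a::field \<Rightarrow> 'a fps" where
  "geo c = inverse (lin c)"

lemma lin_geo [simp]: "lin c * geo c = 1" "geo c * lin c = 1"
  by (simp_all add: geo_def inverse_mult_eq_1 inverse_mult_eq_1')

lemma div_lin: "F / lin c = F * geo c"
  by (simp add: geo_def fps_divide_unit)

text \<open>
  The Cayley transform \<open>(1 + c z) / (1 - c z)\<close>, the factor of the generating function of the \<open>q\<^sub>r\<close>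
  at the variable \<open>c\<close>.
\<close>

definition cayley :: "'a::field \<Rightarrow> 'a fps" where
  "cayley c = (1 + fps_const c * fps_X) * geo c"

text \<open>
  The coefficient \<open>c\<close> for which \<open>D v\<^sub>m - c D v\<^sub>k\<close> is a finite combination of factorial monomials,
  and also the coefficient of \<open>v\<^sub>k\<close> in that combination.
\<close>

definition hit_coeff :: "(nat \<Rightarrow> 'a::field) \<Rightarrow> nat \<Rightarrow> nat \<Rightarrow> 'a fps" where
  "hit_coeff a m k = fps_X ^ (k - m) * (\<Prod>j=m..<k. geo (a j))"

text \<open>
  The coefficient of \<open>v\<^sub>k\<close> in the expansion of \<open>D v\<^sub>m\<close>, where \<open>hit\<close> tells that \<open>k\<close> is the index at
  which the expansion has been cut off.
\<close>

definition row_coeff :: "(nat \<Rightarrow> 'a::field) \<Rightarrow> bool \<Rightarrow> nat \<Rightarrow> nat \<Rightarrow> 'a fps" where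
  "row_coeff a hit m k =
     (if k = m then cayley (a m) else if hit then hit_coeff a m k
      else 2 * fps_X ^ (k - m) * (\<Prod>j=m..k. geo (a j)))"

lemma hit_coeff_Suc: "m \<le> k \<Longrightarrow> hit_coeff a m (Suc k) = hit_coeff a m k * (fps_X * geo (a k))"
  by (simp add: hit_coeff_def Suc_diff_le mult_ac)

lemma cayley_eq: "cayley c = 2 * geo c - 1"
proof -
  have "2 * geo c - 1 = 2 * geo c - lin c * geo c" by simp
  also have "\<dots> = cayley c" unfolding cayley_def by (simp add: algebra_simps)
  finally show ?thesis by simp
qed

lemma row_coeff_eq:
  assumes "m < k"
  shows "row_coeff a False m k = hit_coeff a m k * (1 + cayley (a k))"
proof -
  have "{m..k} = insert k {m..<k}" using assms by auto
  then show ?thesis using assms by (simp add: row_coeff_def cayley_eq hit_coeff_def mult_ac)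
qed

definition fmon :: "(nat \<Rightarrow> 'a::field) \<Rightarrow> nat \<Rightarrow> 'a \<Rightarrow> 'a fps" where
  "fmon a m u = fps_const (factorial_monomial a u m)"

lemma cayley_fmon_Suc:
  "cayley u * fmon a m u - fps_X * geo (a m) * (cayley u * fmon a (Suc m) u)
     = cayley (a m) * fmon a m u + fps_X * geo (a m) * fmon a (Suc m) u"
proof -
  let ?g = "geo (a m)" and ?A = "fps_const (a m)" and ?U = "fps_const u"
  have S: "fmon a (Suc m) u = fmon a m u * (?U - ?A)"
    by (simp add: fmon_def factorial_monomial_def)
  have "1 - fps_X * ?g * (?U - ?A) = ?g * lin (a m) - fps_X * ?g * (?U - ?A)" by simp
  also have "\<dots> = ?g * lin u" by (simp only: algebra_simps)
  finally have *: "1 - fps_X * ?g * (?U - ?A) = ?g * lin u" .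
  have "cayley u * fmon a m u - fps_X * ?g * (cayley u * fmon a (Suc m) u)
      = cayley u * fmon a m u * (1 - fps_X * ?g * (?U - ?A))" unfolding S by (simp only: algebra_simps mult_1_left)
  also have "\<dots> = (1 + ?U * fps_X) * (geo u * lin u) * ?g * fmon a m u" unfolding * cayley_def by (simp only: mult_ac)
  also have "\<dots> = cayley (a m) * fmon a m u + fps_X * ?g * fmon a (Suc m) u"
    unfolding S cayley_def lin_geo by (simp only: algebra_simps mult_1_left mult_1_right)
  finally show ?thesis .
qed

text \<open>
  For \<open>U = m + 1\<close> this is \<open>cayley_fmon_Suc\<close>, and the general case telescopes: replacing \<open>U\<close> by
  \<open>U + 1\<close> adds \<open>c\<close> times the same relation at \<open>U\<close>, which turns the cut-off coefficient \<open>c\<close> of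
  \<open>v\<^sub>U\<close> into \<open>c (1 + cayley a\<^sub>U)\<close>, the regular coefficient.
\<close>

lemma cayley_fmon_telescope:
  assumes "m < U"
  shows "cayley u * fmon a m u - hit_coeff a m U * (cayley u * fmon a U u) =
    (\<Sum>k=m..U. row_coeff a (k = U) m k * fmon a k u)"
proof -
  have "cayley u * fmon a m u - hit_coeff a m U * (cayley u * fmon a U u) =
    (\<Sum>k=m..<U. row_coeff a False m k * fmon a k u) + hit_coeff a m U * fmon a U u"
    using Suc_leI[OF assms]
  proof (induction U rule: dec_induct)
    case base
    have "hit_coeff a m (Suc m) = fps_X * geo (a m)" by (simp add: hit_coeff_def)
    with cayley_fmon_Suc[of u a m] show ?case by (simp add: row_coeff_def)
  next
    case (step U)
    let ?C = "hit_coeff a m U"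
    have "cayley u * fmon a m u - hit_coeff a m (Suc U) * (cayley u * fmon a (Suc U) u) =
      (cayley u * fmon a m u - ?C * (cayley u * fmon a U u))
      + ?C * (cayley u * fmon a U u - fps_X * geo (a U) * (cayley u * fmon a (Suc U) u))"
      using step by (simp add: hit_coeff_Suc algebra_simps)
    also have "\<dots> = (\<Sum>k=m..<U. row_coeff a False m k * fmon a k u) + ?C * fmon a U u
      + ?C * (cayley (a U) * fmon a U u + fps_X * geo (a U) * fmon a (Suc U) u)"
      unfolding step.IH cayley_fmon_Suc ..
    also have "\<dots> = (\<Sum>k=m..<Suc U. row_coeff a False m k * fmon a k u)
      + hit_coeff a m (Suc U) * fmon a (Suc U) u"
      using step by (simp add: hit_coeff_Suc row_coeff_eq algebra_simps)
    finally show ?case .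
  qed
  also have "\<dots> = (\<Sum>k=m..U. row_coeff a (k = U) m k * fmon a k u)"
  proof -
    have "{m..U} = insert U {m..<U}" using assms by auto
    moreover have "(\<Sum>k=m..<U. row_coeff a (k = U) m k * fmon a k u) = (\<Sum>k=m..<U. row_coeff a False m k * fmon a k u)"
      by (rule sum.cong) auto
    moreover have "row_coeff a (U = U) m U = hit_coeff a m U" using assms by (simp add: row_coeff_def)
    ultimately show ?thesis by simp
  qed
  finally show ?thesis .
qed

lemma row_coeff_dvd: "m \<le> k \<Longrightarrow> fps_X ^ (k - m) dvd row_coeff a hit m k"
  unfolding row_coeff_def hit_coeff_def by (auto simp: mult.assoc)

section \<open>Expansion along interlacing sequences\<close>

text \<open>
  The sequences \<open>k\<^sub>1 k\<^sub>2 ...\<close> with \<open>U \<ge> k\<^sub>1 \<ge> m\<^sub>1 \<ge> k\<^sub>2 \<ge> m\<^sub>2 \<ge> ...\<close>.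
\<close>

fun interlacings :: "nat \<Rightarrow> nat list \<Rightarrow> nat list set" where
  "interlacings U [] = {[]}"
| "interlacings U (m # ms) = (\<lambda>(k, ks). k # ks) ` ({m..U} \<times> interlacings m ms)"

fun strip_coeff :: "(nat \<Rightarrow> 'a::field) \<Rightarrow> nat \<Rightarrow> nat list \<Rightarrow> nat list \<Rightarrow> 'a fps" where
  "strip_coeff a U (m # ms) (k # ks) = row_coeff a (k = U) m k * strip_coeff a m ms ks"
| "strip_coeff a U _ _ = 1"

lemma finite_interlacings [simp]: "finite (interlacings U ms)"
  by (induction U ms rule: interlacings.induct) auto

lemma interlacings_length: "ks \<in> interlacings U ms \<Longrightarrow> length ks = length ms"
  by (induction U ms arbitrary: ks rule: interlacings.induct) auto

lemma sum_interlacings_Cons: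
  "(\<Sum>ks\<in>interlacings U (m # ms). g ks) = (\<Sum>ks\<in>interlacings m ms. \<Sum>k=m..U. g (k # ks))"
proof -
  have "(\<Sum>ks\<in>interlacings U (m # ms). g ks) = (\<Sum>p\<in>{m..U} \<times> interlacings m ms. g (fst p # snd p))"
    unfolding interlacings.simps
    by (subst sum.reindex) (auto simp: inj_on_def case_prod_unfold)
  also have "\<dots> = (\<Sum>k=m..U. \<Sum>ks\<in>interlacings m ms. g (k # ks))"
    by (simp add: sum.cartesian_product case_prod_unfold)
  finally show ?thesis by (simp add: sum.swap[of _ "interlacings m ms"])
qed

lemma interlacings_iff:
  "ks \<in> interlacings U ms \<longleftrightarrow>
     length ks = length ms \<and> (\<forall>j<length ms. ms ! j \<le> ks ! j \<and> ks ! j \<le> (U # ms) ! j)"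
proof (induction U ms arbitrary: ks rule: interlacings.induct)
  case (2 U m ms)
  show ?case
  proof (cases ks)
    case (Cons k ks')
    have "ks \<in> interlacings U (m # ms) \<longleftrightarrow> m \<le> k \<and> k \<le> U \<and> ks' \<in> interlacings m ms"
      using Cons by auto
    also have "\<dots> \<longleftrightarrow> length ks = length (m # ms) \<and>
        (\<forall>j<length (m # ms). (m # ms) ! j \<le> ks ! j \<and> ks ! j \<le> (U # m # ms) ! j)"
      unfolding 2 Cons length_Cons All_less_Suc2 by auto
    finally show ?thesis .
  qed auto
qed auto

lemma strip_coeff_eq_prod:
  "length ks = length ms \<Longrightarrow> strip_coeff a U ms ks =
     (\<Prod>j<length ms. row_coeff a (ks ! j = (U # ms) ! j) (ms ! j) (ks ! j))"
proof (induction a U ms ks rule: strip_coeff.induct)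
  case (1 a U m ms k ks)
  then show ?case by (simp add: prod.lessThan_Suc_shift del: prod.lessThan_Suc)
qed auto

lemma interlacings_sorted:
  assumes "ks \<in> interlacings U ms" "distinct ks"
  shows "sorted_wrt (>) ks"
proof -
  have "sorted_wrt (\<ge>) ks \<and> (\<forall>k\<in>set ks. k \<le> U)"
    using assms(1)
  proof (induction U ms arbitrary: ks rule: interlacings.induct)
    case (2 U m ms)
    then obtain k ks' where k: "ks = k # ks'" "m \<le> k" "k \<le> U" "ks' \<in> interlacings m ms" by auto
    with 2 have "sorted_wrt (\<ge>) ks' \<and> (\<forall>k\<in>set ks'. k \<le> m)" by auto
    with k show ?case by auto
  qed auto
  with assms(2) show ?thesis
    by (induction ks) (auto simp: order.order_iff_strict)
qed

text \<open>
  The matrix \<open>A\<close> is kept abstract since only its skew symmetry enters. The columns \<open>v m\<close> are the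
  factorial monomials at the variables, and \<open>w m = D v m\<close>.
\<close>

locale bordered_pfaffian =
  fixes n :: nat and A :: "nat \<Rightarrow> nat \<Rightarrow> 'b::field_char_0 fps" and x a :: "nat \<Rightarrow> 'b"
  assumes skew: "\<And>i j. A j i = - A i j"
begin

abbreviation v :: "nat \<Rightarrow> nat \<Rightarrow> 'b fps" where
  "v m \<equiv> \<lambda>i. fmon a m (x i)"

abbreviation w :: "nat \<Rightarrow> nat \<Rightarrow> 'b fps" where
  "w m \<equiv> \<lambda>i. cayley (x i) * fmon a m (x i)"

text \<open>
  Since \<open>w U\<close> is among the columns, a multiple of it may be subtracted from \<open>w m\<close>, which leaves
  the finite combination.
\<close>

lemma expand_column_below:
  assumes ev: "even (n + length us + length vs + 1)" and U: "w U \<in> set us" and m: "m < U"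
  shows "bpf n A (us @ w m # vs) = (\<Sum>k=m..U. row_coeff a (k = U) m k * bpf n A (us @ v k # vs))"
proof -
  have "bpf n A (us @ w m # vs) = bpf n A (us @ (\<lambda>i. w m i + (- hit_coeff a m U) * w U i) # vs)"
    by (rule bpf_add_column[OF ev skew U, symmetric])
  also have "(\<lambda>i. w m i + (- hit_coeff a m U) * w U i) = (\<lambda>i. \<Sum>k=m..U. row_coeff a (k = U) m k * v k i)"
    using cayley_fmon_telescope[OF m] by auto
  also have "bpf n A (us @ \<dots> # vs) = (\<Sum>k=m..U. row_coeff a (k = U) m k * bpf n A (us @ v k # vs))"
    by (rule bpf_sum[OF ev]) simp
  finally show ?thesis .
qed

text \<open>
  The columns are expanded from the last one to the first, so that the column used to cut off an
  expansion has not been expanded yet.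
\<close>

lemma expand_columns_below:
  assumes "even (n + length us + 1 + length ms + length vs)" "sorted_wrt (>) (U # ms)"
  shows "bpf n A (us @ w U # map w ms @ vs) =
    (\<Sum>ks\<in>interlacings U ms. strip_coeff a U ms ks * bpf n A (us @ w U # map v ks @ vs))"
  using assms
proof (induction ms arbitrary: us U)
  case (Cons m ms)
  let ?g = "\<lambda>ks. bpf n A (us @ w U # map v ks @ vs)"
  have "bpf n A (us @ w U # map w (m # ms) @ vs) = bpf n A ((us @ [w U]) @ w m # map w ms @ vs)" by simp
  also have "\<dots> = (\<Sum>ks\<in>interlacings m ms. strip_coeff a m ms ks * bpf n A ((us @ [w U]) @ w m # map v ks @ vs))"
    using Cons.IH[of "us @ [w U]" m] Cons.prems by simp
  also have "\<dots> = (\<Sum>ks\<in>interlacings m ms. strip_coeff a m ms ks *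
      (\<Sum>k=m..U. row_coeff a (k = U) m k * ?g (k # ks)))"
  proof (rule sum.cong[OF refl])
    fix ks assume "ks \<in> interlacings m ms"
    then have "bpf n A ((us @ [w U]) @ w m # map v ks @ vs) =
       (\<Sum>k=m..U. row_coeff a (k = U) m k * bpf n A ((us @ [w U]) @ v k # map v ks @ vs))"
      using Cons.prems interlacings_length by (intro expand_column_below) fastforce+
    then show "strip_coeff a m ms ks * bpf n A ((us @ [w U]) @ w m # map v ks @ vs) =
      strip_coeff a m ms ks * (\<Sum>k=m..U. row_coeff a (k = U) m k * ?g (k # ks))" by simp
  qed
  also have "\<dots> = (\<Sum>ks\<in>interlacings U (m # ms). strip_coeff a U (m # ms) ks * ?g ks)"
    unfolding sum_interlacings_Cons by (simp add: sum_distrib_left mult_ac)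
  finally show ?case .
qed simp

text \<open>
  The first column has no column before it to cut off its expansion. The telescoped relation with
  a large \<open>N\<close> still holds, and the terms of index \<open>N\<close> are divisible by \<open>z\<^bsup>r+1\<^esup>\<close>; they are
  collected in \<open>J\<close>.
\<close>

lemma expand_columns:
  assumes ev: "even (n + length ms + length vs)" and sorted: "sorted_wrt (>) (N # ms)"
    and N: "\<And>m. m \<in> set ms \<Longrightarrow> m + r < N"
  shows "\<exists>J. bpf n A (map w ms @ vs) =
    (\<Sum>ks\<in>interlacings (N - 1) ms. strip_coeff a N ms ks * bpf n A (map v ks @ vs)) + fps_X ^ (r + 1) * J"
proof (cases ms)
  case (Cons m ms')
  have mN: "m < N" using sorted Cons by simp
  have "r + 1 \<le> N - m" using N[of m] Cons by simp
  then obtain H where H: "hit_coeff a m N = fps_X ^ (r + 1) * H"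
    unfolding hit_coeff_def by (metis le_imp_power_dvd dvdE mult.assoc)
  let ?e = "\<lambda>ks. bpf n A (map v ks @ vs)" and ?J = "\<lambda>ks. bpf n A (w N # map v ks @ vs) + bpf n A (v N # map v ks @ vs)"
  have not_N: "(k = N) = False" if "k \<in> {m..N - 1}" for k using that mN by auto
  have tail: "bpf n A (w m # map v ks @ vs) =
      (\<Sum>k=m..N-1. row_coeff a False m k * ?e (k # ks)) + fps_X ^ (r + 1) * (H * ?J ks)"
    if ks: "ks \<in> interlacings m ms'" for ks
  proof -
    have ev': "even (n + length [] + length (map v ks @ vs) + 1)"
      using ev interlacings_length[OF ks] Cons by auto
    have "w m = (\<lambda>i. (\<Sum>k=m..N. row_coeff a (k = N) m k * v k i) + hit_coeff a m N * w N i)"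
      using cayley_fmon_telescope[OF mN, of _ a] by (auto simp: algebra_simps)
    then have "bpf n A ([] @ w m # map v ks @ vs) =
      bpf n A ([] @ (\<lambda>i. 1 * (\<Sum>k=m..N. row_coeff a (k = N) m k * v k i) + hit_coeff a m N * w N i) # map v ks @ vs)" by
        simp
    also have "\<dots> = (\<Sum>k=m..N. row_coeff a (k = N) m k * bpf n A ([] @ v k # map v ks @ vs))
        + hit_coeff a m N * bpf n A ([] @ w N # map v ks @ vs)"
      by (subst bpf_linear[OF ev'], subst bpf_sum[OF ev']) simp_all
    also have "(\<Sum>k=m..N. row_coeff a (k = N) m k * bpf n A ([] @ v k # map v ks @ vs)) =
      hit_coeff a m N * bpf n A (v N # map v ks @ vs) + (\<Sum>k=m..N-1. row_coeff a False m k * ?e (k # ks))"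
    proof -
      have "{m..N} = insert N {m..N-1}" using mN by auto
      moreover have "(\<Sum>k=m..N-1. row_coeff a (k = N) m k * bpf n A (v k # map v ks @ vs))
        = (\<Sum>k=m..N-1. row_coeff a False m k * ?e (k # ks))"
        by (intro sum.cong refl) (simp add: not_N)
      ultimately show ?thesis using mN by (simp add: row_coeff_def)
    qed
    finally show ?thesis unfolding H by (simp add: algebra_simps)
  qed
  have "bpf n A (map w ms @ vs) = bpf n A ([] @ w m # map w ms' @ vs)" using Cons by simp
  also have "\<dots> = (\<Sum>ks\<in>interlacings m ms'. strip_coeff a m ms' ks * bpf n A ([] @ w m # map v ks @ vs))"
    by (rule expand_columns_below) (use ev sorted Cons in simp_all)
  also have "\<dots> = (\<Sum>ks\<in>interlacings m ms'. strip_coeff a m ms' ks *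
      (\<Sum>k=m..N-1. row_coeff a False m k * ?e (k # ks)))
    + fps_X ^ (r + 1) * (\<Sum>ks\<in>interlacings m ms'. strip_coeff a m ms' ks * (H * ?J ks))"
    unfolding sum_distrib_left[of "fps_X ^ (r + 1)"] sum.distrib[symmetric]
    by (rule sum.cong[OF refl]) (simp add: tail algebra_simps)
  also have "(\<Sum>ks\<in>interlacings m ms'. strip_coeff a m ms' ks * (\<Sum>k=m..N-1. row_coeff a False m k * ?e (k # ks)))
     = (\<Sum>ks\<in>interlacings (N - 1) ms. strip_coeff a N ms ks * ?e ks)"
    unfolding Cons sum_interlacings_Cons sum_distrib_left
    by (intro sum.cong refl) (simp add: not_N mult_ac)
  finally show ?thesis by blast
qed simp

lemma bpf_v_zero:
  assumes "even (n + length ks)" "\<not> distinct ks"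
  shows "bpf n A (map v ks) = 0"
proof -
  obtain p q where "p < q" "q < length ks" "ks ! p = ks ! q"
    using assms(2) unfolding distinct_conv_nth by (metis linorder_neqE_nat)
  then show ?thesis by (intro bpf_equal_columns[OF _ skew, of _ _ p q]) (use assms in auto)
qed

end

section \<open>The Pieri rule for numerators\<close>

text \<open>
  The partition \<open>\<lambda>\<^sup>*\<close> of the definition of \<open>P\<^sub>\<lambda>\<close>.
\<close>

definition star :: "nat \<Rightarrow> nat list \<Rightarrow> nat list" where
  "star n lam = (if even (n + length lam) then lam else lam @ [0])"

abbreviation (input) A_entries :: "(nat \<Rightarrow> 'a::field) \<Rightarrow> nat \<Rightarrow> nat \<Rightarrow> 'a"
  where "A_entries x \<equiv> \<lambda>i j. (x j - x i) / (x j + x i)"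

text \<open>
  The numerator \<open>\<Delta>(x) P\<^sub>\<lambda>(x|a)\<close> if \<open>I = \<lambda>\<^sup>*\<close>.
\<close>

definition P_num :: "nat \<Rightarrow> (nat \<Rightarrow> 'a::field) \<Rightarrow> (nat \<Rightarrow> 'a) \<Rightarrow> nat list \<Rightarrow> 'a" where
  "P_num n x a I = bpf n (A_entries x) (map (\<lambda>m i. factorial_monomial a (x i) m) I)"

lemma even_star: "even (n + length (star n lam))"
  by (simp add: star_def)

lemma factorial_P_eq: "factorial_P n x a lam = 1 / Delta n x * P_num n x a (star n lam)"
proof -
  let ?I = "star n lam"
  let ?V = "V_matrix n x a ?I"
  let ?M = "four_block_mat (A_matrix n x) ?V (- transpose_mat ?V) (0\<^sub>m (length ?I) (length ?I))"
  define h where "h = (n + length ?I) div 2"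
  have h: "2 * h = n + length ?I" using even_star[of n lam] by (simp add: h_def)
  have "dim_row ?M = 2 * h" using h by (simp add: A_matrix_def)
  then have "pfaffian ?M = pf h (\<lambda>i j. ?M $$ (i, j))" by (rule pfaffian_eq_pf)
  also have "\<dots> = P_num n x a ?I" unfolding P_num_def bpf_def length_map h_def[symmetric]
    by (rule pf_cong) (use h in \<open>auto simp: A_matrix_def V_matrix_def bordered_def\<close>)
  finally show ?thesis by (simp add: factorial_P_def Let_def star_def)
qed

lemma fps_const_P_num:
  assumes "even (n + length I)"
  shows "fps_const (P_num n x a I) =
    bpf n (\<lambda>i j. fps_const ((x j - x i) / (x j + x i))) (map (\<lambda>m i. fmon a m (x i)) I)"
  unfolding P_num_def fmon_def using assms
  by (subst bpf_hom[where \<phi> = fps_const]) (simp_all add: o_def)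

lemma entries_skew:
  fixes x :: "nat \<Rightarrow> 'a::field"
  shows "fps_const ((x i - x j) / (x i + x j)) = - fps_const ((x j - x i) / (x j + x i))"
  by (metis add.commute fps_const_neg minus_diff_eq minus_divide_left)

text \<open>
  After multiplication by both denominators this is
  \<open>(1 + s z)(1 + t z) - (1 - s z)(1 - t z) = 2 (s + t) z\<close> together with
  \<open>(1 + t z)(1 - s z) - (1 + s z)(1 - t z) = 2 (t - s) z\<close>.
\<close>

lemma cayley_conjugate:
  fixes s t :: "'a::field"
  assumes "t + s \<noteq> 0"
  shows "cayley s * cayley t * fps_const ((t - s) / (t + s)) =
    fps_const ((t - s) / (t + s)) + (1 * cayley t - cayley s * 1)"
proof -
  define P where "P = fps_const ((t - s) / (t + s))"
  let ?S = "fps_const s * fps_X" and ?T = "fps_const t * fps_X"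
  have "P * (fps_const t + fps_const s) = fps_const t - fps_const s"
    using assms by (simp add: P_def)
  then have *: "P * (?T + ?S) = ?T - ?S" by (simp only: distrib_right[symmetric] mult.assoc[symmetric]
    left_diff_distrib[symmetric])
  have eq: "P * ((1 + ?S) * (1 + ?T)) = P * (lin s * lin t) + (P * (?T + ?S) + P * (?T + ?S))"
    by (simp only: algebra_simps mult_1_left mult_1_right)
  have "cayley s * cayley t * P = geo s * geo t * (P * ((1 + ?S) * (1 + ?T)))"
    by (simp add: cayley_def mult_ac)
  also have "\<dots> = P * ((geo s * lin s) * (geo t * lin t)) + geo s * geo t * ((?T - ?S) + (?T - ?S))"
    unfolding eq * by (simp only: algebra_simps)
  also have "(?T - ?S) + (?T - ?S) = lin s * (1 + ?T) - (1 + ?S) * lin t"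
    by (simp only: algebra_simps mult_1_left mult_1_right)
  also have "geo s * geo t * (lin s * (1 + ?T) - (1 + ?S) * lin t) = (geo s * lin s) * cayley t - cayley s * (geo t *
    lin t)"
    unfolding cayley_def by (simp only: algebra_simps mult_1_left mult_1_right)
  finally show ?thesis unfolding lin_geo P_def by simp
qed

text \<open>
  By \<open>cayley_conjugate\<close>, conjugation by \<open>D\<close> is a rank 2 update with the columns \<open>d = D v\<^sub>0\<close> and
  \<open>1 = v\<^sub>0\<close>.
\<close>

lemma cayley_times_bpf:
  fixes x a :: "nat \<Rightarrow> 'a::field_char_0"
  assumes ev: "even (n + length I)" and x: "\<And>i j. i < j \<Longrightarrow> j < n \<Longrightarrow> x j + x i \<noteq> 0"
  defines "A \<equiv> \<lambda>i j. fps_const ((x j - x i) / (x j + x i))"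
  shows "(\<Prod>i<n. cayley (x i)) * bpf n A (map (\<lambda>m i. fmon a m (x i)) I) =
    bpf n A (map (\<lambda>m i. cayley (x i) * fmon a m (x i)) I) +
    bpf n A (map (\<lambda>m i. cayley (x i) * fmon a m (x i)) (I @ [0]) @ [\<lambda>i. fmon a 0 (x i)])"
proof -
  let ?w = "map (\<lambda>m i. cayley (x i) * fmon a m (x i))"
  have skew: "A j i = - A i j" for i j
    unfolding A_def by (rule entries_skew)
  have 0: "fmon a 0 u = 1" for u by (simp add: fmon_def factorial_monomial_def)
  have "(\<Prod>i<n. cayley (x i)) * bpf n A (map (\<lambda>m i. fmon a m (x i)) I) =
    bpf n (\<lambda>i j. cayley (x i) * cayley (x j) * A i j) (?w I)"
    by (subst bpf_scale[symmetric]) (use ev in \<open>simp_all add: o_def\<close>)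
  also have "\<dots> = bpf n (\<lambda>i j. A i j + (1 * cayley (x j) - cayley (x i) * 1)) (?w I)"
    by (rule bpf_cong) (use ev x in \<open>auto simp: A_def cayley_conjugate\<close>)
  also have "\<dots> = bpf n A (?w I) + bpf n A (?w I @ [\<lambda>i. cayley (x i), \<lambda>_. 1])"
    by (rule bpf_rank2_update) (use ev in simp, rule skew)
  also have "?w I @ [\<lambda>i. cayley (x i), \<lambda>_. 1] = ?w (I @ [0]) @ [\<lambda>i. fmon a 0 (x i)]"
    by (simp add: 0)
  finally show ?thesis .
qed

definition interlaces :: "nat list \<Rightarrow> nat list \<Rightarrow> bool" where
  "interlaces mu lam \<longleftrightarrow> length lam \<le> length mu + 1 \<and>
     (\<forall>k\<in>{1..length mu + 1}. part mu k \<le> part lam k \<and> (1 < k \<longrightarrow> part lam k \<le> part mu (k - 1)))"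

abbreviation (input) row_factor ::
  "(nat \<Rightarrow> 'a::field) \<Rightarrow> nat list \<Rightarrow> nat list \<Rightarrow> nat \<Rightarrow> 'a fps"
  where "row_factor a mu lam k \<equiv>
    row_coeff a (1 < k \<and> part lam k = part mu (k - 1)) (part mu k) (part lam k)"

text \<open>
  The exceptional value \<open>1\<close> reflects that for even \<open>n + l(\<mu>)\<close> the list \<open>\<mu>\<^sup>*\<close> has no part \<open>0\<close>, so
  the row \<open>l(\<mu>) + 1\<close> contributes only if \<open>\<lambda>\<close> has a part there.
\<close>

definition pieri_row :: "nat \<Rightarrow> (nat \<Rightarrow> 'a::field) \<Rightarrow> nat list \<Rightarrow> nat list \<Rightarrow> nat \<Rightarrow> 'a fps" where
  "pieri_row n a mu lam k =
     (if k = length mu + 1 \<and> part lam k = 0 \<and> even (n + length mu) then 1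
      else row_factor a mu lam k)"

definition pieri_series :: "nat \<Rightarrow> (nat \<Rightarrow> 'a::field) \<Rightarrow> nat list \<Rightarrow> nat list \<Rightarrow> 'a fps" where
  "pieri_series n a mu lam =
     (if interlaces mu lam then \<Prod>k=1..length mu + 1. pieri_row n a mu lam k else 0)"

lemma part_nth: "j < length lam \<Longrightarrow> lam ! j = part lam (Suc j)"
  by (simp add: part_def)

lemma part_nth_snoc: "j < Suc (length lam) \<Longrightarrow> (lam @ [0]) ! j = part lam (Suc j)"
  by (auto simp: part_def nth_append)

lemma interlacings_iff_part:
  assumes "length L = h" "length M = h" "\<And>j. j < h \<Longrightarrow> L ! j = part mu (Suc j)"
    "\<And>j. j < h \<Longrightarrow> M ! j = part lam (Suc j)" "\<And>k. k \<in> set M \<Longrightarrow> k < N"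
  shows "M \<in> interlacings (N - 1) L \<longleftrightarrow>
    (\<forall>k\<in>{1..h}. part mu k \<le> part lam k \<and> (1 < k \<longrightarrow> part lam k \<le> part mu (k - 1)))"
proof -
  have "M \<in> interlacings (N - 1) L \<longleftrightarrow>
     (\<forall>j<h. part mu (Suc j) \<le> part lam (Suc j) \<and> (0 < j \<longrightarrow> part lam (Suc j) \<le> part mu j))"
    unfolding interlacings_iff
  proof (intro iffI conjI allI impI; (elim conjE)?)
    fix j assume *: "\<forall>j<length L. L ! j \<le> M ! j \<and> M ! j \<le> ((N - 1) # L) ! j" and j: "j < h"
    show "part mu (Suc j) \<le> part lam (Suc j)" using * assms j by auto
    show "part lam (Suc j) \<le> part mu j" if "0 < j"
    proof -
      obtain i where i: "j = Suc i" using \<open>0 < j\<close> by (cases j) auto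
      have "M ! j \<le> L ! i" using *[rule_format, of j] j assms(1) i by simp
      then show ?thesis using assms(3)[of i] assms(4)[OF j] i j by simp
    qed
  next
    fix j assume *: "\<forall>j<h. part mu (Suc j) \<le> part lam (Suc j) \<and> (0 < j \<longrightarrow> part lam (Suc j) \<le> part mu j)"
      and "j < length L"
    then have j: "j < h" using assms by simp
    show "L ! j \<le> M ! j" using * assms j by auto
    show "M ! j \<le> ((N - 1) # L) ! j"
    proof (cases j)
      case 0
      have "M ! 0 < N" using assms(2,5) j 0 by (metis nth_mem)
      then show ?thesis using 0 by simp
    next
      case (Suc i)
      then show ?thesis using * assms(3)[of i] assms(4)[OF j] j by auto
    qed
  qed (use assms in auto)
  also have "\<dots> \<longleftrightarrow> (\<forall>k\<in>{1..h}. part mu k \<le> part lam k \<and> (1 < k \<longrightarrow> part lam k \<le> part mu (k - 1)))"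
  proof (intro iffI ballI allI impI)
    fix k assume *: "\<forall>j<h. part mu (Suc j) \<le> part lam (Suc j) \<and> (0 < j \<longrightarrow> part lam (Suc j) \<le> part mu j)"
      and "k \<in> {1..h}"
    then obtain j where "k = Suc j" "j < h" by (cases k) auto
    with * show "part mu k \<le> part lam k \<and> (1 < k \<longrightarrow> part lam k \<le> part mu (k - 1))" by auto
  next
    fix j assume *: "\<forall>k\<in>{1..h}. part mu k \<le> part lam k \<and> (1 < k \<longrightarrow> part lam k \<le> part mu (k - 1))" "j < h"
    then show "part mu (Suc j) \<le> part lam (Suc j) \<and> (0 < j \<longrightarrow> part lam (Suc j) \<le> part mu j)"
      using *(1)[rule_format, of "Suc j"] by auto
  qed
  finally show ?thesis .
qed

lemma strip_coeff_part:
  assumes "length L = h" "length M = h" "\<And>j. j < h \<Longrightarrow> L ! j = part mu (Suc j)"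
    "\<And>j. j < h \<Longrightarrow> M ! j = part lam (Suc j)" "\<And>k. k \<in> set M \<Longrightarrow> k < N"
  shows "strip_coeff a N L M =
    (\<Prod>k=1..h. row_factor a mu lam k)"
proof -
  have "strip_coeff a N L M = (\<Prod>j<h. row_coeff a (M ! j = (N # L) ! j) (L ! j) (M ! j))"
    using assms(1,2) by (simp add: strip_coeff_eq_prod)
  also have "\<dots> = (\<Prod>j<h. row_coeff a (1 < Suc j \<and> part lam (Suc j) = part mu j) (part mu (Suc j)) (part lam (Suc j)))"
  proof (rule prod.cong[OF refl])
    fix j assume "j \<in> {..<h}"
    then have j: "j < h" by simp
    have "M ! j = (N # L) ! j \<longleftrightarrow> 1 < Suc j \<and> part lam (Suc j) = part mu j"
    proof (cases j)
      case 0
      have "M ! 0 < N" using assms(2,5) j 0 by (metis nth_mem)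
      then show ?thesis using 0 by simp
    next
      case (Suc i)
      then show ?thesis using assms(3)[of i] assms(4)[OF j] j by simp
    qed
    then show "row_coeff a (M ! j = (N # L) ! j) (L ! j) (M ! j) =
      row_coeff a (1 < Suc j \<and> part lam (Suc j) = part mu j) (part mu (Suc j)) (part lam (Suc j))"
      using assms(3,4) j by simp
  qed
  also have "\<dots> = (\<Prod>k=1..h. row_factor a mu lam k)"
    by (rule prod.reindex_bij_witness[of _ "\<lambda>k. k - 1" Suc]) auto
  finally show ?thesis .
qed

text \<open>
  The bound \<open>N\<close> makes the set finite; for a fixed power of \<open>z\<close> the coefficients of all other \<open>\<lambda>\<close>
  vanish.
\<close>

definition pieri_support :: "nat list \<Rightarrow> nat \<Rightarrow> nat list set" where
  "pieri_support mu N = {lam. strict_partition lam \<and> interlaces mu lam \<and> (\<forall>k\<in>set lam. k < N)}"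

lemma strict_partition_iff: "strict_partition lam \<longleftrightarrow> sorted_wrt (>) lam \<and> 0 \<notin> set lam"
  unfolding strict_partition_def by (metis gr0I less_numeral_extra(3))

lemma sorted_gt_distinct: "sorted_wrt (>) (ks :: nat list) \<Longrightarrow> distinct ks"
  by (induction ks) auto

lemma interlacings_bounded:
  assumes "ks \<in> interlacings (N - 1) L" "\<forall>m\<in>set L. m < N" "0 < N" "k \<in> set ks"
  shows "k < N"
proof -
  obtain j where j: "j < length ks" "k = ks ! j" using assms(4) by (auto simp: in_set_conv_nth)
  then have "k \<le> ((N - 1) # L) ! j" "j < length L" using assms(1) unfolding interlacings_iff by auto
  then show ?thesis using assms(2,3) by (cases j) (auto dest: nth_mem less_trans le_less_trans Suc_lessD)
qed

lemma interlaces_length_ge: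
  assumes "strict_partition mu" "interlaces mu lam"
  shows "length mu \<le> length lam"
proof (rule ccontr)
  assume "\<not> ?thesis"
  then have l: "length lam < length mu" by simp
  then have "part mu (length mu) \<le> part lam (length mu)"
    using assms(2) unfolding interlaces_def by (intro conjunct1[OF bspec[of _ _ "length mu"]]) auto
  moreover have "part lam (length mu) = 0" using l by (simp add: part_def)
  moreover have "part mu (length mu) > 0" using assms(1) l nth_mem[of "length mu - 1" mu]
    unfolding strict_partition_def part_def by auto
  ultimately show False by simp
qed

lemma interlaces_same_length:
  assumes "length lam = length mu"
  shows "interlaces mu lam \<longleftrightarrow>
    (\<forall>k\<in>{1..length mu}. part mu k \<le> part lam k \<and> (1 < k \<longrightarrow> part lam k \<le> part mu (k - 1)))"
proof -
  have *: "{1..length mu + 1} = insert (length mu + 1) {1..length mu}" by auto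
  have "part mu (length mu + 1) = 0" "part lam (length mu + 1) = 0" using assms by (simp_all add: part_def)
  then show ?thesis using assms unfolding interlaces_def * by simp
qed

context
  fixes mu :: "nat list" and N :: nat
  assumes mu: "strict_partition mu" and N: "\<forall>m\<in>set mu. m < N" "0 < N"
begin

lemma support_same_length:
  "{ks \<in> interlacings (N - 1) mu. distinct ks} = {lam \<in> pieri_support mu N. length lam = length mu}"
proof (intro equalityI subsetI; elim CollectE conjE)
  fix ks assume ks: "ks \<in> interlacings (N - 1) mu" "distinct ks"
  have len: "length ks = length mu" by (rule interlacings_length[OF ks(1)])
  have b: "k < N" if "k \<in> set ks" for k using interlacings_bounded[OF ks(1) N that] .
  have "0 \<notin> set ks"
  proof
    assume "0 \<in> set ks"
    then obtain j where "j < length ks" "ks ! j = 0" by (auto simp: in_set_conv_nth)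
    then have "mu ! j = 0" "j < length mu" using ks(1) unfolding interlacings_iff by auto
    then show False using mu unfolding strict_partition_iff by (metis nth_mem)
  qed
  moreover have "interlaces mu ks"
    unfolding interlaces_same_length[OF len]
    by (subst interlacings_iff_part[symmetric, where L = mu and M = ks and N = N])
      (use ks len b part_nth in auto)
  ultimately show "ks \<in> {lam \<in> pieri_support mu N. length lam = length mu}"
    using interlacings_sorted[OF ks] b len by (auto simp: pieri_support_def strict_partition_iff)
next
  fix lam assume lam: "lam \<in> pieri_support mu N" "length lam = length mu"
  then have "interlaces mu lam" by (simp add: pieri_support_def)
  then have "lam \<in> interlacings (N - 1) mu"
    unfolding interlaces_same_length[OF lam(2)]
    by (subst interlacings_iff_part[where mu = mu and lam = lam and h = "length mu"])
      (use lam part_nth in \<open>auto simp: pieri_support_def\<close>)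
  then show "lam \<in> {ks \<in> interlacings (N - 1) mu. distinct ks}"
    using lam sorted_gt_distinct by (auto simp: pieri_support_def strict_partition_iff)
qed

lemma interlacings_snoc_iff:
  assumes "length M = length mu + 1" "\<And>j. j < length mu + 1 \<Longrightarrow> M ! j = part lam (Suc j)"
    "\<And>k. k \<in> set M \<Longrightarrow> k < N" "length lam \<le> length mu + 1"
  shows "M \<in> interlacings (N - 1) (mu @ [0]) \<longleftrightarrow> interlaces mu lam"
  unfolding interlaces_def using assms(4)
  by (subst interlacings_iff_part[where mu = mu and lam = lam and h = "length mu + 1"])
    (use assms part_nth_snoc in auto)

lemma N_snoc: "\<forall>m\<in>set (mu @ [0]). m < N" using N by simp

lemma support_longer:
  "{ks \<in> interlacings (N - 1) (mu @ [0]). distinct (ks @ [0])} =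
     {lam \<in> pieri_support mu N. length lam = length mu + 1}"
proof (intro equalityI subsetI; elim CollectE conjE)
  fix ks assume ks: "ks \<in> interlacings (N - 1) (mu @ [0])" "distinct (ks @ [0])"
  have len: "length ks = length mu + 1" using interlacings_length[OF ks(1)] by simp
  have b: "k < N" if "k \<in> set ks" for k using interlacings_bounded[OF ks(1) N_snoc N(2) that] .
  have "interlaces mu ks"
    using ks(1) by (subst interlacings_snoc_iff[symmetric, where M = ks]) (use len b part_nth in auto)
  then show "ks \<in> {lam \<in> pieri_support mu N. length lam = length mu + 1}"
    using interlacings_sorted[OF ks(1)] b len ks(2) by (auto simp: pieri_support_def strict_partition_iff)
next
  fix lam assume lam: "lam \<in> pieri_support mu N" "length lam = length mu + 1"
  then have "lam \<in> interlacings (N - 1) (mu @ [0])"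
    by (subst interlacings_snoc_iff[where lam = lam]) (use part_nth in \<open>auto simp: pieri_support_def\<close>)
  then show "lam \<in> {ks \<in> interlacings (N - 1) (mu @ [0]). distinct (ks @ [0])}"
    using lam sorted_gt_distinct by (auto simp: pieri_support_def strict_partition_iff)
qed

lemma support_split:
  "{ks \<in> interlacings (N - 1) (mu @ [0]). distinct ks} =
     (\<lambda>lam. lam @ [0]) ` {lam \<in> pieri_support mu N. length lam = length mu} \<union>
     {lam \<in> pieri_support mu N. length lam = length mu + 1}" (is "?S = _ ` ?A \<union> ?B")
proof (intro equalityI subsetI)
  fix ks assume "ks \<in> ?S"
  then have ks: "ks \<in> interlacings (N - 1) (mu @ [0])" "distinct ks" by auto
  have len: "length ks = length mu + 1" using interlacings_length[OF ks(1)] by simp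
  then obtain lam e where le: "ks = lam @ [e]" by (cases ks rule: rev_exhaust) auto
  have b: "k < N" if "k \<in> set ks" for k using interlacings_bounded[OF ks(1) N_snoc N(2) that] .
  have srt: "sorted_wrt (>) ks" by (rule interlacings_sorted[OF ks])
  show "ks \<in> (\<lambda>lam. lam @ [0]) ` ?A \<union> ?B"
  proof (cases "e = 0")
    case True
    have "interlaces mu lam"
      using ks(1) by (subst interlacings_snoc_iff[symmetric, where M = ks])
        (use len b part_nth_snoc[of _ lam] le True in auto)
    moreover have "sorted_wrt (>) lam" "0 \<notin> set lam" using srt le by (auto simp: sorted_wrt_append)
    ultimately have "lam \<in> ?A" using b len le by (auto simp: pieri_support_def strict_partition_iff)
    then show ?thesis using le True by auto
  next
    case False
    then have "0 \<notin> set ks" using srt le by (auto simp: sorted_wrt_append)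
    then have "ks \<in> {ks \<in> interlacings (N - 1) (mu @ [0]). distinct (ks @ [0])}" using ks by simp
    then show ?thesis unfolding support_longer by simp
  qed
next
  fix ks assume "ks \<in> (\<lambda>lam. lam @ [0]) ` ?A \<union> ?B"
  then show "ks \<in> ?S"
  proof
    assume "ks \<in> ?B"
    then show ?thesis unfolding support_longer[symmetric] by simp
  next
    assume "ks \<in> (\<lambda>lam. lam @ [0]) ` ?A"
    then obtain lam where lam: "lam \<in> ?A" "ks = lam @ [0]" by auto
    then have "ks \<in> interlacings (N - 1) (mu @ [0])"
      by (subst interlacings_snoc_iff[where lam = lam])
        (use part_nth_snoc[of _ lam] N in \<open>auto simp: pieri_support_def\<close>)
    moreover have "distinct ks"
      using lam sorted_gt_distinct by (auto simp: pieri_support_def strict_partition_iff)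
    ultimately show ?thesis by simp
  qed
qed

lemma pieri_support_Un:
  "pieri_support mu N = {lam \<in> pieri_support mu N. length lam = length mu} \<union>
     {lam \<in> pieri_support mu N. length lam = length mu + 1}"
proof -
  have "length lam = length mu \<or> length lam = length mu + 1" if "lam \<in> pieri_support mu N" for lam
    using that interlaces_length_ge[OF mu, of lam] unfolding pieri_support_def interlaces_def
    by (auto simp: le_Suc_eq)
  then show ?thesis by auto
qed

lemma finite_pieri_support: "finite (pieri_support mu N)"
  by (subst pieri_support_Un) (simp only: finite_Un support_same_length[symmetric] support_longer[symmetric], simp)

lemma pieri_series_even:
  assumes "even (n + length mu)" "lam \<in> pieri_support mu N" "length lam = length mu"
  shows "pieri_series n a mu lam = strip_coeff a N mu lam"
proof -
  have "part lam (length mu + 1) = 0" using assms by (simp add: part_def)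
  then have "pieri_series n a mu lam = (\<Prod>k=1..length mu. pieri_row n a mu lam k)"
    using assms by (simp add: pieri_series_def pieri_support_def pieri_row_def)
  also have "\<dots> = strip_coeff a N mu lam"
    by (subst strip_coeff_part[where mu = mu and lam = lam and h = "length mu"])
      (use assms part_nth in \<open>auto simp: pieri_support_def pieri_row_def intro!: prod.cong\<close>)
  finally show ?thesis .
qed

lemma pieri_series_snoc:
  assumes "length M = length mu + 1" "\<And>j. j < length mu + 1 \<Longrightarrow> M ! j = part lam (Suc j)"
    "lam \<in> pieri_support mu N" "odd (n + length mu) \<or> length lam = length mu + 1"
  shows "pieri_series n a mu lam = strip_coeff a N (mu @ [0]) M"
proof -
  have b: "k < N" if "k \<in> set M" for k
  proof -
    obtain j where "j < length mu + 1" "k = part lam (Suc j)"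
      using \<open>k \<in> set M\<close> assms(1,2) by (auto simp: in_set_conv_nth)
    then show ?thesis using assms(3) N by (auto simp: part_def pieri_support_def)
  qed
  have nz: "part lam (length mu + 1) \<noteq> 0" if "length lam = length mu + 1"
  proof -
    have "lam ! length mu \<in> set lam" using that by (intro nth_mem) simp
    moreover have "0 \<notin> set lam" using assms(3) by (simp add: pieri_support_def strict_partition_iff)
    ultimately have "lam ! length mu \<noteq> 0" by metis
    then show ?thesis using that by (simp add: part_def)
  qed
  have "pieri_series n a mu lam = (\<Prod>k=1..length mu + 1. pieri_row n a mu lam k)"
    using assms by (simp add: pieri_series_def pieri_support_def)
  also have "\<dots> = (\<Prod>k=1..length mu + 1. row_factor a mu lam k)"
    by (rule prod.cong[OF refl]) (use assms(4) nz in \<open>auto simp: pieri_row_def\<close>)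
  also have "\<dots> = strip_coeff a N (mu @ [0]) M"
    by (rule strip_coeff_part[symmetric]) (use assms b part_nth_snoc in auto)
  finally show ?thesis .
qed

end

text \<open>
  If \<open>n + l(\<mu>)\<close> is even, \<open>\<mu>\<^sup>* = \<mu>\<close>: the first summand of \<open>cayley_times_bpf\<close> expands into the \<open>\<lambda>\<close>
  of length \<open>l(\<mu>)\<close>. In the second summand \<open>v\<^sub>0\<close> is a column already, so the expansion of \<open>D v\<^sub>0\<close>
  loses its term \<open>v\<^sub>0\<close> and the \<open>\<lambda>\<close> of length \<open>l(\<mu>) + 1\<close> remain. If \<open>n + l(\<mu>)\<close> is odd, \<open>\<mu>\<^sup>*\<close> ends
  in \<open>0\<close>: then \<open>D v\<^sub>0\<close> occurs twice in the second summand, which vanishes, and the first one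
  yields both lengths.
\<close>

lemma pieri_identity:
  fixes x a :: "nat \<Rightarrow> 'a::field_char_0"
  assumes x: "\<And>i j. i < j \<Longrightarrow> j < n \<Longrightarrow> x j + x i \<noteq> 0"
    and mu: "strict_partition mu" and N: "\<forall>m\<in>set mu. m + r < N" "r < N"
  shows "fps_nth (\<Prod>i<n. cayley (x i)) r * P_num n x a (star n mu) =
    (\<Sum>lam\<in>pieri_support mu N. fps_nth (pieri_series n a mu lam) r * P_num n x a (star n lam))"
proof -
  define A where "A = (\<lambda>i j. fps_const ((x j - x i) / (x j + x i)))"
  interpret bordered_pfaffian n A x a
    by standard (unfold A_def, rule entries_skew)
  let ?Q = "\<Prod>i<n. cayley (x i)"
  let ?c = "\<lambda>I. fps_const (P_num n x a I)"
  let ?K = "\<lambda>L T. {ks \<in> interlacings (N - 1) L. distinct (ks @ T)}"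
  let ?E = "\<lambda>L T. \<Sum>ks\<in>interlacings (N - 1) L. strip_coeff a N L ks * bpf n A (map v ks @ map v T)"
  let ?A = "{lam \<in> pieri_support mu N. length lam = length mu}"
  let ?B = "{lam \<in> pieri_support mu N. length lam = length mu + 1}"
  let ?t = "\<lambda>lam. pieri_series n a mu lam * fps_const (P_num n x a (star n lam))"
  have N': "\<forall>m\<in>set mu. m < N" "0 < N" using N by auto
  note finA = finite_pieri_support[OF mu N']
  have Pc: "bpf n A (map v I) = fps_const (P_num n x a I)" if "even (n + length I)" for I
    unfolding A_def by (rule fps_const_P_num[OF that, symmetric])
  have restrict: "?E L T =
     (\<Sum>ks\<in>?K L T. strip_coeff a N L ks * ?c (ks @ T))"
    if "even (n + length L + length T)" for L T
  proof -
    have ev: "even (n + length (ks @ T))" if "ks \<in> interlacings (N - 1) L" for ks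
      using interlacings_length[OF that] \<open>even (n + length L + length T)\<close> by auto
    have "?E L T =
      (\<Sum>ks\<in>?K L T. strip_coeff a N L ks * bpf n A (map v (ks @ T)))"
      by (rule sum.mono_neutral_cong_right) (use bpf_v_zero[OF ev] in auto)
    also have "\<dots> = (\<Sum>ks\<in>?K L T. strip_coeff a N L ks * ?c (ks @ T))"
      by (rule sum.cong[OF refl]) (use Pc[OF ev] in auto)
    finally show ?thesis .
  qed
  have srt: "sorted_wrt (>) (N # mu)" "sorted_wrt (>) (N # mu @ [0])"
    using mu N' by (auto simp: strict_partition_def sorted_wrt_append)
  have NS: "m + r < N" if "m \<in> set (mu @ [0])" for m using that N by auto
  have "\<exists>J. ?Q * ?c (star n mu) = (\<Sum>lam\<in>pieri_support mu N. ?t lam) + fps_X ^ (r + 1) * J"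
  proof (cases "even (n + length mu)")
    case True
    then have st: "star n mu = mu" by (simp add: star_def)
    obtain J1 where J1: "bpf n A (map w mu @ map v []) = (?E mu []) + fps_X ^ (r + 1) * J1"
      using expand_columns[of mu "[]" N r] True srt N by auto
    obtain J2 where J2: "bpf n A (map w (mu @ [0]) @ map v [0]) = (?E (mu @ [0]) [0]) + fps_X ^ (r + 1) * J2"
      using expand_columns[of "mu @ [0]" "map v [0]" N r, OF _ srt(2) NS] True by auto
    have 1: "(?E mu []) = (\<Sum>lam\<in>?A. ?t lam)"
    proof -
      have "(?E mu []) =
          (\<Sum>ks\<in>?A. strip_coeff a N mu ks * ?c (ks @ []))"
        using restrict[of mu "[]"] True unfolding support_same_length[OF mu N', symmetric] by simp
      also have "\<dots> = (\<Sum>lam\<in>?A. ?t lam)"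
        by (rule sum.cong[OF refl]) (use True in \<open>simp add: star_def pieri_series_even[OF mu N']\<close>)
      finally show ?thesis .
    qed
    have sB: "pieri_series n a mu lam = strip_coeff a N (mu @ [0]) lam" if "lam \<in> ?B" for lam
      by (rule pieri_series_snoc[OF mu N']) (use that part_nth in auto)
    have "(?E (mu @ [0]) [0]) =
        (\<Sum>ks\<in>?B. strip_coeff a N (mu @ [0]) ks * ?c (ks @ [0]))"
      unfolding support_longer[OF mu N', symmetric] by (rule restrict) (use True in simp)
    also have "\<dots> = (\<Sum>lam\<in>?B. ?t lam)"
      by (rule sum.cong[OF refl]) (use True sB in \<open>simp add: star_def\<close>)
    finally have 2: "(?E (mu @ [0]) [0]) = (\<Sum>lam\<in>?B. ?t lam)" .
    have "?Q * bpf n A (map v mu) = bpf n A (map w mu) + bpf n A (map w (mu @ [0]) @ [v 0])"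
      unfolding A_def by (rule cayley_times_bpf) (use True x in auto)
    also have "\<dots> = ((\<Sum>lam\<in>?A. ?t lam) + (\<Sum>lam\<in>?B. ?t lam)) + fps_X ^ (r + 1) * (J1 + J2)"
      using J1 J2 unfolding 1 2 by (simp add: algebra_simps)
    also have "(\<Sum>lam\<in>?A. ?t lam) + (\<Sum>lam\<in>?B. ?t lam) = (\<Sum>lam\<in>?A \<union> ?B. ?t lam)"
      by (rule sum.union_disjoint[symmetric]) (use finA in auto)
    finally show ?thesis unfolding pieri_support_Un[OF mu N', symmetric] st Pc[OF True] by blast
  next
    case False
    then have st: "star n mu = mu @ [0]" by (simp add: star_def)
    have ev: "even (n + length (mu @ [0]))" using False by simp
    obtain J where J: "bpf n A (map w (mu @ [0]) @ map v []) = (?E (mu @ [0]) []) + fps_X ^ (r + 1) * J"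
      using expand_columns[of "mu @ [0]" "[]" N r, OF _ srt(2) NS] False by auto
    have sA: "pieri_series n a mu lam = strip_coeff a N (mu @ [0]) (lam @ [0])" if "lam \<in> ?A" for lam
      by (rule pieri_series_snoc[OF mu N']) (use that part_nth_snoc[of _ lam] False in auto)
    have sB: "pieri_series n a mu lam = strip_coeff a N (mu @ [0]) lam" if "lam \<in> ?B" for lam
      by (rule pieri_series_snoc[OF mu N']) (use that part_nth in auto)
    have "(?E (mu @ [0]) []) =
        (\<Sum>ks\<in>(\<lambda>lam. lam @ [0]) ` ?A \<union> ?B. strip_coeff a N (mu @ [0]) ks * ?c ks)"
      using restrict[of "mu @ [0]" "[]"] False unfolding support_split[OF mu N', symmetric] by simp
    also have "\<dots> = (\<Sum>ks\<in>(\<lambda>lam. lam @ [0]) ` ?A. strip_coeff a N (mu @ [0]) ks * ?c ks)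
       + (\<Sum>ks\<in>?B. strip_coeff a N (mu @ [0]) ks * ?c ks)"
    proof (rule sum.union_disjoint)
      show "(\<lambda>lam. lam @ [0]) ` ?A \<inter> ?B = {}" by (auto simp: pieri_support_def strict_partition_iff)
    qed (use finA in auto)
    also have "(\<Sum>ks\<in>(\<lambda>lam. lam @ [0]) ` ?A. strip_coeff a N (mu @ [0]) ks * ?c ks) = (\<Sum>lam\<in>?A. ?t lam)"
      by (subst sum.reindex) (use sA False in \<open>auto simp: inj_on_def star_def intro!: sum.cong\<close>)
    also have "(\<Sum>ks\<in>?B. strip_coeff a N (mu @ [0]) ks * ?c ks) = (\<Sum>lam\<in>?B. ?t lam)"
      by (rule sum.cong) (use sB False in \<open>auto simp: star_def\<close>)
    also have "(\<Sum>lam\<in>?A. ?t lam) + (\<Sum>lam\<in>?B. ?t lam) = (\<Sum>lam\<in>?A \<union> ?B. ?t lam)"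
      by (rule sum.union_disjoint[symmetric]) (use finA in auto)
    finally have sum: "(?E (mu @ [0]) []) =
      (\<Sum>lam\<in>pieri_support mu N. ?t lam)" unfolding pieri_support_Un[OF mu N', symmetric] .
    have "bpf n A (map w ((mu @ [0]) @ [0]) @ [v 0]) = 0"
    proof (rule bpf_equal_columns[OF _ skew, where p = "length mu" and q = "Suc (length mu)"])
      show "(map w ((mu @ [0]) @ [0]) @ [v 0]) ! length mu = (map w ((mu @ [0]) @ [0]) @ [v 0]) ! Suc (length mu)"
        by (simp add: nth_append)
    qed (use False in auto)
    moreover have "?Q * bpf n A (map v (mu @ [0])) = bpf n A (map w (mu @ [0])) + bpf n A (map w ((mu @ [0]) @ [0]) @ [v
      0])"
      unfolding A_def by (rule cayley_times_bpf) (use ev x in auto)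
    ultimately have "?Q * bpf n A (map v (mu @ [0])) = (\<Sum>lam\<in>pieri_support mu N. ?t lam) + fps_X ^ (r + 1) * J"
      using J unfolding sum by simp
    then show ?thesis unfolding st Pc[OF ev] by blast
  qed
  then obtain J where "?Q * ?c (star n mu) = (\<Sum>lam\<in>pieri_support mu N. ?t lam) + fps_X ^ (r + 1) * J" ..
  from arg_cong[OF this, of "\<lambda>F. fps_nth F r"] show ?thesis by (simp add: fps_sum_nth fps_X_power_mult_nth del:
    power_Suc)
qed

section \<open>The leading coefficient in the last variable\<close>

text \<open>
  Reordering indices needs a skew matrix, while matrices given by cases are easier to describe
  above the diagonal only.
\<close>

definition skewize :: "(nat \<Rightarrow> nat \<Rightarrow> 'a) \<Rightarrow> nat \<Rightarrow> nat \<Rightarrow> 'a::comm_ring_1" where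
  "skewize f i j = (if i < j then f i j else if j < i then - f j i else 0)"

lemma skewize_skew: "skewize f j i = - skewize f i j"
  by (auto simp: skewize_def)

lemma pf_skewize: "pf h (skewize f) = pf h f"
  by (rule pf_cong) (simp add: skewize_def)

text \<open>
  Moving the pair past one later index takes two adjacent transpositions, so the pair can be moved
  to the end without a sign.
\<close>

lemma pf_isolated_pair_skew:
  fixes f :: "nat \<Rightarrow> nat \<Rightarrow> 'a::comm_ring_1"
  assumes "k < 2 * h + 1" and "\<And>i j. f j i = - f i j"
    and "\<And>j. j < 2 * h + 2 \<Longrightarrow> j \<noteq> k + 1 \<Longrightarrow> f k j = 0"
  shows "pf (Suc h) f = f k (k + 1) * pf h (\<lambda>i j. f (if i < k then i else i + 2) (if j < k then j else j + 2))"
  using assms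
proof (induction "2 * h - k" arbitrary: k f)
  case 0
  have k: "k = 2 * h" using 0(1,2) by simp
  have "f i (2 * h) = 0" if "i < 2 * h" for i
    using 0(3)[where i = "2 * h" and j = i] 0(4)[of i] that k by simp
  then have "pf (Suc h) f = f (2 * h) (2 * h + 1) * pf h f" by (intro pf_last_pair) auto
  also have "pf h f = pf h (\<lambda>i j. f (if i < k then i else i + 2) (if j < k then j else j + 2))"
    by (rule pf_cong) (simp add: k)
  finally show ?case by (simp add: k)
next
  case (Suc d)
  \<comment> \<open>Conjugating \<open>f\<close> by both transpositions moves the pair \<open>(k, k + 1)\<close> to \<open>(k + 1, k + 2)\<close>.\<close>
  let ?\<tau> = "transpose (k + 1) (k + 2)" and ?\<sigma> = "transpose k (k + 1)"
  let ?f = "\<lambda>i j. f (?\<tau> (?\<sigma> i)) (?\<tau> (?\<sigma> j))"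
  have k: "k + 2 < 2 * Suc h" using Suc.hyps(2) by simp
  have "pf (Suc h) ?f = - pf (Suc h) (\<lambda>i j. f (?\<tau> i) (?\<tau> j))"
    by (rule pf_swap_adjacent[where f = "\<lambda>i j. f (?\<tau> i) (?\<tau> j)"]) (use k in simp, rule Suc.prems(2))
  also have "pf (Suc h) (\<lambda>i j. f (?\<tau> i) (?\<tau> j)) = - pf (Suc h) f"
    using pf_swap_adjacent[where k = "k + 1" and h = "Suc h" and f = f, OF _ Suc.prems(2)] k by simp
  finally have "pf (Suc h) f = pf (Suc h) ?f" by simp
  also have "\<dots> = ?f (k + 1) (k + 1 + 1) *
      pf h (\<lambda>i j. ?f (if i < k + 1 then i else i + 2) (if j < k + 1 then j else j + 2))"
  proof (rule Suc.hyps(1))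
    show "?f j i = - ?f i j" for i j by (rule Suc.prems(2))
    show "?f (k + 1) j = 0" if j: "j < 2 * h + 2" "j \<noteq> k + 1 + 1" for j
    proof -
      have "?\<tau> (?\<sigma> (k + 1)) = k" by (simp add: transpose_def)
      moreover have "?\<tau> (?\<sigma> j) < 2 * h + 2" "?\<tau> (?\<sigma> j) \<noteq> k + 1"
        using j k by (auto simp: transpose_def)
      ultimately show ?thesis using Suc.prems(3) by simp
    qed
  qed (use Suc.hyps(2) in auto)
  also have "?f (k + 1) (k + 1 + 1) = f k (k + 1)" by (simp add: transpose_def)
  also have "pf h (\<lambda>i j. ?f (if i < k + 1 then i else i + 2) (if j < k + 1 then j else j + 2)) =
      pf h (\<lambda>i j. f (if i < k then i else i + 2) (if j < k then j else j + 2))"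
  proof -
    have "?\<tau> (?\<sigma> (if i < k + 1 then i else i + 2)) = (if i < k then i else i + 2)" for i
      by (auto simp: transpose_def)
    then show ?thesis by simp
  qed
  finally show ?case .
qed

lemma pf_isolated_pair:
  fixes f :: "nat \<Rightarrow> nat \<Rightarrow> 'a::comm_ring_1"
  assumes k: "k < 2 * h + 1" and before: "\<And>i. i < k \<Longrightarrow> f i k = 0"
    and after: "\<And>j. k + 1 < j \<Longrightarrow> j < 2 * h + 2 \<Longrightarrow> f k j = 0"
  shows "pf (Suc h) f = f k (k + 1) * pf h (\<lambda>i j. f (if i < k then i else i + 2) (if j < k then j else j + 2))"
proof -
  have "pf (Suc h) f = pf (Suc h) (skewize f)" by (simp only: pf_skewize)
  also have "\<dots> = skewize f k (k + 1) *
      pf h (\<lambda>i j. skewize f (if i < k then i else i + 2) (if j < k then j else j + 2))"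
  proof (rule pf_isolated_pair_skew[OF k skewize_skew])
    fix j assume "j < 2 * h + 2" "j \<noteq> k + 1"
    then show "skewize f k j = 0" using before[of j] after[of j] by (auto simp: skewize_def)
  qed
  also have "pf h (\<lambda>i j. skewize f (if i < k then i else i + 2) (if j < k then j else j + 2)) =
      pf h (\<lambda>i j. f (if i < k then i else i + 2) (if j < k then j else j + 2))"
    by (rule pf_cong) (auto simp: skewize_def)
  finally show ?thesis by (simp add: skewize_def)
qed

text \<open>
  Polynomial entries occur only in row and column \<open>k\<close>, and every term has exactly one factor from
  there, so taking a coefficient commutes with the Pfaffian.
\<close>

lemma pf_coeff_row:
  fixes M :: "nat \<Rightarrow> nat \<Rightarrow> 'a::comm_ring_1 poly"
  assumes k: "k < 2 * h"
    and const: "\<And>i j. i < j \<Longrightarrow> j < 2 * h \<Longrightarrow> i \<noteq> k \<Longrightarrow> j \<noteq> k \<Longrightarrow> M i j = [:f i j:]"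
    and row: "\<And>i j. i < j \<Longrightarrow> j < 2 * h \<Longrightarrow> i = k \<or> j = k \<Longrightarrow> coeff (M i j) m = f i j"
  shows "coeff (pf h M) m = pf h f"
  unfolding pf_def coeff_sum
proof (rule sum.cong[OF refl])
  fix s assume s: "s \<in> matchings h"
  note sD = matchingsD[OF s]
  obtain i where i: "i < h" "s (2 * i) = k \<or> s (2 * i + 1) = k"
    "\<And>j. j < h \<Longrightarrow> j \<noteq> i \<Longrightarrow> s (2 * j) \<noteq> k \<and> s (2 * j + 1) \<noteq> k"
    using matching_pair[OF s k] by blast
  let ?R = "\<Prod>j\<in>{..<h} - {i}. f (s (2 * j)) (s (2 * j + 1))"
  have "(\<Prod>j\<in>{..<h} - {i}. M (s (2 * j)) (s (2 * j + 1))) = (\<Prod>j\<in>{..<h} - {i}. [:f (s (2 * j)) (s (2 * j + 1)):])"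
    by (rule prod.cong[OF refl]) (use const i(3) sD in auto)
  also have "\<dots> = [:?R:]"
    by (induction "{..<h} - {i}" rule: infinite_finite_induct) (simp_all add: pCons_one prod_to_poly)
  finally have R: "(\<Prod>j\<in>{..<h} - {i}. M (s (2 * j)) (s (2 * j + 1))) = [:?R:]" .
  have row_i: "coeff (M (s (2 * i)) (s (2 * i + 1))) m = f (s (2 * i)) (s (2 * i + 1))"
    by (rule row) (use i sD in auto)
  have "(\<Prod>j<h. M (s (2 * j)) (s (2 * j + 1))) = M (s (2 * i)) (s (2 * i + 1)) * [:?R:]"
    unfolding R[symmetric] by (rule prod.remove) (use i in auto)
  then have "coeff (of_int (sign s) * (\<Prod>j<h. M (s (2 * j)) (s (2 * j + 1)))) m =
     of_int (sign s) * (f (s (2 * i)) (s (2 * i + 1)) * ?R)"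
    using row_i by (cases s rule: sign_cases) (simp_all add: mult.commute)
  also have "f (s (2 * i)) (s (2 * i + 1)) * ?R = pair_prod h f s"
    by (rule prod.remove[symmetric]) (use i in auto)
  finally show "coeff (of_int (sign s) * (\<Prod>j<h. M (s (2 * j)) (s (2 * j + 1)))) m =
    of_int (sign s) * pair_prod h f s" .
qed

lemma monic_prod_linear:
  fixes c :: "nat \<Rightarrow> 'a::idom"
  assumes "finite S"
  shows "degree (\<Prod>k\<in>S. [:c k, 1:]) = card S" "lead_coeff (\<Prod>k\<in>S. [:c k, 1:]) = 1"
proof -
  show "degree (\<Prod>k\<in>S. [:c k, 1:]) = card S" by (subst degree_prod_sum_eq) auto
  show "lead_coeff (\<Prod>k\<in>S. [:c k, 1:]) = 1" by (simp add: lead_coeff_prod)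
qed

lemma coeff_monic_prod:
  fixes c d :: "nat \<Rightarrow> 'a::idom"
  assumes "finite S" "finite T" "card S + card T \<le> m"
  shows "coeff ((\<Prod>k\<in>S. [:c k, 1:]) * (\<Prod>k\<in>T. [:d k, 1:])) m = (if m = card S + card T then 1 else 0)"
proof -
  let ?p = "(\<Prod>k\<in>S. [:c k, 1:]) * (\<Prod>k\<in>T. [:d k, 1:])"
  have "?p \<noteq> 0" using assms by auto
  then have "degree ?p = card S + card T"
    by (subst degree_mult_eq) (use assms in \<open>auto simp: monic_prod_linear\<close>)
  moreover have "lead_coeff ?p = 1" by (simp only: lead_coeff_mult monic_prod_linear(2)[OF assms(1)]
    monic_prod_linear(2)[OF assms(2)] mult_1_left)
  ultimately show ?thesis using assms(3) coeff_eq_0[of ?p m] by (cases "m = card S + card T") auto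
qed

text \<open>
  Only denominators off the diagonal are required to be nonzero: the diagonal of \<open>A\<close> never enters
  a Pfaffian, and the denominator \<open>2 x\<^sub>i\<close> there may vanish.
\<close>

definition generic :: "nat \<Rightarrow> (nat \<Rightarrow> 'a::field) \<Rightarrow> bool" where
  "generic n x \<longleftrightarrow> (\<forall>i j. i < j \<and> j < n \<longrightarrow> x j + x i \<noteq> 0)"

text \<open>
  The coefficient of \<open>t\<^sup>d\<close> in a numerator in \<open>n + 1\<close> variables all of whose indices are at most
  \<open>d\<close>, as the last variable \<open>t\<close> grows. For \<open>d = 0\<close> the entries of \<open>A\<close> in the last column tend to
  \<open>1\<close>, so the last variable turns into a column \<open>v\<^sub>0\<close> if there is none, and otherwise cancels
  against it.
\<close>

definition lead_P :: "nat \<Rightarrow> (nat \<Rightarrow> 'a::field) \<Rightarrow> (nat \<Rightarrow> 'a) \<Rightarrow> nat \<Rightarrow> nat list \<Rightarrow> 'a" where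
  "lead_P n x a d I =
     (if d = 0 then P_num n x a (if I = [] then [0] else [])
      else if I \<noteq> [] \<and> hd I = d then P_num n x a (tl I) else 0)"

text \<open>
  The matrix of a numerator in \<open>n + 1\<close> variables as a function of its last variable \<open>t\<close>, with row
  and column \<open>n\<close> multiplied by \<open>\<Prod>\<^sub>j (t + x\<^sub>j)\<close> in order to have polynomial entries. Only the
  entries above the diagonal matter.
\<close>

definition last_var_matrix :: "nat \<Rightarrow> (nat \<Rightarrow> 'a::field) \<Rightarrow> (nat \<Rightarrow> 'a) \<Rightarrow> nat list \<Rightarrow> nat \<Rightarrow> nat \<Rightarrow> 'a poly" where
  "last_var_matrix n x a I i j =
     (if j = n then (\<Prod>k\<in>{i}. [:- x k, 1:]) * (\<Prod>k\<in>{..<n} - {i}. [:x k, 1:])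
      else if i = n then (\<Prod>k<I ! (j - Suc n). [:- a k, 1:]) * (\<Prod>k<n. [:x k, 1:])
      else [:bordered (Suc n) (A_entries x)
              (map (\<lambda>m i. factorial_monomial a (x i) m) I) i j:])"

lemma poly_last_var_matrix:
  fixes x :: "nat \<Rightarrow> 'a::field"
  assumes ev: "even (Suc n + length I)" and t: "\<And>j. j < n \<Longrightarrow> t + x j \<noteq> 0"
  defines "h \<equiv> (Suc n + length I) div 2"
  shows "poly (pf h (last_var_matrix n x a I)) t = (\<Prod>j<n. t + x j) * P_num (Suc n) (x(n := t)) a I"
proof -
  define y where "y = x(n := t)"
  define E where "E = (\<Prod>j<n. t + x j)"
  have h: "2 * h = Suc n + length I" using ev by (simp add: h_def)
  let ?B = "bordered (Suc n) (A_entries y) (map (\<lambda>m i. factorial_monomial a (y i) m) I)"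
  let ?d = "\<lambda>i. if i = n then E else 1"
  have E: "E = (t + x i) * (\<Prod>k\<in>{..<n} - {i}. t + x k)" if "i < n" for i
    unfolding E_def by (rule prod.remove) (use that in auto)
  have "poly (pf h (last_var_matrix n x a I)) t = pf h (\<lambda>i j. poly (last_var_matrix n x a I i j) t)"
    by (rule pf_hom) simp_all
  also have "\<dots> = pf h (\<lambda>i j. ?d i * ?d j * ?B i j)"
  proof (rule pf_cong)
    fix i j assume ij: "i < j" "j < 2 * h"
    consider "j = n" | "i = n" | "i \<noteq> n" "j \<noteq> n" by blast
    then show "poly (last_var_matrix n x a I i j) t = ?d i * ?d j * ?B i j"
    proof cases
      case 1
      have "E * ((t - x i) / (t + x i)) = (t - x i) * (\<Prod>k\<in>{..<n} - {i}. t + x k)"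
        using E[of i] t[of i] ij 1 by (simp add: field_simps)
      with ij 1 show ?thesis
        by (simp add: last_var_matrix_def bordered_def y_def poly_prod add.commute left_diff_distrib mult_ac)
    next
      case 2
      with ij h show ?thesis
        by (auto simp: last_var_matrix_def bordered_def y_def poly_prod factorial_monomial_def E_def add.commute
          mult_ac)
    next
      case 3
      with ij h show ?thesis
        by (auto simp: last_var_matrix_def bordered_def y_def)
    qed
  qed
  also have "\<dots> = (\<Prod>i<2 * h. ?d i) * pf h ?B" by (rule pf_scale)
  also have "(\<Prod>i<2 * h. ?d i) = E" using h by (subst prod.delta) auto
  also have "pf h ?B = P_num (Suc n) y a I" unfolding P_num_def bpf_def h_def by simp
  finally show ?thesis unfolding E_def y_def .
qed

text \<open>
  For \<open>d > 0\<close> the only entry of degree \<open>d + n\<close> in row \<open>n\<close> is the one in the column \<open>v\<^sub>d\<close>, which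
  stands right after it if present. For \<open>d = 0\<close> all entries of row \<open>n\<close> have leading coefficient
  \<open>1\<close>.
\<close>

lemma coeff_last_var_matrix:
  fixes x :: "nat \<Rightarrow> 'a::field_char_0"
  assumes ev: "even (Suc n + length I)" and I: "sorted_wrt (>) I" "\<forall>m\<in>set I. m \<le> d"
  defines "h \<equiv> (Suc n + length I) div 2"
  shows "coeff (pf h (last_var_matrix n x a I)) (d + n) = lead_P n x a d I"
proof -
  have h: "2 * h = Suc n + length I" using ev by (simp add: h_def)
  define A where "A = (A_entries x)"
  have skew: "A j i = - A i j" for i j
    unfolding A_def by (metis add.commute minus_diff_eq minus_divide_left)
  define B where "B = bordered (Suc n) A (map (\<lambda>m i. factorial_monomial a (x i) m) I)"
  define f where "f = (\<lambda>i j. if j = n then (if d = 0 then 1 else 0)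
      else if i = n then (if I ! (j - Suc n) = d then 1 else 0) else B i j)"
  have f: "coeff (pf h (last_var_matrix n x a I)) (d + n) = pf h f"
  proof (rule pf_coeff_row[where k = n])
    fix i j assume ij: "i < j" "j < 2 * h"
    show "last_var_matrix n x a I i j = [:f i j:]" if "i \<noteq> n" "j \<noteq> n"
      using that by (simp add: last_var_matrix_def f_def B_def A_def)
    show "coeff (last_var_matrix n x a I i j) (d + n) = f i j" if "i = n \<or> j = n"
    proof (cases "j = n")
      case True
      with ij have c: "card {i} + card ({..<n} - {i}) = n" by simp
      show ?thesis unfolding last_var_matrix_def f_def if_P[OF True]
        by (subst coeff_monic_prod) (use c in auto)
    next
      case False
      then have i: "i = n" using that by simp
      let ?p = "j - Suc n"
      have "?p < length I" using ij h i by auto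
      then have le: "I ! ?p \<le> d" using I(2) by simp
      then show ?thesis unfolding last_var_matrix_def f_def if_not_P[OF False] if_P[OF i]
        by (subst coeff_monic_prod) auto
    qed
  qed (use h in simp)
  show ?thesis
  proof (cases "d = 0")
    case d: False
    show ?thesis
    proof (cases "I \<noteq> [] \<and> hd I = d")
      case True
      then obtain J where J: "I = d # J" by (cases I) auto
      obtain h' where h': "h = Suc h'" using h J by (cases h) auto
      have small: "I ! p \<noteq> d" if "0 < p" "p < length I" for p
        using that I(1) J by (cases p) auto
      have "pf h f = f n (n + 1) * pf h' (\<lambda>i j. f (if i < n then i else i + 2) (if j < n then j else j + 2))"
        unfolding h'
      proof (rule pf_isolated_pair)
        show "n < 2 * h' + 1" using h h' J by simp
        show "f i n = 0" if "i < n" for i using d by (simp add: f_def)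
        show "f n j = 0" if "n + 1 < j" "j < 2 * h' + 2" for j
          using small[of "j - Suc n"] that h h' by (auto simp: f_def)
      qed
      also have "f n (n + 1) = 1" by (simp add: f_def J)
      also have "pf h' (\<lambda>i j. f (if i < n then i else i + 2) (if j < n then j else j + 2)) = P_num n x a J"
      proof -
        have e: "(n + length J) div 2 = h'" using h h' J by simp
        show ?thesis unfolding P_num_def bpf_def length_map e
          by (rule pf_cong) (use h h' J in \<open>auto simp: f_def B_def A_def bordered_def nth_Cons'\<close>)
      qed
      finally show ?thesis using f d J by (simp add: lead_P_def)
    next
      case False
      have lt: "I ! p \<noteq> d" if "p < length I" for p
      proof
        assume *: "I ! p = d"
        obtain m J where J: "I = m # J" using \<open>p < length I\<close> by (cases I) auto
        then have "m < d" using False I(2) by auto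
        moreover have "I ! p \<le> m"
        proof (cases p)
          case (Suc q)
          then have "J ! q \<in> set J" using J \<open>p < length I\<close> by simp
          then show ?thesis using I(1) J Suc by auto
        qed (simp add: J)
        ultimately show False using * by simp
      qed
      have "pf h f = 0"
      proof (rule pf_zero_row[where k = n])
        show "f i j = 0" if "i < j" "j < 2 * h" "i = n \<or> j = n" for i j
          using that d lt[of "j - Suc n"] h by (auto simp: f_def)
      qed (use h in simp)
      then show ?thesis using f False d by (auto simp: lead_P_def)
    qed
  next
    case d: True
    show ?thesis
    proof (cases I)
      case Nil
      have "pf h f = P_num n x a [0]" unfolding P_num_def bpf_def
        using h h_def Nil by (auto intro!: pf_cong simp: f_def B_def A_def bordered_def d factorial_monomial_def)
      then show ?thesis using f d Nil by (simp add: lead_P_def)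
    next
      case (Cons m J)
      then have J: "I = [0]" using I d by (cases J) auto
      obtain h' where h': "h = Suc h'" using h J by (cases h) auto
      have nh: "2 * h' = n" using h h' J by simp
      define e where "e = (\<lambda>i j. if j = n + 1 then (if i = n then 1 else 0) else f i j)"
      define g where "g = bordered n A [\<lambda>_. 1, \<lambda>_. 1]"
      \<comment> \<open>Split off the \<open>1\<close> at position \<open>(n, n + 1)\<close>: without it two columns agree, and alone in its
        column it isolates the last pair.\<close>
      have "pf h f = 1 * pf h g + 1 * pf h e"
        by (rule pf_linear[where k = "n + 1"])
          (use h J in \<open>auto simp: f_def e_def g_def B_def bordered_def d factorial_monomial_def nth_Cons'\<close>)
      also have "pf h g = 0"
        using bpf_equal_columns[of n "[\<lambda>_. 1, \<lambda>_. 1]" A 0 1, OF _ skew] nh h'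
        by (auto simp: bpf_def g_def)
      also have "pf h e = e (2 * h') (2 * h' + 1) * pf h' e" unfolding h'
        by (rule pf_last_pair) (auto simp: e_def nh)
      also have "e (2 * h') (2 * h' + 1) = 1" by (simp add: e_def nh)
      also have "pf h' e = P_num n x a []"
        unfolding P_num_def bpf_def using nh
        by (auto intro!: pf_cong simp: e_def f_def B_def A_def bordered_def)
      finally show ?thesis using f d J by (simp add: lead_P_def)
    qed
  qed
qed

text \<open>
  Induction on the number of variables. In a linear relation with nonzero coefficients let \<open>d\<close> be
  the largest index. As the relation holds for infinitely many values of the last variable, its
  leading coefficient is a relation between numerators in one variable less: the one between the
  lists starting with \<open>d\<close>, their first entry removed, if \<open>d > 0\<close>. If \<open>d = 0\<close>, parity leaves a
  single list, and the relation says that its leading coefficient vanishes.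
\<close>

lemma P_num_independent:
  fixes c :: "nat list \<Rightarrow> 'a::field_char_0"
  assumes "finite S" "\<And>I. I \<in> S \<Longrightarrow> sorted_wrt (>) I \<and> length I \<le> n \<and> even (n + length I)"
    and "\<And>x. generic n x \<Longrightarrow> (\<Sum>I\<in>S. c I * P_num n x a I) = 0"
  shows "\<forall>I\<in>S. c I = 0"
  using assms
proof (induction n arbitrary: S c)
  case 0
  have "S \<subseteq> {[]}" using 0(2) by auto
  moreover have "P_num 0 (\<lambda>_. 0) a [] = 1" by (simp add: P_num_def bpf_def)
  ultimately show ?case using 0(3)[of "\<lambda>_. 0"] by (cases "S = {}") (auto simp: generic_def subset_singleton_iff)
next
  case (Suc n)
  define T where "T = {I \<in> S. c I \<noteq> 0}"
  have fin: "finite T" using Suc.prems(1) by (simp add: T_def)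
  have TD: "sorted_wrt (>) I" "length I \<le> Suc n" "even (Suc n + length I)" "c I \<noteq> 0" if "I \<in> T" for I
    using that Suc.prems(2) by (auto simp: T_def)
  have sumT: "(\<Sum>I\<in>T. c I * P_num (Suc n) x a I) = 0" if "generic (Suc n) x" for x
    using Suc.prems(3)[OF that]
    by (subst (asm) sum.mono_neutral_right[of S T]) (use Suc.prems(1) in \<open>auto simp: T_def\<close>)
  have "T = {}"
  proof (rule ccontr)
    assume ne: "T \<noteq> {}"
    define top where "top = (\<lambda>I :: nat list. if I = [] then 0 else hd I)"
    define d where "d = Max (top ` T)"
    have d_max: "\<forall>m\<in>set I. m \<le> d" if "I \<in> T" for I
    proof
      fix m assume "m \<in> set I"
      then have "m \<le> top I" using TD(1)[OF that] by (cases I) (auto simp: top_def)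
      also have "\<dots> \<le> d" unfolding d_def using fin that by (intro Max_ge) auto
      finally show "m \<le> d" .
    qed
    have "d \<in> top ` T" unfolding d_def using fin ne by (intro Max_in) auto
    then obtain I1 where I1: "I1 \<in> T" "top I1 = d" by auto
    have lead: "(\<Sum>I\<in>T. c I * lead_P n x a d I) = 0" if x: "generic n x" for x
    proof -
      define p where "p = (\<lambda>I. pf ((Suc n + length I) div 2) (last_var_matrix n x a I))"
      define q where "q = (\<Sum>I\<in>T. Polynomial.smult (c I) (p I))"
      have root: "poly q t = 0" if t: "\<forall>j<n. t + x j \<noteq> 0" for t
      proof -
        have gen: "generic (Suc n) (x(n := t))" using x t by (auto simp: generic_def less_Suc_eq)
        have "poly q t = (\<Sum>I\<in>T. c I * ((\<Prod>j<n. t + x j) * P_num (Suc n) (x(n := t)) a I))"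
          unfolding q_def poly_sum poly_smult p_def
          by (intro sum.cong refl arg_cong2[where f = "(*)"] poly_last_var_matrix) (use TD(3) t in auto)
        also have "\<dots> = (\<Prod>j<n. t + x j) * (\<Sum>I\<in>T. c I * P_num (Suc n) (x(n := t)) a I)"
          by (simp add: sum_distrib_left mult_ac)
        finally show ?thesis using sumT[OF gen] by simp
      qed
      have "q = 0"
      proof (rule ccontr)
        assume "q \<noteq> 0"
        then have "finite {t. poly q t = 0}" by (rule poly_roots_finite)
        moreover have "- ((\<lambda>j. - x j) ` {..<n}) \<subseteq> {t. poly q t = 0}"
          using root by (auto simp: add_eq_0_iff2)
        ultimately have "finite (- ((\<lambda>j. - x j) ` {..<n}))" by (rule finite_subset[rotated])
        then have "finite (UNIV :: 'a set)" by (simp add: finite_compl)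
        then show False using infinite_UNIV_char_0 by blast
      qed
      then have "0 = coeff q (d + n)" by simp
      also have "\<dots> = (\<Sum>I\<in>T. c I * lead_P n x a d I)"
        unfolding q_def coeff_sum coeff_smult p_def
        by (intro sum.cong refl arg_cong2[where f = "(*)"] coeff_last_var_matrix) (use TD d_max in auto)
      finally show ?thesis by simp
    qed
    show False
    proof (cases "d = 0")
      case False
      define Td where "Td = {I \<in> T. I \<noteq> [] \<and> hd I = d}"
      have eq: "I = d # tl I" if "I \<in> Td" for I using that by (auto simp: Td_def)
      have inj: "inj_on tl Td" by (rule inj_onI) (metis eq)
      have "\<forall>J\<in>tl ` Td. c (d # J) = 0"
      proof (rule Suc.IH)
        show "finite (tl ` Td)" using fin by (simp add: Td_def)
        show "sorted_wrt (>) J \<and> length J \<le> n \<and> even (n + length J)" if "J \<in> tl ` Td" for J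
        proof -
          obtain I where I: "I \<in> Td" "J = tl I" using \<open>J \<in> tl ` Td\<close> by blast
          then have "I \<in> T" "I = d # J" using eq[of I] by (auto simp: Td_def)
          then show ?thesis using TD(1-3)[of I] by auto
        qed
        show "(\<Sum>J\<in>tl ` Td. c (d # J) * P_num n x a J) = 0" if x: "generic n x" for x
        proof -
          have "(\<Sum>J\<in>tl ` Td. c (d # J) * P_num n x a J) = (\<Sum>I\<in>Td. c I * P_num n x a (tl I))"
            unfolding sum.reindex[OF inj] by (rule sum.cong[OF refl]) (use eq in force)
          also have "\<dots> = (\<Sum>I\<in>T. c I * lead_P n x a d I)"
            by (rule sum.mono_neutral_cong_left) (use fin False in \<open>auto simp: Td_def lead_P_def\<close>)
          finally show ?thesis using lead[OF x] by simp
        qed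
      qed
      moreover have "I1 \<in> Td" using I1 False by (auto simp: Td_def top_def split: if_splits)
      ultimately have "c I1 = 0" using eq[of I1] by force
      then show False using TD(4) I1 by blast
    next
      case True
      have "I = [] \<or> I = [0]" if "I \<in> T" for I
        using d_max[OF that] TD(1)[OF that] True by (cases I; cases "tl I") auto
      then have I1_cases: "I1 = [] \<or> I1 = [0]" and T: "T = {I1}"
        using I1(1) TD(3) by (auto, (metis TD(3) even_Suc list.size(3,4) add_0_right One_nat_def add_Suc_right)+)
      define J where "J = (if I1 = [] then [0] else [] :: nat list)"
      have "\<forall>I\<in>{J}. c I1 = 0"
      proof (rule Suc.IH)
        show "sorted_wrt (>) I \<and> length I \<le> n \<and> even (n + length I)" if "I \<in> {J}" for I
          using that TD(3)[OF I1(1)] I1_cases by (auto simp: J_def Suc_le_eq odd_pos)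
        show "(\<Sum>I\<in>{J}. c I1 * P_num n x a I) = 0" if "generic n x" for x
          using lead[OF that] True unfolding T lead_P_def J_def by simp
      qed simp
      then show False using TD(4) I1 by blast
    qed
  qed
  then show ?case by (auto simp: T_def)
qed

section \<open>Linear independence of factorial P-functions\<close>

definition eval_mono :: "(nat \<Rightarrow> 'b) \<Rightarrow> (nat \<Rightarrow>\<^sub>0 nat) \<Rightarrow> 'b::comm_semiring_1" where
  "eval_mono x e = (\<Prod>i\<in>Poly_Mapping.keys e. x i ^ Poly_Mapping.lookup e i)"

text \<open>
  Evaluation of a polynomial after applying \<open>\<phi>\<close> to its coefficients. The identity is used to
  evaluate at points of a field, the embedding of the natural numbers for polynomials with
  nonnegative integer coefficients.
\<close>

definition eval_via :: "('c \<Rightarrow> 'b) \<Rightarrow> (nat \<Rightarrow> 'b) \<Rightarrow> ((nat \<Rightarrow>\<^sub>0 nat) \<Rightarrow>\<^sub>0 'c::comm_semiring_1) \<Rightarrow> 'b::comm_semiring_1" where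
  "eval_via \<phi> x p = (\<Sum>e\<in>Poly_Mapping.keys p. \<phi> (Poly_Mapping.lookup p e) * eval_mono x e)"

lemma eval_mono_add: "eval_mono x (e + f) = eval_mono x e * eval_mono x f"
proof -
  have *: "eval_mono x g = (\<Prod>i\<in>Poly_Mapping.keys e \<union> Poly_Mapping.keys f. x i ^ Poly_Mapping.lookup g i)"
    if "Poly_Mapping.keys g \<subseteq> Poly_Mapping.keys e \<union> Poly_Mapping.keys f" for g
    unfolding eval_mono_def by (rule prod.mono_neutral_left) (use that in \<open>auto simp: in_keys_iff\<close>)
  show ?thesis
    by (subst (1 2 3) *) (auto simp: keys_add lookup_add power_add prod.distrib)
qed

lemma poly_mapping_induct [case_names single add]:
  fixes p :: "'k \<Rightarrow>\<^sub>0 'c::comm_monoid_add"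
  assumes single: "\<And>k v. P (Poly_Mapping.single k v)" and add: "\<And>p q. P p \<Longrightarrow> P q \<Longrightarrow> P (p + q)"
  shows "P p"
proof (induction p rule: update_induct)
  case const
  show ?case using single[of undefined 0] by simp
next
  case (update p k v)
  have "Poly_Mapping.update k v p = p + Poly_Mapping.single k v"
    using update by (intro poly_mapping_eqI) (auto simp: lookup_update lookup_add lookup_single when_def in_keys_iff)
  then show ?case using add[OF update(3) single] by simp
qed

context
  fixes \<phi> :: "'c::comm_semiring_1 \<Rightarrow> 'b::comm_semiring_1" and x :: "nat \<Rightarrow> 'b"
  assumes \<phi>: "\<phi> 0 = 0" "\<phi> 1 = 1" "\<And>a b. \<phi> (a + b) = \<phi> a + \<phi> b" "\<And>a b. \<phi> (a * b) = \<phi> a * \<phi> b"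
begin

lemma eval_via_single: "eval_via \<phi> x (Poly_Mapping.single e c) = \<phi> c * eval_mono x e"
  by (simp add: eval_via_def \<phi>)

lemma eval_via_add: "eval_via \<phi> x (p + q) = eval_via \<phi> x p + eval_via \<phi> x q"
  unfolding eval_via_def
  by (rule setsum_keys_plus_distrib) (simp_all add: \<phi> distrib_right)

lemma eval_via_mult: "eval_via \<phi> x (p * q) = eval_via \<phi> x p * eval_via \<phi> x q"
proof (induction p rule: poly_mapping_induct)
  case (single e c)
  show ?case
  proof (induction q rule: poly_mapping_induct)
    case (single f d)
    show ?case by (simp add: mult_single eval_via_single eval_mono_add \<phi> mult_ac)
  next
    case (add p q)
    then show ?case by (simp add: distrib_left eval_via_add)
  qed
next
  case (add p q)
  then show ?case by (simp add: distrib_right eval_via_add)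
qed

lemma eval_via_const: "eval_via \<phi> x (Poly_Mapping.single 0 c) = \<phi> c"
  by (simp add: eval_via_single eval_mono_def)

lemma eval_via_var: "eval_via \<phi> x (Poly_Mapping.single (Poly_Mapping.single i 1) 1) = x i"
  by (simp add: eval_via_single eval_mono_def \<phi>)

end

text \<open>
  A rational function \<open>q\<close> has the value \<open>y\<close> at \<open>x\<close> if some representation as a fraction with
  denominator nonzero at \<open>x\<close> says so. A relation avoids the choice of a representation.
\<close>

definition evaluates_to :: "(nat \<Rightarrow> 'a::field_char_0) \<Rightarrow> 'a ratfun \<Rightarrow> 'a \<Rightarrow> bool" where
  "evaluates_to x q y \<longleftrightarrow> (\<exists>N D. q * to_fract D = to_fract N \<and> eval_via id x D \<noteq> 0 \<and>
     y * eval_via id x D = eval_via id x N)"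

lemma evaluates_const: "evaluates_to x (ratfun_const c) c"
  unfolding evaluates_to_def ratfun_const_def
  by (rule exI[of _ "Poly_Mapping.single 0 c"], rule exI[of _ 1])
    (use eval_via_const[of id x 1] eval_via_const[of id x c] in simp)

lemma evaluates_var: "evaluates_to x (ratfun_var i) (x i)"
  unfolding evaluates_to_def ratfun_var_def
  by (rule exI[of _ "Poly_Mapping.single (Poly_Mapping.single i 1) 1"], rule exI[of _ 1])
    (use eval_via_const[of id x 1] eval_via_var[of id x i] in simp)

lemma evaluates_add_mult:
  assumes "evaluates_to x q y" "evaluates_to x q' y'"
  shows "evaluates_to x (q + q') (y + y')" "evaluates_to x (q * q') (y * y')"
proof -
  obtain N D N' D' where *: "q * to_fract D = to_fract N" "eval_via id x D \<noteq> 0"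
    "y * eval_via id x D = eval_via id x N" "q' * to_fract D' = to_fract N'" "eval_via id x D' \<noteq> 0"
    "y' * eval_via id x D' = eval_via id x N'"
    using assms unfolding evaluates_to_def by blast
  have D: "eval_via id x (D * D') \<noteq> 0" using *(2,5) by (simp add: eval_via_mult)
  have "(q + q') * to_fract (D * D') = to_fract (N * D' + N' * D)"
    "(q * q') * to_fract (D * D') = to_fract (N * N')"
    using *(1,4)[symmetric] by (simp_all add: algebra_simps)
  moreover have "(y + y') * eval_via id x (D * D') = eval_via id x (N * D' + N' * D)"
    "(y * y') * eval_via id x (D * D') = eval_via id x (N * N')"
    using *(3,6)[symmetric] by (simp_all add: eval_via_add eval_via_mult algebra_simps)
  ultimately show "evaluates_to x (q + q') (y + y')" "evaluates_to x (q * q') (y * y')"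
    unfolding evaluates_to_def using D by blast+
qed

lemmas evaluates_add = evaluates_add_mult(1) and evaluates_mult = evaluates_add_mult(2)

lemma evaluates_inverse:
  assumes "evaluates_to x q y" "y \<noteq> 0"
  shows "evaluates_to x (inverse q) (inverse y)"
proof -
  obtain N D where *: "q * to_fract D = to_fract N" "eval_via id x D \<noteq> 0"
    "y * eval_via id x D = eval_via id x N"
    using assms unfolding evaluates_to_def by blast
  have N: "eval_via id x N \<noteq> 0" using *(2,3) assms(2) by (metis mult_eq_0_iff)
  then have "N \<noteq> 0" by (auto simp: eval_via_def)
  then have "q \<noteq> 0" using *(1) by auto
  then have "inverse q * to_fract N = to_fract D" using *(1)[symmetric] by (simp add: field_simps)
  moreover have "inverse y * eval_via id x N = eval_via id x D" using assms(2) *(3)[symmetric] by simp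
  ultimately show ?thesis using N unfolding evaluates_to_def by blast
qed

lemma evaluates_0: "evaluates_to x 0 0" and evaluates_1: "evaluates_to x 1 1"
  using evaluates_const[of x 0] evaluates_const[of x 1] by (simp_all add: ratfun_const_def)

lemma evaluates_uminus: "evaluates_to x q y \<Longrightarrow> evaluates_to x (- q) (- y)"
  using evaluates_mult[OF evaluates_const[of x "- 1"], of q y]
  by (simp add: ratfun_const_def single_uminus)

lemma evaluates_diff:
  "evaluates_to x q y \<Longrightarrow> evaluates_to x q' y' \<Longrightarrow> evaluates_to x (q - q') (y - y')"
  using evaluates_add[OF _ evaluates_uminus, of x q y q' y'] by simp

lemma evaluates_divide:
  "evaluates_to x q y \<Longrightarrow> evaluates_to x q' y' \<Longrightarrow> y' \<noteq> 0 \<Longrightarrow> evaluates_to x (q / q') (y / y')"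
  unfolding divide_inverse by (intro evaluates_mult evaluates_inverse)

lemma evaluates_sum:
  "(\<And>i. i \<in> S \<Longrightarrow> evaluates_to x (f i) (g i)) \<Longrightarrow> evaluates_to x (sum f S) (sum g S)"
  by (induction S rule: infinite_finite_induct) (auto intro: evaluates_0 evaluates_add)

lemma evaluates_prod:
  "(\<And>i. i \<in> S \<Longrightarrow> evaluates_to x (f i) (g i)) \<Longrightarrow> evaluates_to x (prod f S) (prod g S)"
  by (induction S rule: infinite_finite_induct) (auto intro: evaluates_1 evaluates_mult)

text \<open>
  The step from relations between rational functions to relations between values.
\<close>

lemma evaluates_unique_0: "evaluates_to x 0 y \<Longrightarrow> y = 0"
  unfolding evaluates_to_def by (auto simp: eval_via_def)

lemma evaluates_pf:
  assumes "\<And>i j. i < j \<Longrightarrow> j < 2 * h \<Longrightarrow> evaluates_to x (f i j) (g i j)"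
  shows "evaluates_to x (pf h f) (pf h g)"
  unfolding pf_def
proof (intro evaluates_sum evaluates_mult evaluates_prod)
  fix s assume s: "s \<in> matchings h"
  show "evaluates_to x (of_int (sign s)) (of_int (sign s))"
    by (cases s rule: sign_cases) (auto intro: evaluates_1 evaluates_uminus)
  show "evaluates_to x (f (s (2 * i)) (s (2 * i + 1))) (g (s (2 * i)) (s (2 * i + 1)))" if "i \<in> {..<h}" for i
    using assms matchingsD[OF s] that by simp
qed

lemma evaluates_P_num:
  assumes "generic n x"
  shows "evaluates_to x (P_num n ratfun_var (\<lambda>j. ratfun_const (a j)) I) (P_num n x a I)"
  unfolding P_num_def bpf_def length_map
proof (rule evaluates_pf)
  fix i j :: nat assume "i < j"
  then have "i < n \<and> j < n \<longrightarrow> x j + x i \<noteq> 0" using assms by (auto simp: generic_def)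
  then show "evaluates_to x
      (bordered n (\<lambda>i j. (ratfun_var j - ratfun_var i) / (ratfun_var j + ratfun_var i))
        (map (\<lambda>m i. factorial_monomial (\<lambda>j. ratfun_const (a j)) (ratfun_var i) m) I) i j)
      (bordered n (A_entries x) (map (\<lambda>m i. factorial_monomial a (x i) m) I) i j)"
    by (auto simp: bordered_def factorial_monomial_def intro!: evaluates_divide evaluates_diff
        evaluates_add evaluates_var evaluates_const evaluates_prod evaluates_0 evaluates_uminus)
qed

lemma ratfun_var_combination:
  assumes "i \<noteq> j" "c = 1 \<or> c = - 1"
  shows "ratfun_var j + ratfun_const c * (ratfun_var i :: 'a::field_char_0 ratfun) \<noteq> 0"
proof -
  have "evaluates_to (\<lambda>k. if k = j then 1 else 0) (ratfun_var j + ratfun_const c * (ratfun_var i :: 'a ratfun))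
     ((if j = j then 1 else 0) + c * (if i = j then 1 else 0))"
    by (intro evaluates_add evaluates_mult evaluates_const evaluates_var[of "\<lambda>k. if k = j then 1 else 0"])
  then show ?thesis using evaluates_unique_0 assms by fastforce
qed

lemma ratfun_var_add_neq_0: "i \<noteq> j \<Longrightarrow> ratfun_var j + (ratfun_var i :: 'a::field_char_0 ratfun) \<noteq> 0"
  using ratfun_var_combination[of i j 1] by (simp add: ratfun_const_def)

lemma ratfun_var_diff_neq_0: "i \<noteq> j \<Longrightarrow> ratfun_var j - (ratfun_var i :: 'a::field_char_0 ratfun) \<noteq> 0"
  using ratfun_var_combination[of i j "-1"] by (simp add: ratfun_const_def single_uminus)

lemma Delta_generic_neq_0: "Delta n (ratfun_var :: nat \<Rightarrow> 'a::field_char_0 ratfun) \<noteq> 0"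
proof -
  have "finite {(i, j). i < j \<and> j < n}" by (rule finite_subset[of _ "{..<n} \<times> {..<n}"]) auto
  moreover have "(ratfun_var j - ratfun_var i) / (ratfun_var j + (ratfun_var i :: 'a ratfun)) \<noteq> 0" if "i < j" for i j
    using ratfun_var_add_neq_0[of i j, where 'a = 'a] ratfun_var_diff_neq_0[of i j, where 'a = 'a] that by auto
  ultimately show ?thesis unfolding Delta_def by (subst prod_zero_iff) auto
qed

lemma star_inverse: "strict_partition lam \<Longrightarrow> filter (\<lambda>m. m \<noteq> 0) (star n lam) = lam"
  by (auto simp: star_def strict_partition_def intro!: filter_True)

text \<open>
  A linear relation may be evaluated at every generic point, and there \<open>P_num_independent\<close>
  applies. The list \<open>\<lambda>\<^sup>*\<close> determines \<open>\<lambda>\<close>: remove the zeros.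
\<close>

lemma P_generic_independent:
  fixes c :: "nat list \<Rightarrow> 'a::field_char_0"
  assumes fin: "finite S" and S: "\<And>lam. lam \<in> S \<Longrightarrow> strict_partition lam \<and> length lam \<le> n"
    and zero: "(\<Sum>lam\<in>S. ratfun_const (c lam) * P_generic n a lam) = 0"
  shows "\<forall>lam\<in>S. c lam = 0"
proof -
  let ?P = "\<lambda>lam. P_num n ratfun_var (\<lambda>j. ratfun_const (a j)) (star n lam)"
  let ?f = "filter (\<lambda>m. m \<noteq> (0::nat))"
  have inj: "inj_on (star n) S" by (rule inj_onI) (metis S star_inverse)
  have "1 / Delta n ratfun_var * (\<Sum>lam\<in>S. ratfun_const (c lam) * ?P lam) = 0"
    using zero by (simp add: P_generic_def factorial_P_eq sum_distrib_left mult_ac)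
  then have num: "(\<Sum>lam\<in>S. ratfun_const (c lam) * ?P lam) = 0"
    using Delta_generic_neq_0[of n, where 'a = 'a] by simp
  have "\<forall>I\<in>star n ` S. c (?f I) = 0"
  proof (rule P_num_independent)
    show "sorted_wrt (>) I \<and> length I \<le> n \<and> even (n + length I)" if I: "I \<in> star n ` S" for I
    proof -
      obtain lam where lam: "lam \<in> S" "I = star n lam" using I by blast
      have "length lam \<noteq> n" if "odd (n + length lam)" using that by auto
      then show ?thesis using S[OF lam(1)] even_star[of n lam] lam(2)
        by (auto simp: star_def strict_partition_def sorted_wrt_append)
    qed
    show "(\<Sum>I\<in>star n ` S. c (?f I) * P_num n x a I) = 0" if "generic n x" for x
    proof -
      have "evaluates_to x (\<Sum>lam\<in>S. ratfun_const (c lam) * ?P lam)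
          (\<Sum>lam\<in>S. c lam * P_num n x a (star n lam))"
        by (intro evaluates_sum evaluates_mult evaluates_const evaluates_P_num that)
      then have "(\<Sum>lam\<in>S. c lam * P_num n x a (star n lam)) = 0"
        unfolding num by (rule evaluates_unique_0)
      moreover have "(\<Sum>I\<in>star n ` S. c (?f I) * P_num n x a I) = (\<Sum>lam\<in>S. c lam * P_num n x a (star n lam))"
        unfolding sum.reindex[OF inj] by (rule sum.cong[OF refl]) (use S star_inverse in auto)
      ultimately show ?thesis by simp
    qed
  qed (use fin in simp)
  then show ?thesis using S star_inverse by force
qed

section \<open>Pieri coefficients\<close>

lemma lin_times_nth:
  "fps_nth (lin c * F) n = fps_nth F n - (if n = 0 then 0 else c * fps_nth F (n - 1))"
  by (simp add: left_diff_distrib mult.assoc)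

lemma geo_nth: "fps_nth (geo c) n = c ^ n"
proof -
  have "lin c * Abs_fps (\<lambda>n. c ^ n) = 1"
  proof (rule fps_ext)
    show "fps_nth (lin c * Abs_fps (\<lambda>n. c ^ n)) n = fps_nth 1 n" for n
      unfolding lin_times_nth by (cases n) simp_all
  qed
  then have "geo c * (lin c * Abs_fps (\<lambda>n. c ^ n)) = geo c" by simp
  then have "geo c = Abs_fps (\<lambda>n. c ^ n)" by (simp add: mult.assoc[symmetric])
  then show ?thesis by simp
qed

lemma ratfun_const_hom:
  "ratfun_const 0 = 0" "ratfun_const 1 = 1" "ratfun_const (c + d) = ratfun_const c + ratfun_const d"
  "ratfun_const (c * d) = ratfun_const c * ratfun_const d"
  by (simp_all add: ratfun_const_def single_add mult_single flip: to_fract_mult)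

lemma ratfun_const_sum: "ratfun_const (sum f S) = (\<Sum>i\<in>S. ratfun_const (f i))"
  by (induction S rule: infinite_finite_induct) (simp_all add: ratfun_const_hom)

lemma ratfun_const_power: "ratfun_const (c ^ k) = ratfun_const c ^ k"
  by (induction k) (simp_all add: ratfun_const_hom)

lemma ratfun_const_uminus: "ratfun_const (- c) = - ratfun_const c"
  using ratfun_const_hom(3)[of c "- c"] by (simp add: ratfun_const_hom eq_neg_iff_add_eq_0 add.commute)

text \<open>
  The expansion takes place over the field of rational functions, but its coefficients come from
  the field of the parameters.
\<close>

definition lift_fps :: "'a::field_char_0 fps \<Rightarrow> 'a ratfun fps" where
  "lift_fps F = Abs_fps (\<lambda>n. ratfun_const (fps_nth F n))"

lemma lift_fps_hom:
  "lift_fps (F + G) = lift_fps F + lift_fps G" "lift_fps (F * G) = lift_fps F * lift_fps G"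
  "lift_fps 1 = 1" "lift_fps 0 = 0"
  by (rule fps_ext; simp add: lift_fps_def ratfun_const_hom fps_mult_nth ratfun_const_sum)+

lemma lift_fps_atoms:
  "lift_fps fps_X = fps_X" "lift_fps (fps_const c) = fps_const (ratfun_const c)" "lift_fps (geo c) = geo (ratfun_const
    c)"
  by (rule fps_ext; simp add: lift_fps_def ratfun_const_hom geo_nth ratfun_const_power)+

lemma lift_fps_power: "lift_fps (F ^ k) = lift_fps F ^ k"
  by (induction k) (simp_all add: lift_fps_hom)

lemma lift_fps_prod: "lift_fps (prod f S) = (\<Prod>i\<in>S. lift_fps (f i))"
  by (induction S rule: infinite_finite_induct) (simp_all add: lift_fps_hom)

lemma lift_fps_row_coeff:
  "lift_fps (row_coeff a hit m k) = row_coeff (\<lambda>j. ratfun_const (a j)) hit m k"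
proof -
  have 2: "lift_fps 2 = 2" unfolding one_add_one[symmetric] lift_fps_hom ..
  show ?thesis
    by (simp add: row_coeff_def hit_coeff_def cayley_def lift_fps_hom lift_fps_atoms lift_fps_power lift_fps_prod 2)
qed

lemma pieri_series_ratfun:
  "fps_nth (pieri_series n (\<lambda>j. ratfun_const (a j)) mu lam) r = ratfun_const (fps_nth (pieri_series n a mu lam) r)"
proof -
  have row: "lift_fps (pieri_row n a mu lam k) = pieri_row n (\<lambda>j. ratfun_const (a j)) mu lam k" for k
    unfolding pieri_row_def by (simp only: lift_fps_row_coeff lift_fps_hom if_distrib[of lift_fps])
  have "pieri_series n (\<lambda>j. ratfun_const (a j)) mu lam = lift_fps (pieri_series n a mu lam)"
    by (simp add: pieri_series_def lift_fps_hom lift_fps_prod row)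
  then show ?thesis by (simp add: lift_fps_def)
qed

text \<open>
  Row 1 contributes the factor \<open>z\<close> to the power \<open>\<lambda>\<^sub>1 - \<mu>\<^sub>1\<close>.
\<close>

lemma pieri_series_nth_zero:
  assumes "part mu 1 + r < part lam 1"
  shows "fps_nth (pieri_series n a mu lam) r = 0"
proof -
  have "fps_X ^ (part lam 1 - part mu 1) dvd pieri_row n a mu lam 1"
    using assms row_coeff_dvd[of "part mu 1" "part lam 1" a] by (auto simp: pieri_row_def)
  also have "pieri_row n a mu lam 1 dvd (\<Prod>k=1..length mu + 1. pieri_row n a mu lam k)"
    by (rule dvd_prodI) auto
  finally have "fps_X ^ (part lam 1 - part mu 1) dvd pieri_series n a mu lam"
    by (simp only: pieri_series_def split: if_split) simp
  then obtain G where "pieri_series n a mu lam = fps_X ^ (part lam 1 - part mu 1) * G" by (elim dvdE)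
  then show ?thesis using assms by (simp add: fps_X_power_mult_nth)
qed

lemma part_1_ge: "strict_partition lam \<Longrightarrow> k \<in> set lam \<Longrightarrow> k \<le> part lam 1"
  by (cases lam) (auto simp: strict_partition_def part_def)

text \<open>
  The expansion of \<open>pieri_identity\<close>, divided by \<open>\<Delta>\<close>, has the defining properties of the Pieri
  coefficients, and linear independence makes it the only one. Partitions of length greater than
  \<open>n\<close> may be dropped, since their numerators have too many columns.
\<close>

lemma pieri_coeff_eq:
  fixes a :: "nat \<Rightarrow> 'a::field_char_0"
  assumes mu: "strict_partition mu" "length mu \<le> n"
  shows "pieri_coeff n a mu r lam =
    (if strict_partition lam \<and> length lam \<le> n then fps_nth (pieri_series n a mu lam) r else 0)"
proof -
  let ?al = "\<lambda>j. ratfun_const (a j)"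
  define c where "c = (\<lambda>lam. if strict_partition lam \<and> length lam \<le> n then fps_nth (pieri_series n a mu lam) r else 0)"
  \<comment> \<open>By \<open>pieri_series_nth_zero\<close>, only \<open>\<lambda>\<close> with \<open>\<lambda>\<^sub>1 < N\<close> have a nonzero coefficient at \<open>z\<^sup>r\<close>.\<close>
  define N where "N = part mu 1 + r + 1"
  have N: "\<forall>m\<in>set mu. m + r < N" "r < N" using part_1_ge[OF mu(1)] by (auto simp: N_def le_imp_less_Suc)
  have N': "\<forall>m\<in>set mu. m < N" "0 < N" using N by auto
  have fin: "finite (pieri_support mu N)" by (rule finite_pieri_support[OF mu(1) N'])
  have supp: "{lam. c lam \<noteq> 0} \<subseteq> pieri_support mu N"
  proof
    fix lam assume "lam \<in> {lam. c lam \<noteq> 0}"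
    then have l: "strict_partition lam" "fps_nth (pieri_series n a mu lam) r \<noteq> 0"
      by (auto simp: c_def split: if_splits)
    have "interlaces mu lam" using l(2) by (auto simp: pieri_series_def split: if_splits)
    moreover have "part lam 1 < N" using pieri_series_nth_zero[of mu r lam n a] l(2) unfolding N_def by linarith
    ultimately show "lam \<in> pieri_support mu N"
      using l(1) part_1_ge[OF l(1)] by (auto simp: pieri_support_def intro: le_less_trans)
  qed
  have gen: "ratfun_var j + (ratfun_var i :: 'a ratfun) \<noteq> 0" if "i < j" for i j
    using ratfun_var_add_neq_0[of i j, where 'a = 'a] that by simp
  have q: "q_generic n r = fps_nth (\<Prod>i<n. cayley (ratfun_var i :: 'a ratfun)) r"
    by (simp add: q_generic_def schur_q_def cayley_def div_lin)
  have term_eq: "ratfun_const (c lam) * P_generic n a lam = 1 / Delta n ratfun_var *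
      (fps_nth (pieri_series n ?al mu lam) r * P_num n ratfun_var ?al (star n lam))"
    if lam: "lam \<in> pieri_support mu N" for lam
  proof (cases "length lam \<le> n")
    case True
    then show ?thesis using lam
      by (simp add: c_def P_generic_def factorial_P_eq pieri_series_ratfun pieri_support_def)
  next
    case False
    then have "P_num n ratfun_var ?al (star n lam) = 0"
      unfolding P_num_def using even_star[of n lam]
      by (intro bpf_too_many_columns) (auto simp: star_def)
    then show ?thesis using False by (simp add: c_def ratfun_const_hom)
  qed
  have "P_generic n a mu * q_generic n r = 1 / Delta n ratfun_var *
      (fps_nth (\<Prod>i<n. cayley (ratfun_var i)) r * P_num n ratfun_var ?al (star n mu))"
    by (simp add: P_generic_def factorial_P_eq q mult_ac)
  also have "\<dots> = 1 / Delta n ratfun_var *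
      (\<Sum>lam\<in>pieri_support mu N. fps_nth (pieri_series n ?al mu lam) r * P_num n ratfun_var ?al (star n lam))"
    by (subst pieri_identity[OF gen mu(1) N]) auto
  also have "\<dots> = (\<Sum>lam\<in>pieri_support mu N. ratfun_const (c lam) * P_generic n a lam)"
    unfolding sum_distrib_left by (rule sum.cong[OF refl]) (simp add: term_eq)
  also have "\<dots> = (\<Sum>lam | c lam \<noteq> 0. ratfun_const (c lam) * P_generic n a lam)"
    by (rule sum.mono_neutral_right) (use fin supp in \<open>auto simp: ratfun_const_hom\<close>)
  finally have expansion: "P_generic n a mu * q_generic n r = (\<Sum>lam | c lam \<noteq> 0. ratfun_const (c lam) * P_generic n a
    lam)" .
  have c2: "strict_partition lam \<and> length lam \<le> n" if "c lam \<noteq> 0" for lam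
    using that unfolding c_def by presburger
  have fin_c: "finite {lam. c lam \<noteq> 0}" by (rule finite_subset[OF supp fin])
  have "pieri_coeff n a mu r = c" unfolding pieri_coeff_def
  proof (rule the_equality, intro conjI)
    show "\<forall>lam. c lam \<noteq> 0 \<longrightarrow> strict_partition lam \<and> length lam \<le> n" using c2 by blast
  next
    fix d :: "nat list \<Rightarrow> 'a"
    assume d: "finite {lam. d lam \<noteq> 0} \<and> (\<forall>lam. d lam \<noteq> 0 \<longrightarrow> strict_partition lam \<and> length lam \<le> n) \<and>
      P_generic n a mu * q_generic n r = (\<Sum>lam | d lam \<noteq> 0. ratfun_const (d lam) * P_generic n a lam)"
    then have d1: "finite {lam. d lam \<noteq> 0}" and d2: "\<And>lam. d lam \<noteq> 0 \<Longrightarrow> strict_partition lam \<and> length lam \<le> n"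
      and d3: "P_generic n a mu * q_generic n r = (\<Sum>lam | d lam \<noteq> 0. ratfun_const (d lam) * P_generic n a lam)"
      by blast+
    define S where "S = {lam. c lam \<noteq> 0} \<union> {lam. d lam \<noteq> 0}"
    have fS: "finite S" using d1 fin_c by (simp add: S_def)
    have e: "(\<Sum>lam\<in>S. ratfun_const (g lam) * P_generic n a lam) = P_generic n a mu * q_generic n r"
      if "g = c \<or> g = d" for g
    proof -
      have eq: "(\<Sum>lam\<in>S. ratfun_const (g lam) * P_generic n a lam) = (\<Sum>lam | g lam \<noteq> 0. ratfun_const (g lam) * P_generic
        n a lam)"
      proof (rule sum.mono_neutral_right[OF fS])
        show "{lam. g lam \<noteq> 0} \<subseteq> S" using that by (auto simp: S_def)
      qed (simp add: ratfun_const_hom)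
      from that show ?thesis
      proof
        assume g: "g = c"
        show ?thesis unfolding eq unfolding g by (rule expansion[symmetric])
      next
        assume g: "g = d"
        show ?thesis unfolding eq unfolding g by (rule d3[symmetric])
      qed
    qed
    have diff: "\<forall>lam\<in>S. d lam + - c lam = 0"
    proof (rule P_generic_independent[OF fS])
      show "strict_partition lam \<and> length lam \<le> n" if "lam \<in> S" for lam
        using that d2 c2 unfolding S_def by blast
      show "(\<Sum>lam\<in>S. ratfun_const (d lam + - c lam) * P_generic n a lam) = 0"
      proof -
        have "(\<Sum>lam\<in>S. ratfun_const (d lam + - c lam) * P_generic n a lam) =
            (\<Sum>lam\<in>S. ratfun_const (d lam) * P_generic n a lam) - (\<Sum>lam\<in>S. ratfun_const (c lam) * P_generic n a lam)"
          unfolding ratfun_const_hom(3) ratfun_const_uminus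
          by (simp add: left_diff_distrib sum_subtractf)
        then show ?thesis using e[of d] e[of c] by (simp only: simp_thms diff_self)
      qed
    qed
    show "d = c"
    proof
      fix lam
      show "d lam = c lam"
      proof (cases "lam \<in> S")
        case True
        then have "d lam + - c lam = 0" using diff by blast
        then show ?thesis by simp
      qed (simp add: S_def)
    qed
  qed (use fin_c expansion in auto)
  then show ?thesis by (simp add: c_def)
qed

lemma pieri_gf_eq:
  assumes "strict_partition mu" "length mu \<le> n" "strict_partition lam" "length lam \<le> n"
  shows "pieri_gf n a mu lam = pieri_series n a mu lam"
  by (rule fps_ext) (simp add: pieri_gf_def pieri_coeff_eq assms)

section \<open>Polynomials with nonnegative integer coefficients\<close>

definition nat_polynomial :: "((nat \<Rightarrow> 'a) \<Rightarrow> 'a::comm_semiring_1) \<Rightarrow> bool" where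
  "nat_polynomial f \<longleftrightarrow> (\<exists>p. \<forall>b. f b = eval_nat_poly p b)"

lemma eval_nat_poly_via: "eval_nat_poly p b = eval_via of_nat b p"
  by (simp add: eval_nat_poly_def eval_via_def eval_mono_def)

lemma nat_polynomial_add:
  "nat_polynomial f \<Longrightarrow> nat_polynomial g \<Longrightarrow> nat_polynomial (\<lambda>b. f b + g b)"
  unfolding nat_polynomial_def eval_nat_poly_via
  by (elim exE, rule_tac x = "p + pa" in exI) (simp add: eval_via_add)

lemma nat_polynomial_mult:
  "nat_polynomial f \<Longrightarrow> nat_polynomial g \<Longrightarrow> nat_polynomial (\<lambda>b. f b * g b)"
  unfolding nat_polynomial_def eval_nat_poly_via
  by (elim exE, rule_tac x = "p * pa" in exI) (simp add: eval_via_mult)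

lemma nat_polynomial_const: "nat_polynomial (\<lambda>b. of_nat k)"
  unfolding nat_polynomial_def eval_nat_poly_via
  by (rule exI[of _ "Poly_Mapping.single 0 k"]) (simp add: eval_via_const del: single_of_nat)

lemma nat_polynomial_0: "nat_polynomial (\<lambda>b. 0)" and nat_polynomial_1: "nat_polynomial (\<lambda>b. 1)"
  using nat_polynomial_const[of 0] nat_polynomial_const[of 1] by simp_all

lemma nat_polynomial_var: "nat_polynomial (\<lambda>b. b i)"
  unfolding nat_polynomial_def eval_nat_poly_via
  by (rule exI[of _ "Poly_Mapping.single (Poly_Mapping.single i 1) 1"]) (subst eval_via_var, simp_all)

lemma nat_polynomial_power: "nat_polynomial f \<Longrightarrow> nat_polynomial (\<lambda>b. f b ^ k)"
  by (induction k) (auto intro: nat_polynomial_1 nat_polynomial_mult)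

lemma nat_polynomial_sum:
  "(\<And>i. i \<in> S \<Longrightarrow> nat_polynomial (f i)) \<Longrightarrow> nat_polynomial (\<lambda>b. \<Sum>i\<in>S. f i b)"
  by (induction S rule: infinite_finite_induct) (auto intro: nat_polynomial_0 nat_polynomial_add)

definition nat_poly_series :: "((nat \<Rightarrow> 'a) \<Rightarrow> 'a::comm_semiring_1 fps) \<Rightarrow> bool" where
  "nat_poly_series F \<longleftrightarrow> (\<forall>r. nat_polynomial (\<lambda>b. fps_nth (F b) r))"

lemma nat_poly_series_add:
  "nat_poly_series F \<Longrightarrow> nat_poly_series G \<Longrightarrow> nat_poly_series (\<lambda>b. F b + G b)"
  by (simp add: nat_poly_series_def nat_polynomial_add)

lemma nat_poly_series_mult:
  "nat_poly_series F \<Longrightarrow> nat_poly_series G \<Longrightarrow> nat_poly_series (\<lambda>b. F b * G b)"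
  by (auto simp: nat_poly_series_def fps_mult_nth intro!: nat_polynomial_sum nat_polynomial_mult)

lemma nat_poly_series_1: "nat_poly_series (\<lambda>b. 1)" and nat_poly_series_0: "nat_poly_series (\<lambda>b. 0)"
  and nat_poly_series_X: "nat_poly_series (\<lambda>b. fps_X)"
  by (auto simp: nat_poly_series_def fps_X_nth nat_polynomial_0 nat_polynomial_1)

lemma nat_poly_series_const: "nat_poly_series (\<lambda>b. fps_const (b i))"
  unfolding nat_poly_series_def
proof
  show "nat_polynomial (\<lambda>b. fps_nth (fps_const (b i)) r)" for r
    by (cases "r = 0") (simp_all add: nat_polynomial_0 nat_polynomial_var)
qed

lemma nat_poly_series_geo: "nat_poly_series (\<lambda>b. geo (b i))"
  by (auto simp: nat_poly_series_def geo_nth nat_polynomial_power nat_polynomial_var)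

lemma nat_poly_series_power: "nat_poly_series F \<Longrightarrow> nat_poly_series (\<lambda>b. F b ^ k)"
  by (induction k) (auto intro: nat_poly_series_1 nat_poly_series_mult)

lemma nat_poly_series_prod:
  "(\<And>i. i \<in> S \<Longrightarrow> nat_poly_series (f i)) \<Longrightarrow> nat_poly_series (\<lambda>b. \<Prod>i\<in>S. f i b)"
  by (induction S rule: infinite_finite_induct) (auto intro: nat_poly_series_1 nat_poly_series_mult)

text \<open>
  All factors are built from \<open>1 / (1 - a z) = \<Sum> a\<^sup>r z\<^sup>r\<close> by sums and products.
\<close>

lemma nat_poly_series_row_coeff: "nat_poly_series (\<lambda>b. row_coeff b hit m k)"
proof -
  have "nat_poly_series (\<lambda>b. (1 + fps_const (b i) * fps_X) * geo (b i))" for i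
    by (intro nat_poly_series_mult nat_poly_series_add nat_poly_series_1 nat_poly_series_X
        nat_poly_series_const nat_poly_series_geo)
  moreover have "nat_poly_series (\<lambda>b. fps_X ^ e * (\<Prod>j\<in>S. geo (b j)))" for e S
    by (intro nat_poly_series_mult nat_poly_series_power nat_poly_series_X nat_poly_series_prod nat_poly_series_geo)
  moreover have "nat_poly_series (\<lambda>b. 2 * fps_X ^ e * (\<Prod>j\<in>S. geo (b j)))" for e S
    unfolding one_add_one[symmetric]
    by (intro nat_poly_series_mult nat_poly_series_add nat_poly_series_1 nat_poly_series_power
        nat_poly_series_X nat_poly_series_prod nat_poly_series_geo)
  ultimately show ?thesis unfolding row_coeff_def cayley_def hit_coeff_def by (cases "k = m"; cases hit) simp_all
qed

lemma nat_poly_series_pieri: "nat_poly_series (\<lambda>b. pieri_series n b mu lam)"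
proof (cases "interlaces mu lam")
  case True
  have "nat_poly_series (\<lambda>b. pieri_row n b mu lam k)" for k
  proof (cases "k = length mu + 1 \<and> part lam k = 0 \<and> even (n + length mu)")
    case True
    show ?thesis unfolding pieri_row_def if_P[OF True] by (rule nat_poly_series_1)
  next
    case False
    show ?thesis unfolding pieri_row_def if_not_P[OF False] by (rule nat_poly_series_row_coeff)
  qed
  then have "nat_poly_series (\<lambda>b. \<Prod>k=1..length mu + 1. pieri_row n b mu lam k)" by (rule nat_poly_series_prod)
  then show ?thesis using True by (simp only: pieri_series_def if_True)
next
  case False
  then show ?thesis by (simp add: pieri_series_def nat_poly_series_0)
qed

section \<open>Interlacing and border strips\<close>

lemma cells_iff:
  "(i, j) \<in> skew_shifted_diagram lam mu \<longleftrightarrow> 1 \<le> i \<and> part mu i + i \<le> j \<and> j < part lam i + i"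
  by (auto simp: skew_shifted_diagram_def shifted_diagram_def part_def)

lemma part_eq_0_iff: "strict_partition lam \<Longrightarrow> 1 \<le> k \<Longrightarrow> part lam k = 0 \<longleftrightarrow> length lam < k"
  unfolding strict_partition_def part_def by (auto dest!: bspec[OF _ nth_mem[of "k - 1" lam]])

lemma part_decreasing:
  assumes "strict_partition lam" "1 \<le> k" "part lam k > 0"
  shows "part lam (k + 1) < part lam k"
proof (cases "k + 1 \<le> length lam")
  case True
  then show ?thesis using assms sorted_wrt_nth_less[of "(>)" lam "k - 1" k]
    by (simp add: strict_partition_def part_def)
qed (use assms in \<open>simp add: part_def\<close>)

lemma diagram_subset_part:
  assumes "shifted_diagram mu \<subseteq> shifted_diagram lam" "1 \<le> k"
  shows "part mu k \<le> part lam k"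
proof (cases "part mu k = 0")
  case False
  then have "(k, part mu k + k - 1) \<in> shifted_diagram mu"
    using assms(2) by (auto simp: shifted_diagram_def part_def split: if_splits)
  then have "(k, part mu k + k - 1) \<in> shifted_diagram lam" using assms(1) by blast
  then show ?thesis using assms(2) by (auto simp: shifted_diagram_def)
qed simp

text \<open>
  A block in the rows \<open>i\<close> and \<open>i + 1\<close> forces \<open>\<lambda>\<^bsub>i+1\<^esub> > \<mu>\<^sub>i\<close>.
\<close>

lemma block_not_interlaces:
  assumes "strict_partition lam" "contains_block (skew_shifted_diagram lam mu)"
  shows "\<not> interlaces mu lam"
proof
  assume inter: "interlaces mu lam"
  obtain i j where ij: "(i, j) \<in> skew_shifted_diagram lam mu" "(i + 1, j + 1) \<in> skew_shifted_diagram lam mu"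
    using assms(2) unfolding contains_block_def by blast
  then have gt: "part lam (i + 1) > part mu i" "1 \<le> i" by (auto simp: cells_iff)
  then have "i + 1 \<le> length mu + 1"
    using inter part_eq_0_iff[OF assms(1), of "i + 1"] by (auto simp: interlaces_def)
  then have "i + 1 \<in> {1..length mu + 1}" by simp
  with inter have "1 < i + 1 \<longrightarrow> part lam (i + 1) \<le> part mu (i + 1 - 1)" unfolding interlaces_def by blast
  then have "part lam (i + 1) \<le> part mu i" using gt(2) by simp
  with gt show False by simp
qed

text \<open>
  If \<open>\<lambda>\<^bsub>i+1\<^esub> > \<mu>\<^sub>i > 0\<close>, then strictness puts a block with upper left cell in column \<open>\<mu>\<^sub>i + i\<close>
  into the rows \<open>i\<close> and \<open>i + 1\<close>. For \<open>\<mu>\<^sub>i = 0\<close> this cell would lie on the diagonal, which is why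
  the lengths have to be bounded.
\<close>

lemma no_block_interlaces:
  assumes lam: "strict_partition lam" and mu: "strict_partition mu"
    and sub: "shifted_diagram mu \<subseteq> shifted_diagram lam"
    and no_block: "\<not> contains_block (skew_shifted_diagram lam mu)" and len: "length lam \<le> length mu + 1"
  shows "interlaces mu lam"
  unfolding interlaces_def
proof (intro conjI ballI impI)
  fix k assume k: "k \<in> {1..length mu + 1}"
  then show "part mu k \<le> part lam k" using diagram_subset_part[OF sub] by simp
  assume k1: "1 < k"
  define i where "i = k - 1"
  have i: "k = i + 1" "1 \<le> i" "i \<le> length mu" using k k1 by (auto simp: i_def)
  have pos: "part mu i > 0" using part_eq_0_iff[OF mu i(2)] i(3) by simp
  show "part lam k \<le> part mu (k - 1)"
  proof (rule ccontr)
    assume "\<not> ?thesis"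
    then have gt: "part mu i < part lam (i + 1)" using i by simp
    have "part mu (i + 1) < part mu i" by (rule part_decreasing[OF mu i(2) pos])
    moreover have "part lam i \<noteq> 0"
      using gt part_eq_0_iff[OF lam, of "i + 1"] part_eq_0_iff[OF lam i(2)] by auto
    then have "part lam (i + 1) < part lam i" by (intro part_decreasing[OF lam i(2)]) simp
    ultimately have "{(i, part mu i + i), (i, part mu i + i + 1), (i + 1, part mu i + i), (i + 1, part mu i + i + 1)}
        \<subseteq> skew_shifted_diagram lam mu"
      using gt i(2) by (auto simp: cells_iff)
    then show False using no_block unfolding contains_block_def by blast
  qed
qed (rule len)

abbreviation (input) adj :: "(nat \<times> nat) set \<Rightarrow> ((nat \<times> nat) \<times> (nat \<times> nat)) set" where
  "adj D \<equiv> {(s, t). s \<in> D \<and> t \<in> D \<and> share_edge s t}"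

lemma share_edge_sym: "share_edge p q \<Longrightarrow> share_edge q p"
  by (cases p; cases q) auto

lemma component_closed:
  assumes "C \<in> cell_components D" "p \<in> C" "q \<in> D" "share_edge p q"
  shows "q \<in> C"
proof -
  obtain x where x: "C = edge_connected D `` {x}" using assms(1) by (auto simp: cell_components_def quotient_def)
  then have "x \<in> D" "p \<in> D" "(x, p) \<in> (adj D)\<^sup>*" using assms(2) by (auto simp: edge_connected_def)
  moreover have "(p, q) \<in> adj D" using assms(3,4) \<open>p \<in> D\<close> by simp
  ultimately show ?thesis using x assms(3) unfolding edge_connected_def by (auto intro: rtrancl_into_rtrancl)
qed

lemma Union_components: "\<Union> (cell_components D) = D"
  by (auto simp: cell_components_def quotient_def edge_connected_def)

lemma adj_path_closed:
  assumes "(p, q) \<in> (adj D)\<^sup>*" "p \<in> C" "\<And>s t. s \<in> C \<Longrightarrow> t \<in> D \<Longrightarrow> share_edge s t \<Longrightarrow> t \<in> C"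
  shows "q \<in> C"
  using assms(1,2) by (induction rule: rtrancl_induct) (use assms(3) in auto)

lemma components_eqI:
  assumes D: "D = \<Union> G"
    and conn: "\<And>C. C \<in> G \<Longrightarrow> C \<noteq> {} \<and> edge_connected C = C \<times> C"
    and closed: "\<And>C p q. C \<in> G \<Longrightarrow> p \<in> C \<Longrightarrow> q \<in> D \<Longrightarrow> share_edge p q \<Longrightarrow> q \<in> C"
  shows "cell_components D = G"
proof -
  have comp: "edge_connected D `` {p} = C" if C: "C \<in> G" "p \<in> C" for C p
  proof (intro equalityI subsetI)
    fix q assume "q \<in> edge_connected D `` {p}"
    then have "(p, q) \<in> (adj D)\<^sup>*" by (auto simp: edge_connected_def)
    then show "q \<in> C" by (rule adj_path_closed[OF _ C(2)]) (rule closed[OF C(1)])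
  next
    fix q assume q: "q \<in> C"
    have CD: "C \<subseteq> D" using C D by blast
    have "(p, q) \<in> edge_connected C" using conn[OF C(1)] C(2) q by simp
    then have "(p, q) \<in> (adj C)\<^sup>*" by (auto simp: edge_connected_def)
    moreover have "adj C \<subseteq> adj D" using CD by auto
    ultimately have "(p, q) \<in> (adj D)\<^sup>*" using rtrancl_mono by blast
    then show "q \<in> edge_connected D `` {p}" using C(2) q CD by (auto simp: edge_connected_def)
  qed
  show ?thesis
  proof (intro equalityI subsetI)
    fix C assume "C \<in> cell_components D"
    then obtain p where p: "p \<in> D" "C = edge_connected D `` {p}" by (auto simp: cell_components_def quotient_def)
    then obtain C' where "C' \<in> G" "p \<in> C'" using D by blast
    then show "C \<in> G" using comp p by simp
  next
    fix C assume C: "C \<in> G"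
    then obtain p where p: "p \<in> C" using conn by blast
    then have "p \<in> D" using C D by blast
    then show "C \<in> cell_components D"
      unfolding cell_components_def using quotientI[of p D "edge_connected D"] comp[OF C p] by simp
  qed
qed

context
  fixes lam mu :: "nat list"
  assumes lam: "strict_partition lam" and mu: "strict_partition mu" and inter: "interlaces mu lam"
begin

private abbreviation (input) "D \<equiv> skew_shifted_diagram lam mu"

text \<open>
  By \<open>vertical_edge\<close> and \<open>linked_edge\<close>, this holds exactly if the rows \<open>k\<close> and \<open>k + 1\<close> of \<open>S(\<lambda>/\<mu>)\<close>
  share an edge.
\<close>

definition linked :: "nat \<Rightarrow> bool" where
  "linked k \<longleftrightarrow> 1 \<le> k \<and> k \<le> length mu \<and> part lam (k + 1) = part mu k"

lemma row_range: "(k, j) \<in> D \<Longrightarrow> 1 \<le> k \<and> k \<le> length mu + 1"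
proof -
  assume "(k, j) \<in> D"
  then have "1 \<le> k" "part lam k \<noteq> 0" by (auto simp: cells_iff)
  then show ?thesis using part_eq_0_iff[OF lam, of k] inter by (auto simp: interlaces_def)
qed

lemma linked_rows:
  assumes "linked k"
  shows "part mu k < part lam k" "part mu (k + 1) < part lam (k + 1)"
proof -
  have k: "1 \<le> k" "part lam (k + 1) = part mu k" "part mu k > 0"
    using assms part_eq_0_iff[OF mu, of k] by (auto simp: linked_def)
  have "part lam k \<noteq> 0" using k part_eq_0_iff[OF lam, of k] part_eq_0_iff[OF lam, of "k + 1"] by auto
  then show "part mu k < part lam k" using part_decreasing[OF lam k(1)] k(2) by simp
  show "part mu (k + 1) < part lam (k + 1)" using part_decreasing[OF mu k(1) k(3)] k(2) by simp
qed

lemma vertical_edge: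
  assumes "(k, j) \<in> D" "(k + 1, j) \<in> D"
  shows "linked k"
proof -
  have k: "1 \<le> k" "k \<le> length mu" using row_range[OF assms(1)] row_range[OF assms(2)] by auto
  then have "part lam (k + 1) \<le> part mu k"
    using inter unfolding interlaces_def by (auto dest!: bspec[of _ _ "k + 1"])
  then show "linked k" using assms k by (auto simp: cells_iff linked_def)
qed

lemma linked_edge:
  assumes "linked k"
  shows "(k, part mu k + k) \<in> D" "(k + 1, part mu k + k) \<in> D"
  using assms linked_rows[OF assms] by (auto simp: cells_iff linked_def)

text \<open>
  Every cell is joined to the first cell of its row, which lies above the last cell of the next
  row; so every cell is joined to the first cell of row \<open>M\<close>.
\<close>

lemma strip_connected:
  assumes links: "\<And>k. m \<le> k \<Longrightarrow> k < M \<Longrightarrow> linked k"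
    and last: "1 \<le> M" "part mu M < part lam M"
  defines "R \<equiv> rows m M D"
  shows "edge_connected R = R \<times> R"
proof -
  have sym: "sym (adj R)" by (auto simp: sym_def dest: share_edge_sym)
  have row: "((k, part mu k + k + d), (k, part mu k + k)) \<in> (adj R)\<^sup>*"
    if "(k, part mu k + k + d) \<in> R" for k d
    using that
  proof (induction d)
    case (Suc d)
    then have "(k, part mu k + k + d) \<in> R" by (auto simp: R_def rows_def cells_iff)
    then have "((k, part mu k + k + Suc d), (k, part mu k + k + d)) \<in> adj R" using Suc.prems by simp
    then show ?case using Suc.IH[OF \<open>(k, part mu k + k + d) \<in> R\<close>] by (rule converse_rtrancl_into_rtrancl)
  qed simp
  have end_row: "((k, part mu k + k), (M, part mu M + M)) \<in> (adj R)\<^sup>*" if "m \<le> k" "k \<le> M" for k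
    using that(2,1)
  proof (induction k rule: inc_induct)
    case (step k)
    have l: "linked k" using links step by simp
    have R: "(k, part mu k + k) \<in> R" "(k + 1, part mu k + k) \<in> R"
      using linked_edge[OF l] step by (auto simp: R_def rows_def)
    have "((k, part mu k + k), (k + 1, part mu k + k)) \<in> adj R" using R by simp
    also have "((k + 1, part mu k + k), (k + 1, part mu (k + 1) + (k + 1))) \<in> (adj R)\<^sup>*"
    proof -
      have "part mu (k + 1) + (k + 1) \<le> part mu k + k" using R(2) by (auto simp: R_def rows_def cells_iff)
      then obtain d where d: "part mu k + k = part mu (k + 1) + (k + 1) + d" by (metis le_iff_add)
      show ?thesis using row[of "k + 1" d] R(2) unfolding d by simp
    qed
    also have "((k + 1, part mu (k + 1) + (k + 1)), (M, part mu M + M)) \<in> (adj R)\<^sup>*"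
      using step by simp
    finally show ?case .
  qed simp
  have to_end: "(p, (M, part mu M + M)) \<in> (adj R)\<^sup>*" if "p \<in> R" for p
  proof -
    obtain k j where p: "p = (k, j)" by (cases p)
    then have k: "m \<le> k" "k \<le> M" "part mu k + k \<le> j" using that by (auto simp: R_def rows_def cells_iff)
    then obtain d where d: "j = part mu k + k + d" by (metis le_iff_add)
    show ?thesis using row[of k d] end_row[OF k(1,2)] that unfolding p d by (auto intro: rtrancl_trans)
  qed
  have "(p, q) \<in> (adj R)\<^sup>*" if "p \<in> R" "q \<in> R" for p q
    using to_end[OF that(1)] symD[OF sym_rtrancl[OF sym] to_end[OF that(2)]] by (rule rtrancl_trans)
  then show ?thesis by (auto simp: edge_connected_def)
qed

text \<open>
  Inside a strip, connectedness forces an edge between any two consecutive rows. The row above the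
  strip is not linked to it, for otherwise the component would extend to that row.
\<close>

lemma decomposition_rows:
  assumes dec: "border_strip_decomposition lam mu r m M" and i: "i \<in> {1..r}"
  shows "1 \<le> m i" "m i \<le> M i" "M i \<le> length mu + 1"
    "\<And>k. m i \<le> k \<Longrightarrow> k \<le> M i \<Longrightarrow> part mu k < part lam k"
    "\<And>k. m i \<le> k \<Longrightarrow> k < M i \<Longrightarrow> part lam (k + 1) = part mu k"
    "1 < m i \<Longrightarrow> part lam (m i) \<noteq> part mu (m i - 1)"
proof -
  define R where "R = rows (m i) (M i) D"
  have d: "m i \<le> M i" "edge_connected R = R \<times> R" "fst ` R = {m i..M i}" "R \<in> cell_components D"
    using dec i unfolding border_strip_decomposition_def Let_def border_strip_def R_def by auto
  show mM: "m i \<le> M i" by fact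
  have cell: "\<exists>j. (k, j) \<in> R" if "m i \<le> k" "k \<le> M i" for k
  proof -
    have "k \<in> fst ` R" using d(3) that by simp
    then show ?thesis by force
  qed
  have RD: "p \<in> R \<Longrightarrow> p \<in> D" for p by (auto simp: R_def rows_def)
  show "1 \<le> m i" using cell[of "m i"] mM RD row_range by blast
  show "M i \<le> length mu + 1" using cell[of "M i"] mM RD row_range by blast
  show "part mu k < part lam k" if "m i \<le> k" "k \<le> M i" for k
    using cell[OF that] RD by (fastforce simp: cells_iff)
  show "part lam (k + 1) = part mu k" if k: "m i \<le> k" "k < M i" for k
  proof -
    have "\<exists>j. (k, j) \<in> R \<and> (k + 1, j) \<in> R"
    proof (rule ccontr)
      assume no: "\<not> ?thesis"
      obtain j j' where jj: "(k, j) \<in> R" "(k + 1, j') \<in> R" using cell[of k] cell[of "k + 1"] k by auto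
      then have "((k, j), (k + 1, j')) \<in> (adj R)\<^sup>*" using d(2) by (auto simp: edge_connected_def)
      moreover have "(k, j) \<in> {p \<in> R. fst p \<le> k}" using jj by simp
      ultimately have "(k + 1, j') \<in> {p \<in> R. fst p \<le> k}"
      proof (rule adj_path_closed)
        fix s t assume st: "s \<in> {p \<in> R. fst p \<le> k}" "t \<in> R" "share_edge s t"
        obtain a b a' b' where ab: "s = (a, b)" "t = (a', b')" by (cases s, cases t)
        show "t \<in> {p \<in> R. fst p \<le> k}"
        proof (rule ccontr)
          assume "\<not> ?thesis"
          then have "a = k" "a' = k + 1" "b = b'" using st ab by auto
          then show False using no st ab by auto
        qed
      qed
      then show False by simp
    qed
    then obtain j where "(k, j) \<in> D" "(k + 1, j) \<in> D" using RD by blast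
    then show ?thesis using vertical_edge by (simp add: linked_def)
  qed
  show "part lam (m i) \<noteq> part mu (m i - 1)" if "1 < m i"
  proof
    assume eq: "part lam (m i) = part mu (m i - 1)"
    define k where "k = m i - 1"
    have k: "m i = k + 1" "1 \<le> k" "k \<le> length mu" using that \<open>M i \<le> length mu + 1\<close> mM by (auto simp: k_def)
    then have l: "linked k" using eq by (simp add: linked_def)
    note e = linked_edge[OF l]
    have "(k + 1, part mu k + k) \<in> R" using e(2) k mM by (simp add: R_def rows_def)
    then have "(k, part mu k + k) \<in> R"
      by (rule component_closed[OF d(4)]) (use e in auto)
    then show False using k by (simp add: R_def rows_def)
  qed
qed

lemma decomposition_cover:
  assumes dec: "border_strip_decomposition lam mu r m M" and k: "1 \<le> k" "part mu k < part lam k"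
  shows "\<exists>i\<in>{1..r}. k \<in> {m i..M i}"
proof -
  have "(k, part mu k + k) \<in> D" using k by (auto simp: cells_iff)
  then obtain C where "C \<in> cell_components D" "(k, part mu k + k) \<in> C" using Union_components by blast
  then show ?thesis using dec unfolding border_strip_decomposition_def Let_def by (auto simp: rows_def)
qed

text \<open>
  The strips are the maximal intervals of linked rows, a nonempty row without links being one by
  itself.
\<close>

definition strip_starts :: "nat set" where
  "strip_starts = {k \<in> {1..length mu + 1}. part mu k < part lam k \<and> \<not> linked (k - 1)}"

definition strip_end :: "nat \<Rightarrow> nat" where
  "strip_end s = Max {e. s \<le> e \<and> e \<le> length mu + 1 \<and> (\<forall>k\<in>{s..<e}. linked k)}"

lemma strip_end_props:
  assumes "s \<in> strip_starts"
  shows "s \<le> strip_end s" "strip_end s \<le> length mu + 1"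
    "\<And>k. s \<le> k \<Longrightarrow> k < strip_end s \<Longrightarrow> linked k" "\<not> linked (strip_end s)"
    "\<And>e. s \<le> e \<Longrightarrow> e \<le> length mu + 1 \<Longrightarrow> (\<And>k. s \<le> k \<Longrightarrow> k < e \<Longrightarrow> linked k) \<Longrightarrow> e \<le> strip_end s"
proof -
  let ?E = "{e. s \<le> e \<and> e \<le> length mu + 1 \<and> (\<forall>k\<in>{s..<e}. linked k)}"
  have fin: "finite ?E" by (rule finite_subset[of _ "{..length mu + 1}"]) auto
  have "s \<in> ?E" using assms by (auto simp: strip_starts_def)
  then have E: "strip_end s \<in> ?E" unfolding strip_end_def using fin by (intro Max_in) auto
  then show a: "s \<le> strip_end s" "strip_end s \<le> length mu + 1"
    and b: "\<And>k. s \<le> k \<Longrightarrow> k < strip_end s \<Longrightarrow> linked k" by auto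
  show max: "e \<le> strip_end s" if "s \<le> e" "e \<le> length mu + 1" "\<And>k. s \<le> k \<Longrightarrow> k < e \<Longrightarrow> linked k" for e
    unfolding strip_end_def by (rule Max_ge[OF fin]) (use that in auto)
  show "\<not> linked (strip_end s)"
  proof
    assume l: "linked (strip_end s)"
    then have "strip_end s + 1 \<le> length mu + 1" using linked_def by auto
    then have "strip_end s + 1 \<le> strip_end s" using a b l by (intro max) (auto simp: less_Suc_eq)
    then show False by simp
  qed
qed

lemma strip_rows_nonempty:
  assumes "s \<in> strip_starts" "s \<le> k" "k \<le> strip_end s"
  shows "part mu k < part lam k"
proof (cases "k = s")
  case True
  then show ?thesis using assms by (simp add: strip_starts_def)
next
  case False
  then have "linked (k - 1)" using assms by (intro strip_end_props(3)) auto
  from linked_rows(2)[OF this] show ?thesis using False assms by simp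
qed

lemma strip_starts_separated:
  assumes "s \<in> strip_starts" "s' \<in> strip_starts" "s < s'"
  shows "strip_end s < s'"
proof (rule ccontr)
  assume "\<not> ?thesis"
  then have "linked (s' - 1)" using assms by (intro strip_end_props(3)) auto
  then show False using assms(2) by (simp add: strip_starts_def)
qed

lemma strip_of_row:
  assumes k: "k \<in> {1..length mu + 1}" "part mu k < part lam k"
  shows "\<exists>s\<in>strip_starts. s \<le> k \<and> k \<le> strip_end s"
proof -
  let ?P = "\<lambda>s. 1 \<le> s \<and> s \<le> k \<and> (\<forall>i\<in>{s..<k}. linked i)"
  define s where "s = (LEAST s. ?P s)"
  have "?P k" using k by auto
  then have s: "?P s" unfolding s_def by (rule LeastI)
  have "\<not> linked (s - 1)"
  proof
    assume l: "linked (s - 1)"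
    then have "1 \<le> s - 1" using linked_def by simp
    moreover have "\<forall>i\<in>{s - 1..<k}. linked i"
    proof
      fix i assume "i \<in> {s - 1..<k}"
      then show "linked i" using s l by (cases "i = s - 1") auto
    qed
    ultimately have "?P (s - 1)" using s by auto
    then have "s \<le> s - 1" unfolding s_def by (rule Least_le)
    with \<open>1 \<le> s - 1\<close> show False by simp
  qed
  moreover have "part mu s < part lam s"
  proof (cases "s = k")
    case False
    then have "linked s" using s by auto
    then show ?thesis by (rule linked_rows(1))
  qed (use k in simp)
  ultimately have "s \<in> strip_starts" using s k by (auto simp: strip_starts_def)
  moreover have "k \<le> strip_end s"
    by (rule strip_end_props(5)[OF \<open>s \<in> strip_starts\<close>]) (use s k in auto)
  ultimately show ?thesis using s by blast
qed

lemma strip_components: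
  "cell_components D = (\<lambda>s. rows s (strip_end s) D) ` strip_starts"
proof (rule components_eqI)
  show "D = \<Union> ((\<lambda>s. rows s (strip_end s) D) ` strip_starts)"
  proof (intro equalityI subsetI)
    fix p assume p: "p \<in> D"
    obtain k j where kj: "p = (k, j)" by (cases p)
    then have "k \<in> {1..length mu + 1}" "part mu k < part lam k"
      using p row_range[of k j] by (auto simp: cells_iff)
    from strip_of_row[OF this] show "p \<in> \<Union> ((\<lambda>s. rows s (strip_end s) D) ` strip_starts)"
      using p kj by (auto simp: rows_def)
  qed (auto simp: rows_def)
next
  fix C assume "C \<in> (\<lambda>s. rows s (strip_end s) D) ` strip_starts"
  then obtain s where s: "s \<in> strip_starts" "C = rows s (strip_end s) D" by auto
  note E = strip_end_props[OF s(1)]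
  have s1: "1 \<le> s" using s(1) by (simp add: strip_starts_def)
  have "(s, part mu s + s) \<in> C"
    using s E(1) s1 by (auto simp: rows_def cells_iff strip_starts_def)
  moreover have "edge_connected C = C \<times> C" unfolding s(2)
    by (rule strip_connected[OF E(3)]) (use s1 E(1) strip_rows_nonempty[OF s(1)] in auto)
  ultimately show "C \<noteq> {} \<and> edge_connected C = C \<times> C" by blast
  show "q \<in> C" if pq: "p \<in> C" "q \<in> D" "share_edge p q" for p q
  proof -
    obtain k j k' j' where kj: "p = (k, j)" "q = (k', j')" by (cases p, cases q)
    have pD: "(k, j) \<in> D" "s \<le> k" "k \<le> strip_end s" using pq(1) kj s by (auto simp: rows_def)
    have qD: "(k', j') \<in> D" using pq(2) kj by simp
    have "s \<le> k' \<and> k' \<le> strip_end s"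
    proof (cases "k' = k")
      case False
      then have j: "j' = j" "k' = k + 1 \<or> k = k' + 1" using pq(3) kj by auto
      from j(2) show ?thesis
      proof
        assume k': "k' = k + 1"
        then have "linked k" using vertical_edge[of k j] pD qD j by simp
        then have "k \<noteq> strip_end s" using E(4) by auto
        then show ?thesis using pD k' by simp
      next
        assume k': "k = k' + 1"
        then have "linked k'" using vertical_edge[of k' j] pD qD j by simp
        then have "k \<noteq> s" using s(1) k' by (auto simp: strip_starts_def)
        then show ?thesis using pD k' by simp
      qed
    qed (use pD in simp)
    then show ?thesis using qD kj s by (simp add: rows_def)
  qed
qed

lemma decomposition_exists:
  assumes no_block: "\<not> contains_block D"
  shows "\<exists>r m M. border_strip_decomposition lam mu r m M"
proof -
  define xs where "xs = sorted_list_of_set strip_starts"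
  have fin: "finite strip_starts" by (simp add: strip_starts_def)
  have xs: "set xs = strip_starts" "sorted_wrt (<) xs" using fin by (simp_all add: xs_def)
  define m where "m = (\<lambda>i. xs ! (i - 1))"
  have m: "m i \<in> strip_starts" if "i \<in> {1..length xs}" for i
  proof -
    have "i - 1 < length xs" using that by auto
    then have "xs ! (i - 1) \<in> set xs" by (rule nth_mem)
    then show ?thesis unfolding m_def xs(1) .
  qed
  have m_less: "m i < m (i + 1)" if "i \<in> {1..<length xs}" for i
  proof -
    have "i - 1 < i" "i < length xs" using that by auto
    then have "xs ! (i - 1) < xs ! i" by (rule sorted_wrt_nth_less[OF xs(2)])
    then show ?thesis by (simp add: m_def)
  qed
  have m_img: "m ` {1..length xs} = strip_starts"
  proof (intro equalityI subsetI)
    fix s assume "s \<in> strip_starts"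
    then obtain p where "p < length xs" "xs ! p = s" using xs(1) by (metis in_set_conv_nth)
    then show "s \<in> m ` {1..length xs}" by (intro image_eqI[of _ _ "p + 1"]) (auto simp: m_def)
  qed (use m in auto)
  have strip: "border_strip (rows s (strip_end s) D) \<and> fst ` rows s (strip_end s) D = {s..strip_end s}"
    if s: "s \<in> strip_starts" for s
  proof -
    let ?R = "rows s (strip_end s) D"
    note E = strip_end_props[OF s]
    have s1: "1 \<le> s" using s by (simp add: strip_starts_def)
    have cell: "(k, part mu k + k) \<in> ?R" if "s \<le> k" "k \<le> strip_end s" for k
      using that strip_rows_nonempty[OF s that] s1 by (auto simp: rows_def cells_iff)
    have "edge_connected ?R = ?R \<times> ?R"
      by (rule strip_connected[OF E(3)]) (use s1 E(1) strip_rows_nonempty[OF s] in auto)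
    moreover have "\<not> contains_block ?R"
    proof
      assume "contains_block ?R"
      moreover have "?R \<subseteq> D" by (auto simp: rows_def)
      ultimately show False using no_block unfolding contains_block_def by (meson subset_trans)
    qed
    moreover have "?R \<noteq> {}" using cell[of s] E(1) by blast
    moreover have "fst ` ?R = {s..strip_end s}"
    proof (intro equalityI subsetI)
      fix k assume "k \<in> {s..strip_end s}"
      then have "(k, part mu k + k) \<in> ?R" by (intro cell) auto
      then show "k \<in> fst ` ?R" by force
    qed (auto simp: rows_def)
    ultimately show ?thesis unfolding border_strip_def by blast
  qed
  have "cell_components D = (\<lambda>i. rows (m i) (strip_end (m i)) D) ` {1..length xs}"
    unfolding strip_components m_img[symmetric] image_image ..
  moreover have "\<forall>i\<in>{1..<length xs}. strip_end (m i) < m (i + 1)"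
  proof
    fix i assume i: "i \<in> {1..<length xs}"
    then have "i \<in> {1..length xs}" "i + 1 \<in> {1..length xs}" by simp_all
    then show "strip_end (m i) < m (i + 1)" using m_less[OF i] by (intro strip_starts_separated m)
  qed
  moreover have "\<forall>i\<in>{1..length xs}. m i \<le> strip_end (m i)"
    by (intro ballI strip_end_props(1) m)
  moreover have "\<forall>i\<in>{1..length xs}. border_strip (rows (m i) (strip_end (m i)) D) \<and>
      fst ` rows (m i) (strip_end (m i)) D = {m i..strip_end (m i)}"
    by (intro ballI strip m)
  ultimately have "border_strip_decomposition lam mu (length xs) m (\<lambda>i. strip_end (m i))"
    unfolding border_strip_decomposition_def Let_def by (intro conjI)
  then show ?thesis by blast
qed

end

section \<open>The product over border strips\<close>

abbreviation (input) strip_factor :: "(nat \<Rightarrow> 'a::field) \<Rightarrow> nat \<Rightarrow> nat \<Rightarrow> 'a fps"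
  where "strip_factor a p q \<equiv> 2 * fps_X ^ (q - p) * (\<Prod>j=p..q. geo (a j))"

text \<open>
  Row \<open>m\<close> contributes the factors for \<open>\<mu>\<^sub>m \<le> j \<le> \<lambda>\<^sub>m\<close> and the only factor \<open>2\<close>. Each later row \<open>k\<close>
  has \<open>\<lambda>\<^sub>k = \<mu>\<^bsub>k-1\<^esub>\<close> and contributes those for \<open>\<mu>\<^sub>k \<le> j < \<mu>\<^bsub>k-1\<^esub>\<close>, which extends the range
  downwards.
\<close>

lemma hit_product:
  assumes "m \<le> M" "\<And>k. m \<le> k \<Longrightarrow> k \<le> M \<Longrightarrow> part mu k < part lam k"
    and "\<And>k. m \<le> k \<Longrightarrow> k < M \<Longrightarrow> part lam (k + 1) = part mu k"
    and first: "\<not> (1 < m \<and> part lam m = part mu (m - 1))" and m: "1 \<le> m"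
  shows "(\<Prod>k=m..M. row_factor a mu lam k) =
    strip_factor a (part mu M) (part lam m) \<and> part mu M < part lam m"
  using assms(1-3)
proof (induction M rule: dec_induct)
  case base
  then have lt: "part mu m < part lam m" by simp
  have "row_coeff a (1 < m \<and> part lam m = part mu (m - 1)) (part mu m) (part lam m) =
      row_coeff a False (part mu m) (part lam m)"
    using first by (simp only: eq_False[symmetric])
  then show ?case using lt by (simp add: row_coeff_def)
next
  case (step M)
  let ?q = "part mu M" and ?p = "part mu (Suc M)" and ?l = "part lam m"
  have IH: "(\<Prod>k=m..M. row_factor a mu lam k) =
    2 * fps_X ^ (?l - ?q) * (\<Prod>j=?q..?l. geo (a j))" "?q < ?l"
    using step by auto
  have eq: "part lam (Suc M) = ?q" using step.prems(2)[of M] step.hyps by simp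
  have lt: "?p < ?q" using step.prems(1)[of "Suc M"] step.hyps eq by simp
  have M: "1 < Suc M" using m step.hyps by simp
  have "{?p..?l} = {?p..<?q} \<union> {?q..?l}" using lt IH(2) by auto
  then have geo_split: "(\<Prod>j=?p..?l. geo (a j)) = (\<Prod>j=?p..<?q. geo (a j)) * (\<Prod>j=?q..?l. geo (a j))"
    by (simp only:) (rule prod.union_disjoint, auto)
  have X_split: "fps_X ^ (?l - ?p) = fps_X ^ (?l - ?q) * (fps_X :: 'a fps) ^ (?q - ?p)"
    unfolding power_add[symmetric] using lt IH(2) by simp
  have "(\<Prod>k=m..Suc M. row_factor a mu lam k) =
      (2 * fps_X ^ (?l - ?q) * (\<Prod>j=?q..?l. geo (a j))) * row_coeff a True ?p ?q"
    using step.hyps IH(1) M eq by simp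
  also have "\<dots> = 2 * fps_X ^ (?l - ?p) * (\<Prod>j=?p..?l. geo (a j))"
    unfolding geo_split X_split using lt by (simp add: row_coeff_def hit_coeff_def mult_ac)
  finally show ?case using lt IH(2) by simp
qed

lemma div_prod_lin:
  "F / (\<Prod>j\<in>S. lin (a j)) = F * (\<Prod>j\<in>S. geo (a j))"
proof -
  have 1: "(\<Prod>j\<in>S. geo (a j)) * (\<Prod>j\<in>S. lin (a j)) = 1" by (simp add: prod.distrib[symmetric])
  have 0: "fps_nth (\<Prod>j\<in>S. lin (a j)) 0 \<noteq> 0" using arg_cong[OF 1, of "\<lambda>F. fps_nth F 0"] by auto
  have "inverse (\<Prod>j\<in>S. lin (a j)) = (\<Prod>j\<in>S. geo (a j))"
    using 0 1 by (metis fps_inverse_unique mult.commute)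
  then show ?thesis using 0 by (simp add: fps_divide_unit)
qed

text \<open>
  The rows with \<open>\<lambda>\<^sub>k = \<mu>\<^sub>k\<close> give the product over \<open>K\<close>. For even \<open>n + l(\<mu>)\<close> the row \<open>l(\<mu>) + 1\<close> is
  not in \<open>K\<close>, and if it is empty, its factor is \<open>1\<close>. The remaining rows are partitioned by the
  strips.
\<close>

lemma pieri_series_strips:
  assumes lam: "strict_partition lam" and mu: "strict_partition mu" and inter: "interlaces mu lam"
    and dec: "border_strip_decomposition lam mu r m M"
  shows "pieri_series n a mu lam =
    (\<Prod>k\<in>K_set n mu lam. cayley (a (part mu k))) *
    (\<Prod>i=1..r. strip_factor a (part mu (M i)) (part lam (m i)))"
proof -
  let ?rows = "{1..length mu + 1}" and ?P = "pieri_row n a mu lam"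
  define Fix where "Fix = {k \<in> ?rows. part lam k = part mu k}"
  define Move where "Move = {k \<in> ?rows. part mu k < part lam k}"
  note dr = decomposition_rows[OF lam mu inter dec]
  have sep: "M i < m i'" if "i < i'" "i \<in> {1..r}" "i' \<in> {1..r}" for i i'
    using that
  proof (induction i')
    case (Suc i')
    have step: "M i' < m (Suc i')" if "i' \<in> {1..<r}"
      using dec that unfolding border_strip_decomposition_def Let_def by auto
    show ?case
    proof (cases "i = i'")
      case False
      then have "M i < m i'" using Suc by auto
      also have "\<dots> \<le> M i'" using Suc.prems False by (intro dr(2)) auto
      also have "\<dots> < m (Suc i')" using Suc.prems False by (intro step) auto
      finally show ?thesis .
    qed (use step Suc.prems in auto)
  qed simp
  have "?rows = Fix \<union> Move"
    using inter by (auto simp: Fix_def Move_def interlaces_def order.order_iff_strict)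
  then have "pieri_series n a mu lam = (\<Prod>k\<in>Fix \<union> Move. ?P k)"
    using inter by (simp only: pieri_series_def if_True)
  also have "\<dots> = (\<Prod>k\<in>Fix. ?P k) * (\<Prod>k\<in>Move. ?P k)"
    by (rule prod.union_disjoint) (auto simp: Fix_def Move_def)
  also have "(\<Prod>k\<in>Fix. ?P k) = (\<Prod>k\<in>K_set n mu lam. cayley (a (part mu k)))"
  proof (rule prod.mono_neutral_cong_right)
    have "part mu (length mu + 1) = 0" by (simp add: part_def)
    then show "\<forall>k\<in>Fix - K_set n mu lam. ?P k = 1"
      by (auto simp: Fix_def K_set_def pieri_row_def le_Suc_eq split: if_splits)
    show "?P k = cayley (a (part mu k))" if "k \<in> K_set n mu lam" for k
      using that by (auto simp: K_set_def pieri_row_def row_coeff_def split: if_splits)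
  qed (auto simp: Fix_def K_set_def split: if_splits)
  also have "(\<Prod>k\<in>Move. ?P k) = (\<Prod>i=1..r. \<Prod>k=m i..M i. ?P k)"
  proof -
    have "Move = (\<Union>i\<in>{1..r}. {m i..M i})"
    proof (intro equalityI subsetI)
      fix k assume "k \<in> Move"
      then show "k \<in> (\<Union>i\<in>{1..r}. {m i..M i})"
        using decomposition_cover[OF lam mu inter dec, of k] by (auto simp: Move_def)
    next
      fix k assume "k \<in> (\<Union>i\<in>{1..r}. {m i..M i})"
      then obtain i where i: "i \<in> {1..r}" "m i \<le> k" "k \<le> M i" by auto
      then show "k \<in> Move" using dr(1,3)[OF i(1)] dr(4)[OF i] by (auto simp: Move_def)
    qed
    moreover have "{m i..M i} \<inter> {m i'..M i'} = {}" if "i \<in> {1..r}" "i' \<in> {1..r}" "i \<noteq> i'" for i i'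
      using sep[of i i'] sep[of i' i] that by (cases "i < i'") auto
    ultimately show ?thesis by (simp only:) (rule prod.UNION_disjoint, auto)
  qed
  also have "(\<Prod>i=1..r. \<Prod>k=m i..M i. ?P k) = (\<Prod>i=1..r. strip_factor a (part mu (M i)) (part lam (m i)))"
  proof (rule prod.cong[OF refl])
    fix i assume i: "i \<in> {1..r}"
    have "(\<Prod>k=m i..M i. ?P k) =
        (\<Prod>k=m i..M i. row_factor a mu lam k)"
    proof (rule prod.cong[OF refl])
      fix k assume "k \<in> {m i..M i}"
      then have "part lam k \<noteq> 0" using dr(4)[OF i, of k] by auto
      then show "?P k = row_factor a mu lam k"
        by (simp add: pieri_row_def)
    qed
    also have "\<dots> = strip_factor a (part mu (M i)) (part lam (m i))"
      by (rule conjunct1[OF hit_product]) (use dr[OF i] in auto)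
    finally show "(\<Prod>k=m i..M i. ?P k) = strip_factor a (part mu (M i)) (part lam (m i))" .
  qed
  finally show ?thesis .
qed

theorem theorem6p6:
  fixes n :: nat and a :: "nat \<Rightarrow> 'a::field_char_0" and lam mu :: "nat list"
  assumes lam: "strict_partition lam" "length lam \<le> n"
    and mu: "strict_partition mu" "length mu \<le> n"
  shows
    "(shifted_diagram mu \<subseteq> shifted_diagram lam \<and>
        contains_block (skew_shifted_diagram lam mu) \<longrightarrow>
        pieri_gf n a mu lam = 0) \<and>
     (shifted_diagram mu \<subseteq> shifted_diagram lam \<and>
        \<not> contains_block (skew_shifted_diagram lam mu) \<and> length lam \<ge> length mu + 2 \<longrightarrow>
        pieri_gf n a mu lam = 0) \<and>
     (shifted_diagram mu \<subseteq> shifted_diagram lam \<and>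
        \<not> contains_block (skew_shifted_diagram lam mu) \<and> length lam \<le> length mu + 1 \<longrightarrow>
        (\<exists>r m M. border_strip_decomposition lam mu r m M) \<and>
        (\<forall>r m M. border_strip_decomposition lam mu r m M \<longrightarrow>
          pieri_gf n a mu lam =
            (\<Prod>k\<in>K_set n mu lam.
               (1 + fps_const (a (part mu k)) * fps_X) / (1 - fps_const (a (part mu k)) * fps_X)) *
            (\<Prod>i=1..r.
               (2 * fps_X ^ (part lam (m i) - part mu (M i))) /
               (\<Prod>j=part mu (M i)..part lam (m i). (1 - fps_const (a j) * fps_X))))) \<and>
     (\<forall>r. \<exists>p :: (nat \<Rightarrow>\<^sub>0 nat) \<Rightarrow>\<^sub>0 nat. \<forall>b :: nat \<Rightarrow> 'a.
        pieri_coeff n b mu r lam = eval_nat_poly p b)"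
proof -
  have gf: "pieri_gf n a mu lam = pieri_series n a mu lam"
    by (rule pieri_gf_eq[OF mu lam])
  have zero: "pieri_gf n a mu lam = 0" if "\<not> interlaces mu lam"
    using that by (simp add: gf pieri_series_def)
  show ?thesis
  proof (intro conjI impI allI; (elim conjE)?)
    assume "contains_block (skew_shifted_diagram lam mu)"
    then show "pieri_gf n a mu lam = 0" by (intro zero block_not_interlaces[OF lam(1)])
  next
    assume "length lam \<ge> length mu + 2"
    then show "pieri_gf n a mu lam = 0" by (intro zero) (simp add: interlaces_def)
  next
    assume "shifted_diagram mu \<subseteq> shifted_diagram lam" "\<not> contains_block (skew_shifted_diagram lam mu)"
      "length lam \<le> length mu + 1"
    then show "\<exists>r m M. border_strip_decomposition lam mu r m M"
      by (intro decomposition_exists no_block_interlaces lam mu)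
  next
    fix r m M
    assume "shifted_diagram mu \<subseteq> shifted_diagram lam" "\<not> contains_block (skew_shifted_diagram lam mu)"
      "length lam \<le> length mu + 1" and dec: "border_strip_decomposition lam mu r m M"
    then have inter: "interlaces mu lam" by (intro no_block_interlaces lam mu)
    show "pieri_gf n a mu lam =
            (\<Prod>k\<in>K_set n mu lam.
               (1 + fps_const (a (part mu k)) * fps_X) / (1 - fps_const (a (part mu k)) * fps_X)) *
            (\<Prod>i=1..r.
               (2 * fps_X ^ (part lam (m i) - part mu (M i))) /
               (\<Prod>j=part mu (M i)..part lam (m i). (1 - fps_const (a j) * fps_X)))"
      unfolding gf pieri_series_strips[OF lam(1) mu(1) inter dec]
      by (simp add: div_lin div_prod_lin cayley_def)
  next
    fix r
    have "nat_polynomial (\<lambda>b :: nat \<Rightarrow> 'a. fps_nth (pieri_series n b mu lam) r)"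
      using nat_poly_series_pieri unfolding nat_poly_series_def by blast
    then show "\<exists>p. \<forall>b :: nat \<Rightarrow> 'a. pieri_coeff n b mu r lam = eval_nat_poly p b"
      unfolding nat_polynomial_def by (simp add: pieri_coeff_eq[OF mu] lam)
  qed
qed

end
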